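(* Let $K$ be a commutative ring with unit which is an integral domain, let $d\ge 1$, let $W\le S_d$ be a permutation group with $|W|\in U(K)$, let $\chi\colon W\to U(K)$ be a group homomorphism, and let $E$ be a $K$-module with finite basis $(e_\ell)_{\ell=1}^n$, with dual basis $(e_\ell^* )_{\ell=1}^n$ of $E^*$. (i) The formula $$B\colon[\chi]^d(E)\times[\chi^{-1}]^d(E^* )\to K,\qquad B(x_1\chi\ldots\chi x_d,\ x_1^*\chi^{-1}\ldots\chi^{-1}x_d^* )=d_\chi^W\big((\langle x_i,x_j^*\rangle)_{i,j=1}^d\big)$$ and (in degree $0$) the formula $B\colon[\chi]^0(E)\times[\chi^{-1}]^0(E^* )\to K$, $B(k,k^* )=kk^*$, define non-singular bilinear forms. (ii) Let $\iota_E^{(d)}\colon[\chi^{-1}]^d(E^* )\to([\chi]^d(E))^*$ (resp. $\iota^{(0)}\colon[\chi^{-1}]^0(E^* )\to([\chi]^0(E))^*$) be the isomorphism of $K$-modules associated with the bilinear form $B$ in degree $d$ (resp. in degree $0$), i.e. $y\mapsto B(\cdot,y)$. Then the family $\iota^{(d)}=(\iota_E^{(d)})_{E\in Ob(\mathcal F)}$ (resp. $\iota^{(0)}$) is an isomorphism of functors $[\chi^{-1}]^d(-^* )\to([\chi]^d(-))^*$ (resp. $[\chi^{-1}]^0(-^* )\to([\chi]^0(-))^*$) on the category $\mathcal F$ of $K$-modules with finite bases. (iii) After the identification of $[\chi^{-1}]^d(E^* )$ with $([\chi]^d(E))^*$ via $\iota^{(d)}$, $B$ is the canonical bilinear form of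 the $K$-module $[\chi]^d(E)$, and the bases $(e_j)_{j\in J}$ of $[\chi]^d(E)$ and $\big(\tfrac{1}{|W_j|}e_j^*\big)_{j\in J}$ of $[\chi^{-1}]^d(E^* )$ are dual.
   Context: $U(K)$ is the group of units of $K$. For a $K$-module $M$, $M^*$ is its dual; the canonical bilinear form of $M$ is $M\times M^*\to K$, $\langle x,x^*\rangle=x^*(x)$. A bilinear form $M\times N\to K$ is non-singular if the associated map $N\to M^*$ is an isomorphism. $S_d$ acts on $T^d(E)$ by $\sigma(x_1\otimes\cdots\otimes x_d)=x_{\sigma^{-1}(1)}\otimes\cdots\otimes x_{\sigma^{-1}(d)}$. For a character $\chi$ of $W\le S_d$, $[\chi]^d(E)$ is the quotient of $T^d(E)$ by the submodule generated by all $\chi(\sigma)^{-1}z-\sigma z$, $\sigma\in W$, $z\in T^d(E)$; the image of $x_1\otimes\cdots\otimes x_d$ is denoted $x_1\chi\ldots\chi x_d$; $[\chi]^0(E)=K$. $\chi^{-1}$ is the character $\sigma\mapsto\chi(\sigma)^{-1}$. $[\chi]^d(-)$ is a functor: for $u\colon E\to F$, $[\chi]^d(u)(x_1\chi\ldots\chi x_d)=u(x_1)\chi\ldots\chi u(x_d)$. For a $d\times d$ matrix $A=(a_{ij})$ over $K$, the generalized Schur function is $d_\chi^W(A)=\sum_{\sigma\in W}\chi(\sigma)a_{\sigma^{-1}(1)1}\cdots a_{\sigma^{-1}(d)d}$. $W$ acts on $\{1,\ldots,n\}^d$ by $(\sigma i)_t=i_{\sigma^{-1}(t)}$, $W_i$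 is the stabilizer of $i$, and $J$ is the set of those $j\in\{1,\ldots,n\}^d$ which are lexicographically minimal in their $W$-orbit and satisfy $\chi=1$ on $W_j$. For $j\in J$, $e_j=e_{j_1}\chi\ldots\chi e_{j_d}$ and $e_j^*=e_{j_1}^*\chi^{-1}\ldots\chi^{-1}e_{j_d}^*$. *)

theory Defs
  imports "HOL-Algebra.Module" "HOL-Algebra.QuotRing" "HOL-Algebra.Sym_Groups" "HOL-Algebra.Group_Action" "HOL-Library.Fun_Lexorder"
begin

section \<open>Modules over a commutative ring\<close>

text \<open>
  Maps between modules are extensional functions on the carriers, so that equality of maps
  is equality in HOL.  The fields \<open>mult\<close> and \<open>one\<close>, which the record \<open>module\<close> inherits from
  \<open>ring\<close>, play no role in the locale \<open>module\<close> and are left unspecified.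
\<close>

definition module_hom ::
    "('k, 'r) ring_scheme \<Rightarrow> ('k, 'a, 'p) module_scheme \<Rightarrow> ('k, 'b, 'q) module_scheme \<Rightarrow> ('a \<Rightarrow> 'b) set"
  where "module_hom K M N =
    {f \<in> carrier M \<rightarrow>\<^sub>E carrier N.
      (\<forall>x\<in>carrier M. \<forall>y\<in>carrier M. f (x \<oplus>\<^bsub>M\<^esub> y) = f x \<oplus>\<^bsub>N\<^esub> f y) \<and>
      (\<forall>a\<in>carrier K. \<forall>x\<in>carrier M. f (a \<odot>\<^bsub>M\<^esub> x) = a \<odot>\<^bsub>N\<^esub> f x)}"

definition module_iso ::
    "('k, 'r) ring_scheme \<Rightarrow> ('k, 'a, 'p) module_scheme \<Rightarrow> ('k, 'b, 'q) module_scheme \<Rightarrow> ('a \<Rightarrow> 'b) set"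
  where "module_iso K M N = {f \<in> module_hom K M N. bij_betw f (carrier M) (carrier N)}"

definition regular_module :: "('k, 'r) ring_scheme \<Rightarrow> ('k, 'k) module"
  where "regular_module K =
    \<lparr>carrier = carrier K, monoid.mult = monoid.mult K, one = one K, zero = zero K, add = add K, smult = monoid.mult K\<rparr>"

definition dual_module ::
    "('k, 'r) ring_scheme \<Rightarrow> ('k, 'a, 'p) module_scheme \<Rightarrow> ('k, 'a \<Rightarrow> 'k) module"
  where "dual_module K M =
    \<lparr>carrier = module_hom K M (regular_module K),
     monoid.mult = undefined, one = undefined,
     zero = (\<lambda>x\<in>carrier M. \<zero>\<^bsub>K\<^esub>),
     add = (\<lambda>f g. \<lambda>x\<in>carrier M. f x \<oplus>\<^bsub>K\<^esub> g x),
     smult = (\<lambda>a f. \<lambda>x\<in>carrier M. a \<otimes>\<^bsub>K\<^esub> f x)\<rparr>"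

definition transpose_map ::
    "('k, 'r) ring_scheme \<Rightarrow> ('k, 'a, 'p) module_scheme \<Rightarrow> ('k, 'b, 'q) module_scheme \<Rightarrow>
      ('a \<Rightarrow> 'b) \<Rightarrow> ('b \<Rightarrow> 'k) \<Rightarrow> ('a \<Rightarrow> 'k)"
  where "transpose_map K M N u = (\<lambda>f\<in>carrier (dual_module K N). \<lambda>x\<in>carrier M. f (u x))"

definition submodule_span ::
    "('k, 'r) ring_scheme \<Rightarrow> ('k, 'a, 'p) module_scheme \<Rightarrow> 'a set \<Rightarrow> 'a set"
  where "submodule_span K M S = \<Inter>{H. submodule H K M \<and> S \<subseteq> H}"

text \<open>The scalar multiplication of cosets is the analogue of \<^const>\<open>rcoset_mult\<close>.\<close>

definition quotient_module ::
    "('k, 'a, 'p) module_scheme \<Rightarrow> 'a set \<Rightarrow> ('k, 'a set) module"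
  where "quotient_module M H =
    \<lparr>carrier = a_rcosets\<^bsub>M\<^esub> H,
     monoid.mult = undefined, one = undefined,
     zero = H,
     add = set_add M,
     smult = (\<lambda>a A. \<Union>x\<in>A. H +>\<^bsub>M\<^esub> (a \<odot>\<^bsub>M\<^esub> x))\<rparr>"

definition module_basis ::
    "('k, 'r) ring_scheme \<Rightarrow> ('k, 'a, 'p) module_scheme \<Rightarrow> 'i set \<Rightarrow> ('i \<Rightarrow> 'a) \<Rightarrow> bool"
  where "module_basis K M I b \<longleftrightarrow>
    finite I \<and> b \<in> I \<rightarrow> carrier M \<and>
    (\<forall>c \<in> I \<rightarrow> carrier K.
      finsum M (\<lambda>i. c i \<odot>\<^bsub>M\<^esub> b i) I = \<zero>\<^bsub>M\<^esub> \<longrightarrow> (\<forall>i\<in>I. c i = \<zero>\<^bsub>K\<^esub>)) \<and>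
    (\<forall>x \<in> carrier M. \<exists>c \<in> I \<rightarrow> carrier K. x = finsum M (\<lambda>i. c i \<odot>\<^bsub>M\<^esub> b i) I)"

definition finite_free_module ::
    "('k, 'r) ring_scheme \<Rightarrow> ('k, 'a, 'p) module_scheme \<Rightarrow> bool"
  where "finite_free_module K M \<longleftrightarrow> module K M \<and> (\<exists>(n::nat) b. module_basis K M {1..n} b)"

definition dual_family ::
    "('k, 'r) ring_scheme \<Rightarrow> ('k, 'a, 'p) module_scheme \<Rightarrow> 'i set \<Rightarrow> ('i \<Rightarrow> 'a) \<Rightarrow> ('i \<Rightarrow> 'a \<Rightarrow> 'k) \<Rightarrow> bool"
  where "dual_family K M I b b' \<longleftrightarrow>
    b' \<in> I \<rightarrow> carrier (dual_module K M) \<and>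
    (\<forall>i\<in>I. \<forall>j\<in>I. b' j (b i) = (if i = j then \<one>\<^bsub>K\<^esub> else \<zero>\<^bsub>K\<^esub>))"


section \<open>Bilinear forms\<close>

definition bilinear_forms ::
    "('k, 'r) ring_scheme \<Rightarrow> ('k, 'a, 'p) module_scheme \<Rightarrow> ('k, 'b, 'q) module_scheme \<Rightarrow> ('a \<times> 'b \<Rightarrow> 'k) set"
  where "bilinear_forms K M N =
    {B \<in> carrier M \<times> carrier N \<rightarrow>\<^sub>E carrier K.
      (\<forall>y\<in>carrier N. (\<lambda>x\<in>carrier M. B (x, y)) \<in> module_hom K M (regular_module K)) \<and>
      (\<forall>x\<in>carrier M. (\<lambda>y\<in>carrier N. B (x, y)) \<in> module_hom K N (regular_module K))}"

definition canonical_form ::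
    "('k, 'r) ring_scheme \<Rightarrow> ('k, 'a, 'p) module_scheme \<Rightarrow> 'a \<times> ('a \<Rightarrow> 'k) \<Rightarrow> 'k"
  where "canonical_form K M = (\<lambda>(x, f) \<in> carrier M \<times> carrier (dual_module K M). f x)"

definition associated_map ::
    "('k, 'a, 'p) module_scheme \<Rightarrow> ('k, 'b, 'q) module_scheme \<Rightarrow> ('a \<times> 'b \<Rightarrow> 'k) \<Rightarrow> 'b \<Rightarrow> 'a \<Rightarrow> 'k"
  where "associated_map M N B = (\<lambda>y\<in>carrier N. \<lambda>x\<in>carrier M. B (x, y))"

definition nonsingular_form ::
    "('k, 'r) ring_scheme \<Rightarrow> ('k, 'a, 'p) module_scheme \<Rightarrow> ('k, 'b, 'q) module_scheme \<Rightarrow> ('a \<times> 'b \<Rightarrow> 'k) \<Rightarrow> bool"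
  where "nonsingular_form K M N B \<longleftrightarrow>
    B \<in> bilinear_forms K M N \<and> associated_map M N B \<in> module_iso K N (dual_module K M)"


section \<open>Tensor powers\<close>

definition free_module :: "('k, 'r) ring_scheme \<Rightarrow> 'x set \<Rightarrow> ('k, 'x \<Rightarrow> 'k) module"
  where "free_module K X =
    \<lparr>carrier = {f. (\<forall>x\<in>X. f x \<in> carrier K) \<and> (\<forall>x. x \<notin> X \<longrightarrow> f x = \<zero>\<^bsub>K\<^esub>) \<and> finite {x. f x \<noteq> \<zero>\<^bsub>K\<^esub>}},
     monoid.mult = undefined, one = undefined,
     zero = (\<lambda>x. \<zero>\<^bsub>K\<^esub>),
     add = (\<lambda>f g x. f x \<oplus>\<^bsub>K\<^esub> g x),
     smult = (\<lambda>a f x. a \<otimes>\<^bsub>K\<^esub> f x)\<rparr>"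

definition free_gen :: "('k, 'r) ring_scheme \<Rightarrow> 'x \<Rightarrow> 'x \<Rightarrow> 'k"
  where "free_gen K x = (\<lambda>y. if y = x then \<one>\<^bsub>K\<^esub> else \<zero>\<^bsub>K\<^esub>)"

text \<open>A \<open>d\<close>-tuple \<open>(x\<^sub>1, \<dots>, x\<^sub>d)\<close> over \<open>A\<close> is an element of \<open>{1..d} \<rightarrow>\<^sub>E A\<close>.\<close>

abbreviation tuples :: "nat \<Rightarrow> 'a set \<Rightarrow> (nat \<Rightarrow> 'a) set"
  where "tuples d A \<equiv> {1..d} \<rightarrow>\<^sub>E A"

abbreviation free_tuples ::
    "('k, 'r) ring_scheme \<Rightarrow> nat \<Rightarrow> ('k, 'a, 'p) module_scheme \<Rightarrow> ('k, (nat \<Rightarrow> 'a) \<Rightarrow> 'k) module"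
  where "free_tuples K d E \<equiv> free_module K (tuples d (carrier E))"

definition tensor_relations ::
    "('k, 'r) ring_scheme \<Rightarrow> nat \<Rightarrow> ('k, 'a, 'p) module_scheme \<Rightarrow> ((nat \<Rightarrow> 'a) \<Rightarrow> 'k) set"
  where "tensor_relations K d E =
    {free_gen K (x(t := a \<oplus>\<^bsub>E\<^esub> b)) \<ominus>\<^bsub>free_tuples K d E\<^esub>
       (free_gen K (x(t := a)) \<oplus>\<^bsub>free_tuples K d E\<^esub> free_gen K (x(t := b))) | x t a b.
       x \<in> tuples d (carrier E) \<and> t \<in> {1..d} \<and> a \<in> carrier E \<and> b \<in> carrier E} \<union>
    {free_gen K (x(t := r \<odot>\<^bsub>E\<^esub> a)) \<ominus>\<^bsub>free_tuples K d E\<^esub>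
       (r \<odot>\<^bsub>free_tuples K d E\<^esub> free_gen K (x(t := a))) | x t r a.
       x \<in> tuples d (carrier E) \<and> t \<in> {1..d} \<and> r \<in> carrier K \<and> a \<in> carrier E}"

definition tensor_power ::
    "('k, 'r) ring_scheme \<Rightarrow> nat \<Rightarrow> ('k, 'a, 'p) module_scheme \<Rightarrow> ('k, ((nat \<Rightarrow> 'a) \<Rightarrow> 'k) set) module"
  where "tensor_power K d E =
    quotient_module (free_tuples K d E)
      (submodule_span K (free_tuples K d E) (tensor_relations K d E))"

definition tensor ::
    "('k, 'r) ring_scheme \<Rightarrow> nat \<Rightarrow> ('k, 'a, 'p) module_scheme \<Rightarrow> (nat \<Rightarrow> 'a) \<Rightarrow> ((nat \<Rightarrow> 'a) \<Rightarrow> 'k) set"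
  where "tensor K d E x =
    submodule_span K (free_tuples K d E) (tensor_relations K d E) +>\<^bsub>free_tuples K d E\<^esub> free_gen K x"


section \<open>The functors attached to a character of a permutation group\<close>

text \<open>
  The place permutation \<open>(\<sigma> x)\<^sub>t = x\<^bsub>\<sigma>\<^sup>-\<^sup>1(t)\<^esub>\<close>.  It preserves \<^term>\<open>tuples d A\<close> for
  \<open>\<sigma>\<close> in \<^term>\<open>carrier (sym_group d)\<close>.
\<close>

definition place_perm :: "(nat \<Rightarrow> nat) \<Rightarrow> (nat \<Rightarrow> 'a) \<Rightarrow> (nat \<Rightarrow> 'a)"
  where "place_perm \<sigma> x = x \<circ> inv_into UNIV \<sigma>"

text \<open>The linear action of \<open>\<sigma>\<close> on the tensor power, determined by its values on decomposable tensors.\<close>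

definition tensor_act ::
    "('k, 'r) ring_scheme \<Rightarrow> nat \<Rightarrow> ('k, 'a, 'p) module_scheme \<Rightarrow> (nat \<Rightarrow> nat) \<Rightarrow>
      ((nat \<Rightarrow> 'a) \<Rightarrow> 'k) set \<Rightarrow> ((nat \<Rightarrow> 'a) \<Rightarrow> 'k) set"
  where "tensor_act K d E \<sigma> =
    (THE g. g \<in> module_hom K (tensor_power K d E) (tensor_power K d E) \<and>
      (\<forall>x \<in> tuples d (carrier E). g (tensor K d E x) = tensor K d E (place_perm \<sigma> x)))"

abbreviation perm_group :: "nat \<Rightarrow> (nat \<Rightarrow> nat) set \<Rightarrow> (nat \<Rightarrow> nat) monoid"
  where "perm_group d W \<equiv> (sym_group d)\<lparr>carrier := W\<rparr>"

definition inv_char ::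
    "('k, 'r) ring_scheme \<Rightarrow> ((nat \<Rightarrow> nat) \<Rightarrow> 'k) \<Rightarrow> (nat \<Rightarrow> nat) \<Rightarrow> 'k"
  where "inv_char K \<chi> = (\<lambda>\<sigma>. inv\<^bsub>K\<^esub> (\<chi> \<sigma>))"

definition chi_relations ::
    "('k, 'r) ring_scheme \<Rightarrow> nat \<Rightarrow> (nat \<Rightarrow> nat) set \<Rightarrow> ((nat \<Rightarrow> nat) \<Rightarrow> 'k) \<Rightarrow>
      ('k, 'a, 'p) module_scheme \<Rightarrow> ((nat \<Rightarrow> 'a) \<Rightarrow> 'k) set set"
  where "chi_relations K d W \<chi> E =
    {(inv\<^bsub>K\<^esub> (\<chi> \<sigma>) \<odot>\<^bsub>tensor_power K d E\<^esub> z) \<ominus>\<^bsub>tensor_power K d E\<^esub> tensor_act K d E \<sigma> z | \<sigma> z.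
       \<sigma> \<in> W \<and> z \<in> carrier (tensor_power K d E)}"

text \<open>\<open>[\<chi>]\<^sup>d(E)\<close> for \<open>d \<ge> 1\<close>; degree \<open>0\<close> is treated separately below.\<close>

definition chi_power ::
    "('k, 'r) ring_scheme \<Rightarrow> nat \<Rightarrow> (nat \<Rightarrow> nat) set \<Rightarrow> ((nat \<Rightarrow> nat) \<Rightarrow> 'k) \<Rightarrow>
      ('k, 'a, 'p) module_scheme \<Rightarrow> ('k, ((nat \<Rightarrow> 'a) \<Rightarrow> 'k) set set) module"
  where "chi_power K d W \<chi> E =
    quotient_module (tensor_power K d E)
      (submodule_span K (tensor_power K d E) (chi_relations K d W \<chi> E))"

text \<open>\<open>x\<^sub>1 \<chi> \<dots> \<chi> x\<^sub>d\<close>\<close>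

definition chi_prod ::
    "('k, 'r) ring_scheme \<Rightarrow> nat \<Rightarrow> (nat \<Rightarrow> nat) set \<Rightarrow> ((nat \<Rightarrow> nat) \<Rightarrow> 'k) \<Rightarrow>
      ('k, 'a, 'p) module_scheme \<Rightarrow> (nat \<Rightarrow> 'a) \<Rightarrow> ((nat \<Rightarrow> 'a) \<Rightarrow> 'k) set set"
  where "chi_prod K d W \<chi> E x =
    submodule_span K (tensor_power K d E) (chi_relations K d W \<chi> E)
      +>\<^bsub>tensor_power K d E\<^esub> tensor K d E x"

text \<open>\<open>[\<chi>]\<^sup>d(u)\<close> for \<open>u \<in> module_hom K E F\<close>\<close>

definition chi_power_map ::
    "('k, 'r) ring_scheme \<Rightarrow> nat \<Rightarrow> (nat \<Rightarrow> nat) set \<Rightarrow> ((nat \<Rightarrow> nat) \<Rightarrow> 'k) \<Rightarrow>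
      ('k, 'a, 'p) module_scheme \<Rightarrow> ('k, 'b, 'q) module_scheme \<Rightarrow> ('a \<Rightarrow> 'b) \<Rightarrow>
      ((nat \<Rightarrow> 'a) \<Rightarrow> 'k) set set \<Rightarrow> ((nat \<Rightarrow> 'b) \<Rightarrow> 'k) set set"
  where "chi_power_map K d W \<chi> E F u =
    (THE g. g \<in> module_hom K (chi_power K d W \<chi> E) (chi_power K d W \<chi> F) \<and>
      (\<forall>x \<in> tuples d (carrier E).
        g (chi_prod K d W \<chi> E x) = chi_prod K d W \<chi> F (\<lambda>t\<in>{1..d}. u (x t))))"

text \<open>The functor \<open>[\<chi>]\<^sup>0\<close> is constant with value \<open>K\<close>.\<close>

definition chi_power0 :: "('k, 'r) ring_scheme \<Rightarrow> ('k, 'a, 'p) module_scheme \<Rightarrow> ('k, 'k) module"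
  where "chi_power0 K E = regular_module K"

definition chi_power_map0 ::
    "('k, 'r) ring_scheme \<Rightarrow> ('k, 'a, 'p) module_scheme \<Rightarrow> ('k, 'b, 'q) module_scheme \<Rightarrow>
      ('a \<Rightarrow> 'b) \<Rightarrow> 'k \<Rightarrow> 'k"
  where "chi_power_map0 K E F u = (\<lambda>k\<in>carrier K. k)"


section \<open>Generalized Schur functions and the form \<open>B\<close>\<close>

definition schur_function ::
    "('k, 'r) ring_scheme \<Rightarrow> nat \<Rightarrow> (nat \<Rightarrow> nat) set \<Rightarrow> ((nat \<Rightarrow> nat) \<Rightarrow> 'k) \<Rightarrow> (nat \<Rightarrow> nat \<Rightarrow> 'k) \<Rightarrow> 'k"
  where "schur_function K d W \<chi> A =
    finsum K (\<lambda>\<sigma>. \<chi> \<sigma> \<otimes>\<^bsub>K\<^esub> finprod K (\<lambda>t. A (inv_into UNIV \<sigma> t) t) {1..d}) W"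

definition satisfies_schur_formula ::
    "('k, 'r) ring_scheme \<Rightarrow> nat \<Rightarrow> (nat \<Rightarrow> nat) set \<Rightarrow> ((nat \<Rightarrow> nat) \<Rightarrow> 'k) \<Rightarrow>
      ('k, 'a, 'p) module_scheme \<Rightarrow>
      (((nat \<Rightarrow> 'a) \<Rightarrow> 'k) set set \<times> ((nat \<Rightarrow> 'a \<Rightarrow> 'k) \<Rightarrow> 'k) set set \<Rightarrow> 'k) \<Rightarrow> bool"
  where "satisfies_schur_formula K d W \<chi> E B \<longleftrightarrow>
    (\<forall>x \<in> tuples d (carrier E). \<forall>y \<in> tuples d (carrier (dual_module K E)).
      B (chi_prod K d W \<chi> E x, chi_prod K d W (inv_char K \<chi>) (dual_module K E) y) =
        schur_function K d W \<chi> (\<lambda>i j. canonical_form K E (x i, y j)))"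

definition schur_form ::
    "('k, 'r) ring_scheme \<Rightarrow> nat \<Rightarrow> (nat \<Rightarrow> nat) set \<Rightarrow> ((nat \<Rightarrow> nat) \<Rightarrow> 'k) \<Rightarrow>
      ('k, 'a, 'p) module_scheme \<Rightarrow>
      ((nat \<Rightarrow> 'a) \<Rightarrow> 'k) set set \<times> ((nat \<Rightarrow> 'a \<Rightarrow> 'k) \<Rightarrow> 'k) set set \<Rightarrow> 'k"
  where "schur_form K d W \<chi> E =
    (THE B. B \<in> bilinear_forms K (chi_power K d W \<chi> E) (chi_power K d W (inv_char K \<chi>) (dual_module K E)) \<and>
      satisfies_schur_formula K d W \<chi> E B)"

definition schur_form0 :: "('k, 'r) ring_scheme \<Rightarrow> ('k, 'a, 'p) module_scheme \<Rightarrow> 'k \<times> 'k \<Rightarrow> 'k"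
  where "schur_form0 K E =
    (\<lambda>(k, l) \<in> carrier (chi_power0 K E) \<times> carrier (chi_power0 K (dual_module K E)). k \<otimes>\<^bsub>K\<^esub> l)"

text \<open>The maps \<open>\<iota>\<^sub>E\<close> in degree \<open>d\<close> and in degree \<open>0\<close>\<close>

definition iota ::
    "('k, 'r) ring_scheme \<Rightarrow> nat \<Rightarrow> (nat \<Rightarrow> nat) set \<Rightarrow> ((nat \<Rightarrow> nat) \<Rightarrow> 'k) \<Rightarrow>
      ('k, 'a, 'p) module_scheme \<Rightarrow>
      ((nat \<Rightarrow> 'a \<Rightarrow> 'k) \<Rightarrow> 'k) set set \<Rightarrow> ((nat \<Rightarrow> 'a) \<Rightarrow> 'k) set set \<Rightarrow> 'k"
  where "iota K d W \<chi> E =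
    associated_map (chi_power K d W \<chi> E) (chi_power K d W (inv_char K \<chi>) (dual_module K E))
      (schur_form K d W \<chi> E)"

definition iota0 ::
    "('k, 'r) ring_scheme \<Rightarrow> ('k, 'a, 'p) module_scheme \<Rightarrow> 'k \<Rightarrow> 'k \<Rightarrow> 'k"
  where "iota0 K E =
    associated_map (chi_power0 K E) (chi_power0 K (dual_module K E)) (schur_form0 K E)"


section \<open>The index set \<open>J\<close> and the bases\<close>

abbreviation index_stabilizer :: "nat \<Rightarrow> (nat \<Rightarrow> nat) set \<Rightarrow> (nat \<Rightarrow> nat) \<Rightarrow> (nat \<Rightarrow> nat) set"
  where "index_stabilizer d W i \<equiv> stabilizer (perm_group d W) place_perm i"

text \<open>
  Multi-indices agree outside \<^term>\<open>{1..d}\<close>, hence \<^const>\<open>less_fun\<close> restricts to the strict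
  lexicographic order on them.
\<close>

definition index_set ::
    "('k, 'r) ring_scheme \<Rightarrow> nat \<Rightarrow> (nat \<Rightarrow> nat) set \<Rightarrow> ((nat \<Rightarrow> nat) \<Rightarrow> 'k) \<Rightarrow> nat \<Rightarrow> (nat \<Rightarrow> nat) set"
  where "index_set K d W \<chi> n =
    {j \<in> tuples d {1..n}.
      (\<forall>i \<in> orbit (perm_group d W) place_perm j. \<not> less_fun i j) \<and>
      (\<forall>\<sigma> \<in> index_stabilizer d W j. \<chi> \<sigma> = \<one>\<^bsub>K\<^esub>)}"

text \<open>With \<open>\<chi>\<close> and \<open>e\<close> this is \<open>e\<^sub>j\<close>; with \<open>\<chi>\<^sup>-\<^sup>1\<close> and the dual basis it is \<open>e\<^sub>j\<^sup>*\<close>.\<close>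

definition chi_basis ::
    "('k, 'r) ring_scheme \<Rightarrow> nat \<Rightarrow> (nat \<Rightarrow> nat) set \<Rightarrow> ((nat \<Rightarrow> nat) \<Rightarrow> 'k) \<Rightarrow>
      ('k, 'a, 'p) module_scheme \<Rightarrow> (nat \<Rightarrow> 'a) \<Rightarrow> (nat \<Rightarrow> nat) \<Rightarrow> ((nat \<Rightarrow> 'a) \<Rightarrow> 'k) set set"
  where "chi_basis K d W \<chi> E e j = chi_prod K d W \<chi> E (\<lambda>t\<in>{1..d}. e (j t))"

definition scaled_dual_chi_basis ::
    "('k, 'r) ring_scheme \<Rightarrow> nat \<Rightarrow> (nat \<Rightarrow> nat) set \<Rightarrow> ((nat \<Rightarrow> nat) \<Rightarrow> 'k) \<Rightarrow>
      ('k, 'a, 'p) module_scheme \<Rightarrow> (nat \<Rightarrow> 'a \<Rightarrow> 'k) \<Rightarrow> (nat \<Rightarrow> nat) \<Rightarrow>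
      ((nat \<Rightarrow> 'a \<Rightarrow> 'k) \<Rightarrow> 'k) set set"
  where "scaled_dual_chi_basis K d W \<chi> E e' j =
    inv\<^bsub>K\<^esub> ([card (index_stabilizer d W j)] \<cdot>\<^bsub>K\<^esub> \<one>\<^bsub>K\<^esub>)
      \<odot>\<^bsub>chi_power K d W (inv_char K \<chi>) (dual_module K E)\<^esub>
      chi_basis K d W (inv_char K \<chi>) (dual_module K E) e' j"

end

theory Submission
  imports Defs "HOL-Algebra.Divisibility"
begin

text \<open>
  Linear maps out of \<open>[\<chi>]\<^sup>d(E)\<close> are the multilinear maps \<open>\<Phi>\<close> on \<open>E\<^sup>d\<close> with
  \<open>\<Phi> (\<sigma> x) = \<chi>(\<sigma>)\<^sup>-\<^sup>1 \<Phi> x\<close>.  The generalized Schur function is multilinear and equivariant in both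
  arguments, so it descends to a bilinear form \<open>B\<close> on \<open>[\<chi>]\<^sup>d(E) \<times> [\<chi>\<^sup>-\<^sup>1]\<^sup>d(E\<^sup>*)\<close>.
  The \<open>e\<^sub>j\<close> with \<open>j \<in> J\<close> generate \<open>[\<chi>]\<^sup>d(E)\<close>: up to a unit, a product of basis vectors depends only on
  the \<open>W\<close>-orbit of its index, and it vanishes when \<open>\<chi>\<close> is nontrivial on the stabilizer \<open>W\<^sub>j\<close>, because
  \<open>|W\<^sub>j|\<close> is a unit and \<open>\<chi>\<^sup>-\<^sup>1\<close> sums to \<open>0\<close> over \<open>W\<^sub>j\<close> (this is where \<open>K\<close> must be a domain).
  Likewise the \<open>e\<^sub>j\<^sup>*\<close> generate \<open>[\<chi>\<^sup>-\<^sup>1]\<^sup>d(E\<^sup>*)\<close>.  Since \<open>B(e\<^sub>i, e\<^sub>j\<^sup>*)\<close> is \<open>|W\<^sub>j|\<close> if \<open>i = j\<close> and \<open>0\<close> otherwise,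
  both generating families are bases and \<open>B\<close> is non-singular; no basis of the tensor power is needed.
\<close>

section \<open>Linear maps and generating families\<close>

text \<open>The modules are iterated quotients and the maps on them definite descriptions. After the
  general facts on quotients, tensor powers and \<open>[\<chi>]^d(E)\<close> are used only through a
  universal property and the fact that decomposable elements generate. So the form is built by
  lifting twice: for a fixed tuple \<open>y\<close> the Schur function lifts to a linear form on
  \<open>[\<chi>]^d(E)\<close>, and sending \<open>y\<close> to that form lifts again, to a linear
  map into the dual. The inverse character belongs on the dual side because permuting
  \<open>x\<close> by \<sigma> multiplies the Schur function by the inverse of \<chi>(\<sigma>),
  while permuting \<open>y\<close> multiplies it by \<chi>(\<sigma>). Bases come last: if two
  generating families pair to the Kronecker delta, pairing with one reads off coefficients along the
  other, so both are independent and the associated map is bijective. The factor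
  \<open>1/|W_j|\<close> normalizes the diagonal of the pairing. A stabilizer is itself a
  permutation group with the restricted character, so its character sum is an instance of the sum
  over a whole group.\<close>

lemma module_hom_closed:
  "f \<in> module_hom K M N \<Longrightarrow> x \<in> carrier M \<Longrightarrow> f x \<in> carrier N"
  by (auto simp: module_hom_def)

lemma module_hom_add:
  "f \<in> module_hom K M N \<Longrightarrow> x \<in> carrier M \<Longrightarrow> y \<in> carrier M \<Longrightarrow> f (x \<oplus>\<^bsub>M\<^esub> y) = f x \<oplus>\<^bsub>N\<^esub> f y"
  by (auto simp: module_hom_def)

lemma module_hom_smult:
  "f \<in> module_hom K M N \<Longrightarrow> a \<in> carrier K \<Longrightarrow> x \<in> carrier M \<Longrightarrow> f (a \<odot>\<^bsub>M\<^esub> x) = a \<odot>\<^bsub>N\<^esub> f x"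
  by (auto simp: module_hom_def)

lemma module_hom_ext:
  "f \<in> module_hom K M N \<Longrightarrow> g \<in> module_hom K M N \<Longrightarrow> (\<And>x. x \<in> carrier M \<Longrightarrow> f x = g x) \<Longrightarrow> f = g"
  unfolding module_hom_def by (blast intro: PiE_ext)

lemma module_hom_restrictI:
  assumes "module K M"
    and "\<And>x. x \<in> carrier M \<Longrightarrow> f x \<in> carrier N"
    and "\<And>x y. x \<in> carrier M \<Longrightarrow> y \<in> carrier M \<Longrightarrow> f (x \<oplus>\<^bsub>M\<^esub> y) = f x \<oplus>\<^bsub>N\<^esub> f y"
    and "\<And>a x. a \<in> carrier K \<Longrightarrow> x \<in> carrier M \<Longrightarrow> f (a \<odot>\<^bsub>M\<^esub> x) = a \<odot>\<^bsub>N\<^esub> f x"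
  shows "(\<lambda>x\<in>carrier M. f x) \<in> module_hom K M N"
proof -
  interpret M: module K M by fact
  show ?thesis using assms(2-) by (auto simp: module_hom_def)
qed

lemma module_hom_compose:
  assumes "module K M" "f \<in> module_hom K M N" "g \<in> module_hom K N P"
  shows "(\<lambda>x\<in>carrier M. g (f x)) \<in> module_hom K M P"
  by (rule module_hom_restrictI)
    (use assms in \<open>auto simp: module_hom_closed module_hom_add module_hom_smult\<close>)

text \<open>Linearity is stated for sums and scalars; homogeneity at the scalar 0 supplies the value
  at 0.\<close>

lemma module_hom_zero:
  assumes "module K M" "module K N" "f \<in> module_hom K M N"
  shows "f \<zero>\<^bsub>M\<^esub> = \<zero>\<^bsub>N\<^esub>"
proof -
  interpret M: module K M by fact
  interpret N: module K N by fact
  have "f (\<zero>\<^bsub>K\<^esub> \<odot>\<^bsub>M\<^esub> \<zero>\<^bsub>M\<^esub>) = \<zero>\<^bsub>K\<^esub> \<odot>\<^bsub>N\<^esub> f \<zero>\<^bsub>M\<^esub>"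
    by (rule module_hom_smult[OF assms(3)]) simp_all
  then show ?thesis using module_hom_closed[OF assms(3)] by simp
qed

lemma module_hom_a_minus:
  assumes "module K M" "module K N" "f \<in> module_hom K M N" "x \<in> carrier M" "y \<in> carrier M"
  shows "f (x \<ominus>\<^bsub>M\<^esub> y) = f x \<ominus>\<^bsub>N\<^esub> f y"
proof -
  interpret M: module K M by fact
  interpret N: module K N by fact
  have "f (x \<ominus>\<^bsub>M\<^esub> y) \<oplus>\<^bsub>N\<^esub> f y = f ((x \<ominus>\<^bsub>M\<^esub> y) \<oplus>\<^bsub>M\<^esub> y)"
    using assms by (simp add: module_hom_add)
  also have "\<dots> = f x" using assms by (simp add: M.minus_eq M.a_assoc M.l_neg)
  finally have *: "f (x \<ominus>\<^bsub>M\<^esub> y) \<oplus>\<^bsub>N\<^esub> f y = f x" .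
  have "f (x \<ominus>\<^bsub>M\<^esub> y) \<in> carrier N" "f y \<in> carrier N"
    using assms by (auto simp: module_hom_closed)
  then show ?thesis by (simp add: *[symmetric] N.minus_eq N.a_assoc N.r_neg)
qed

lemma module_hom_finsum:
  assumes "module K M" "module K N" "f \<in> module_hom K M N"
    and "finite A" "g \<in> A \<rightarrow> carrier M"
  shows "f (finsum M g A) = finsum N (\<lambda>i. f (g i)) A"
proof -
  interpret M: module K M by fact
  interpret N: module K N by fact
  from assms(4,5) show ?thesis
  proof (induction A)
    case empty
    then show ?case using module_hom_zero[OF assms(1-3)] by simp
  next
    case (insert a A)
    then have "finsum M g A \<in> carrier M" by (auto intro: M.finsum_closed)
    moreover have "(\<lambda>i. f (g i)) \<in> A \<rightarrow> carrier N"
      using insert.prems by (auto intro: module_hom_closed[OF assms(3)])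
    ultimately show ?case
      using insert by (simp add: Pi_def module_hom_add[OF assms(3)] module_hom_closed[OF assms(3)])
  qed
qed

section \<open>Submodules and spans\<close>

lemma submodule_subset: "submodule H K M \<Longrightarrow> H \<subseteq> carrier M"
  using subgroup.subset[of H "add_monoid M"] by (simp add: submodule_def)

lemma submodule_zero: "submodule H K M \<Longrightarrow> \<zero>\<^bsub>M\<^esub> \<in> H"
  using subgroup.one_closed[of H "add_monoid M"] by (simp add: submodule_def)

lemma submodule_add: "submodule H K M \<Longrightarrow> x \<in> H \<Longrightarrow> y \<in> H \<Longrightarrow> x \<oplus>\<^bsub>M\<^esub> y \<in> H"
  using subgroup.m_closed[of H "add_monoid M"] by (simp add: submodule_def)

lemma submodule_smult: "submodule H K M \<Longrightarrow> a \<in> carrier K \<Longrightarrow> x \<in> H \<Longrightarrow> a \<odot>\<^bsub>M\<^esub> x \<in> H"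
  by (rule submodule.smult_closed)

text \<open>Closure under negation is automatic, since \<open>- x = (- 1) x\<close>.\<close>

lemma (in module) submoduleI':
  assumes "H \<subseteq> carrier M" "\<zero>\<^bsub>M\<^esub> \<in> H"
    and "\<And>x y. x \<in> H \<Longrightarrow> y \<in> H \<Longrightarrow> x \<oplus>\<^bsub>M\<^esub> y \<in> H"
    and "\<And>a x. a \<in> carrier R \<Longrightarrow> x \<in> H \<Longrightarrow> a \<odot>\<^bsub>M\<^esub> x \<in> H"
  shows "submodule H R M"
proof (rule submoduleI)
  fix x assume x: "x \<in> H"
  with assms(1) have "\<ominus>\<^bsub>M\<^esub> x = (\<ominus>\<^bsub>R\<^esub> \<one>\<^bsub>R\<^esub>) \<odot>\<^bsub>M\<^esub> x"
    by (simp add: smult_l_minus subset_eq)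
  then show "\<ominus>\<^bsub>M\<^esub> x \<in> H" using assms(4) x by simp
qed (use assms in auto)

lemma submodule_finsum:
  assumes "module K M" "submodule H K M" "finite A" "\<And>i. i \<in> A \<Longrightarrow> g i \<in> H"
  shows "finsum M g A \<in> H"
proof -
  interpret M: module K M by fact
  from assms(3,4) show ?thesis
  proof (induction A)
    case (insert a A)
    then have "g \<in> A \<rightarrow> carrier M" "g a \<in> carrier M"
      using submodule_subset[OF assms(2)] by auto
    then show ?case using insert submodule_add[OF assms(2)] by simp
  qed (simp add: submodule_zero[OF assms(2)])
qed

text \<open>The set where two linear maps coincide is closed under the module operations; through
  \<open>generates_hom_ext\<close> this underlies the uniqueness arguments for linear maps.\<close>

lemma submodule_equalizer:
  assumes "module K M" "module K N" "f \<in> module_hom K M N" "g \<in> module_hom K M N"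
  shows "submodule {x \<in> carrier M. f x = g x} K M"
proof -
  interpret M: module K M by fact
  show ?thesis
    by (rule M.submoduleI')
      (use assms in \<open>auto simp: module_hom_zero module_hom_add module_hom_smult\<close>)
qed

lemma submodule_span_subset:
  assumes "module K M" "S \<subseteq> carrier M"
  shows "submodule (submodule_span K M S) K M"
proof -
  interpret M: module K M by fact
  \<comment> \<open>The family being intersected is nonempty; otherwise its intersection would be
    the whole type and not a subset of the carrier.\<close>
  have "carrier M \<in> {H. submodule H K M \<and> S \<subseteq> H}"
    using assms M.carrier_is_submodule by simp
  then show ?thesis unfolding submodule_span_def
    by (intro M.submoduleI')
      (use submodule_subset in \<open>auto intro: submodule_zero submodule_add submodule_smult\<close>)
qed

lemma submodule_span_incl: "x \<in> S \<Longrightarrow> x \<in> submodule_span K M S"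
  by (auto simp: submodule_span_def)

lemma submodule_span_least: "submodule H K M \<Longrightarrow> S \<subseteq> H \<Longrightarrow> submodule_span K M S \<subseteq> H"
  by (auto simp: submodule_span_def)

text \<open>Stated through submodules rather than linear combinations: generating sets such as all
  decomposable tensors can be infinite, and the closure form passes to quotients and gives induction
  directly. Coefficients are recovered for finite families in
  \<open>generates_finsum\<close>.\<close>

definition generates ::
    "('k, 'r) ring_scheme \<Rightarrow> ('k, 'a, 'p) module_scheme \<Rightarrow> 'a set \<Rightarrow> bool"
  where "generates K M S \<longleftrightarrow> S \<subseteq> carrier M \<and> (\<forall>H. submodule H K M \<longrightarrow> S \<subseteq> H \<longrightarrow> carrier M \<subseteq> H)"

lemma generates_induct [consumes 3, case_names zero gen add smult]:
  assumes "module K M" "generates K M S" "x \<in> carrier M"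
    and "P \<zero>\<^bsub>M\<^esub>"
    and "\<And>x. x \<in> S \<Longrightarrow> P x"
    and "\<And>x y. x \<in> carrier M \<Longrightarrow> y \<in> carrier M \<Longrightarrow> P x \<Longrightarrow> P y \<Longrightarrow> P (x \<oplus>\<^bsub>M\<^esub> y)"
    and "\<And>a x. a \<in> carrier K \<Longrightarrow> x \<in> carrier M \<Longrightarrow> P x \<Longrightarrow> P (a \<odot>\<^bsub>M\<^esub> x)"
  shows "P x"
proof -
  interpret M: module K M by fact
  have "submodule {x \<in> carrier M. P x} K M"
    by (rule M.submoduleI') (use assms in auto)
  then show ?thesis using assms by (auto simp: generates_def)
qed

lemma generates_hom_ext:
  assumes "module K M" "module K N" "generates K M S"
    and "f \<in> module_hom K M N" "g \<in> module_hom K M N" "\<And>x. x \<in> S \<Longrightarrow> f x = g x"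
  shows "f = g"
proof -
  have "carrier M \<subseteq> {x \<in> carrier M. f x = g x}"
    using submodule_equalizer[OF assms(1,2,4,5)] assms(3,6) by (auto simp: generates_def)
  then show ?thesis using module_hom_ext[OF assms(4,5)] by auto
qed

lemma module_basis_generates:
  assumes "module K M" "module_basis K M I b"
  shows "generates K M (b ` I)"
proof -
  interpret M: module K M by fact
  have fin: "finite I" and b: "b \<in> I \<rightarrow> carrier M"
    and ex: "\<And>x. x \<in> carrier M \<Longrightarrow> \<exists>c\<in>I \<rightarrow> carrier K. x = finsum M (\<lambda>i. c i \<odot>\<^bsub>M\<^esub> b i) I"
    using assms(2) by (auto simp: module_basis_def)
  have "x \<in> H" if H: "submodule H K M" "b ` I \<subseteq> H" and x: "x \<in> carrier M" for H x
  proof -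
    obtain c where "c \<in> I \<rightarrow> carrier K" "x = finsum M (\<lambda>i. c i \<odot>\<^bsub>M\<^esub> b i) I"
      using ex[OF x] by auto
    then show ?thesis
      using H(2) by (auto intro!: submodule_finsum[OF assms(1) H(1) fin] submodule_smult[OF H(1)])
  qed
  then show ?thesis using b by (auto simp: generates_def)
qed

text \<open>The way back from closure to coordinates, since \<open>module_basis\<close> asks for
  coefficient functions. The elements that are such combinations include every generator and are
  stable under the operations, by adding or scaling coefficients.\<close>

lemma generates_finsum:
  assumes "module K M" "finite I" "generates K M (b ` I)" "x \<in> carrier M"
  shows "\<exists>c\<in>I \<rightarrow> carrier K. x = finsum M (\<lambda>i. c i \<odot>\<^bsub>M\<^esub> b i) I"
proof -
  interpret M: module K M by fact
  have b: "b i \<in> carrier M" if "i \<in> I" for i using assms(3) that by (auto simp: generates_def)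
  show ?thesis using assms(1,3,4)
  proof (induction rule: generates_induct)
    case zero
    have "finsum M (\<lambda>i. \<zero>\<^bsub>K\<^esub> \<odot>\<^bsub>M\<^esub> b i) I = finsum M (\<lambda>i. \<zero>\<^bsub>M\<^esub>) I"
      by (rule M.add.finprod_cong') (use b in auto)
    then show ?case by (intro bexI[of _ "\<lambda>i. \<zero>\<^bsub>K\<^esub>"]) auto
  next
    case (gen x)
    then obtain i where i: "i \<in> I" "x = b i" by auto
    have "finsum M (\<lambda>j. if i = j then b j else \<zero>\<^bsub>M\<^esub>) I = b i"
      using i b assms(2) by (intro M.add.finprod_singleton) auto
    moreover have "finsum M (\<lambda>j. (if i = j then \<one>\<^bsub>K\<^esub> else \<zero>\<^bsub>K\<^esub>) \<odot>\<^bsub>M\<^esub> b j) I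
        = finsum M (\<lambda>j. if i = j then b j else \<zero>\<^bsub>M\<^esub>) I"
      by (rule M.add.finprod_cong') (use b in auto)
    ultimately show ?case using i by (intro bexI[of _ "\<lambda>j. if i = j then \<one>\<^bsub>K\<^esub> else \<zero>\<^bsub>K\<^esub>"]) auto
  next
    case (add x y)
    then obtain c c' where c: "c \<in> I \<rightarrow> carrier K" "x = finsum M (\<lambda>i. c i \<odot>\<^bsub>M\<^esub> b i) I"
      and c': "c' \<in> I \<rightarrow> carrier K" "y = finsum M (\<lambda>i. c' i \<odot>\<^bsub>M\<^esub> b i) I" by auto
    have "finsum M (\<lambda>i. (c i \<oplus>\<^bsub>K\<^esub> c' i) \<odot>\<^bsub>M\<^esub> b i) I
        = finsum M (\<lambda>i. c i \<odot>\<^bsub>M\<^esub> b i \<oplus>\<^bsub>M\<^esub> c' i \<odot>\<^bsub>M\<^esub> b i) I"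
      using c c' b by (intro M.add.finprod_cong') (auto simp: M.smult_l_distr Pi_def)
    also have "\<dots> = x \<oplus>\<^bsub>M\<^esub> y"
      unfolding c(2) c'(2) using c(1) c'(1) b by (intro M.finsum_addf) auto
    finally show ?case using c c' by (intro bexI[of _ "\<lambda>i. c i \<oplus>\<^bsub>K\<^esub> c' i"]) auto
  next
    case (smult a x)
    then obtain c where c: "c \<in> I \<rightarrow> carrier K" "x = finsum M (\<lambda>i. c i \<odot>\<^bsub>M\<^esub> b i) I" by auto
    have "a \<odot>\<^bsub>M\<^esub> x = finsum M (\<lambda>i. a \<odot>\<^bsub>M\<^esub> (c i \<odot>\<^bsub>M\<^esub> b i)) I"
      unfolding c(2) using c(1) b smult assms(2) by (intro M.finsum_smult_ldistr) auto
    also have "\<dots> = finsum M (\<lambda>i. (a \<otimes>\<^bsub>K\<^esub> c i) \<odot>\<^bsub>M\<^esub> b i) I"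
      using c b smult by (intro M.add.finprod_cong') (auto simp: M.smult_assoc1 Pi_def)
    finally show ?case using c smult by (intro bexI[of _ "\<lambda>i. a \<otimes>\<^bsub>K\<^esub> c i"]) auto
  qed
qed


section \<open>Dual modules\<close>

lemma regular_module_simps [simp]:
  "carrier (regular_module K) = carrier K" "\<zero>\<^bsub>regular_module K\<^esub> = \<zero>\<^bsub>K\<^esub>"
  "x \<oplus>\<^bsub>regular_module K\<^esub> y = x \<oplus>\<^bsub>K\<^esub> y" "a \<odot>\<^bsub>regular_module K\<^esub> x = a \<otimes>\<^bsub>K\<^esub> x"
  by (simp_all add: regular_module_def)

lemma regular_module_finsum [simp]: "finsum (regular_module K) f A = finsum K f A"
  by (simp add: finsum_def finprod_def regular_module_def)

lemma module_regular:
  assumes "cring K" shows "module K (regular_module K)"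
proof -
  interpret cring K by fact
  show ?thesis
    by (intro moduleI abelian_groupI)
      (auto simp: a_ac m_assoc l_distr r_distr intro: cring_axioms add.l_inv_ex)
qed

lemma dual_module_simps [simp]:
  "carrier (dual_module K M) = module_hom K M (regular_module K)"
  "\<zero>\<^bsub>dual_module K M\<^esub> = (\<lambda>x\<in>carrier M. \<zero>\<^bsub>K\<^esub>)"
  "f \<oplus>\<^bsub>dual_module K M\<^esub> g = (\<lambda>x\<in>carrier M. f x \<oplus>\<^bsub>K\<^esub> g x)"
  "a \<odot>\<^bsub>dual_module K M\<^esub> f = (\<lambda>x\<in>carrier M. a \<otimes>\<^bsub>K\<^esub> f x)"
  by (simp_all add: dual_module_def)

lemma module_dual:
  assumes "module K M" shows "module K (dual_module K M)"
proof -
  interpret M: module K M by fact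
  let ?D = "module_hom K M (regular_module K)"
  have cl: "f x \<in> carrier K" if "f \<in> ?D" "x \<in> carrier M" for f x
    using module_hom_closed[OF that] by simp
  have ad: "f (x \<oplus>\<^bsub>M\<^esub> y) = f x \<oplus>\<^bsub>K\<^esub> f y" if "f \<in> ?D" "x \<in> carrier M" "y \<in> carrier M" for f x y
    using module_hom_add[OF that] by simp
  have sm: "f (a \<odot>\<^bsub>M\<^esub> x) = a \<otimes>\<^bsub>K\<^esub> f x" if "f \<in> ?D" "a \<in> carrier K" "x \<in> carrier M" for f a x
    using module_hom_smult[OF that] by simp
  have ext: "f \<in> extensional (carrier M)" if "f \<in> ?D" for f
    using that by (auto simp: module_hom_def PiE_def)
  have add: "(\<lambda>x\<in>carrier M. f x \<oplus>\<^bsub>K\<^esub> g x) \<in> ?D" if "f \<in> ?D" "g \<in> ?D" for f g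
    by (rule module_hom_restrictI[OF assms])
      (use that in \<open>auto simp: cl ad sm M.R.r_distr M.R.a_ac\<close>)
  have sml: "(\<lambda>x\<in>carrier M. a \<otimes>\<^bsub>K\<^esub> f x) \<in> ?D" if "f \<in> ?D" "a \<in> carrier K" for f a
    by (rule module_hom_restrictI[OF assms])
      (use that in \<open>auto simp: cl ad sm M.R.r_distr M.R.m_lcomm\<close>)
  have zero: "(\<lambda>x\<in>carrier M. \<zero>\<^bsub>K\<^esub>) \<in> ?D"
    by (rule module_hom_restrictI[OF assms]) auto
  \<comment> \<open>The negative of \<open>f\<close> is produced as its multiple by minus one,
    already known to be linear.\<close>
  have inv: "\<exists>g\<in>?D. (\<lambda>x\<in>carrier M. g x \<oplus>\<^bsub>K\<^esub> f x) = (\<lambda>x\<in>carrier M. \<zero>\<^bsub>K\<^esub>)" if f: "f \<in> ?D" for f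
    by (rule bexI[OF _ sml[OF f, of "\<ominus>\<^bsub>K\<^esub> \<one>\<^bsub>K\<^esub>"]])
      (use f in \<open>auto simp: cl M.R.l_minus M.R.l_neg intro!: restrict_ext\<close>)
  show ?thesis
    by (intro moduleI abelian_groupI M.R.cring_axioms M.is_cring)
      (auto simp: add sml zero inv cl ext M.R.a_ac M.R.m_assoc M.R.l_distr M.R.r_distr
        intro!: restrict_ext extensionalityI[of _ "carrier M"])
qed

section \<open>Quotients and free modules\<close>

text \<open>Turns membership of a difference in the submodule into an equation of cosets; this is
  how the defining relations become identities in the quotients.\<close>

lemma r_coset_eqI:
  assumes "module K M" "submodule H K M" "x \<in> carrier M" "y \<in> carrier M" "x \<ominus>\<^bsub>M\<^esub> y \<in> H"
  shows "H +>\<^bsub>M\<^esub> x = H +>\<^bsub>M\<^esub> y"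
proof -
  interpret M: module K M by fact
  have H: "subgroup H (add_monoid M)" using assms(2) by (simp add: submodule_def)
  have "(x \<ominus>\<^bsub>M\<^esub> y) \<oplus>\<^bsub>M\<^esub> y \<in> H +>\<^bsub>M\<^esub> y"
    by (rule M.a_rcosI) (use assms submodule_subset in auto)
  also have "(x \<ominus>\<^bsub>M\<^esub> y) \<oplus>\<^bsub>M\<^esub> y = x"
    using assms by (simp add: M.minus_eq M.a_assoc M.l_neg)
  finally show ?thesis using M.a_repr_independence H assms(4) by metis
qed

lemma quotient_module_carrier:
  "carrier (quotient_module M H) = (\<lambda>x. H +>\<^bsub>M\<^esub> x) ` carrier M"
  by (auto simp: quotient_module_def A_RCOSETS_def')

lemma quotient_module_add:
  assumes "module K M" "submodule H K M" "x \<in> carrier M" "y \<in> carrier M"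
  shows "(H +>\<^bsub>M\<^esub> x) \<oplus>\<^bsub>quotient_module M H\<^esub> (H +>\<^bsub>M\<^esub> y) = H +>\<^bsub>M\<^esub> (x \<oplus>\<^bsub>M\<^esub> y)"
proof -
  interpret M: module K M by fact
  interpret H: abelian_subgroup H M
    using assms(2) by (intro abelian_subgroupI2 M.a_comm_group) (simp add: submodule_def)
  show ?thesis using H.a_rcos_sum assms by (simp add: quotient_module_def)
qed

text \<open>The scalar multiple of a coset is defined as a union over its elements; closure of
  \<open>H\<close> under scalars makes all cosets in that union coincide.\<close>

lemma quotient_module_smult:
  assumes "module K M" "submodule H K M" "a \<in> carrier K" "x \<in> carrier M"
  shows "a \<odot>\<^bsub>quotient_module M H\<^esub> (H +>\<^bsub>M\<^esub> x) = H +>\<^bsub>M\<^esub> (a \<odot>\<^bsub>M\<^esub> x)"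
proof -
  interpret M: module K M by fact
  interpret H: abelian_subgroup H M
    using assms(2) by (intro abelian_subgroupI2 M.a_comm_group) (simp add: submodule_def)
  have "H +>\<^bsub>M\<^esub> (a \<odot>\<^bsub>M\<^esub> y) = H +>\<^bsub>M\<^esub> (a \<odot>\<^bsub>M\<^esub> x)" if y: "y \<in> H +>\<^bsub>M\<^esub> x" for y
  proof -
    obtain h where h: "h \<in> H" "y = h \<oplus>\<^bsub>M\<^esub> x"
      using y by (auto simp: a_r_coset_def')
    then have hM: "h \<in> carrier M" using H.a_subset by auto
    have "a \<odot>\<^bsub>M\<^esub> y = a \<odot>\<^bsub>M\<^esub> h \<oplus>\<^bsub>M\<^esub> a \<odot>\<^bsub>M\<^esub> x"
      using h hM assms by (simp add: M.smult_r_distr)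
    moreover have "a \<odot>\<^bsub>M\<^esub> h \<in> H" using submodule_smult assms h by metis
    ultimately have "a \<odot>\<^bsub>M\<^esub> y \<in> H +>\<^bsub>M\<^esub> (a \<odot>\<^bsub>M\<^esub> x)"
      using M.a_rcosI[OF _ H.a_subset] assms by simp
    then show ?thesis
      using M.a_repr_independence H.a_subgroup assms M.smult_closed by metis
  qed
  \<comment> \<open>The index set of the union is nonempty, so a union of equal cosets is that
    coset.\<close>
  moreover have "x \<in> H +>\<^bsub>M\<^esub> x" using H.a_rcos_self assms by simp
  ultimately have "(\<Union>y\<in>H +>\<^bsub>M\<^esub> x. H +>\<^bsub>M\<^esub> (a \<odot>\<^bsub>M\<^esub> y)) = H +>\<^bsub>M\<^esub> (a \<odot>\<^bsub>M\<^esub> x)" by blast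
  then show ?thesis by (simp add: quotient_module_def)
qed

lemma quotient_module_zero:
  assumes "module K M" "submodule H K M"
  shows "\<zero>\<^bsub>quotient_module M H\<^esub> = H +>\<^bsub>M\<^esub> \<zero>\<^bsub>M\<^esub>"
proof -
  interpret M: module K M by fact
  show ?thesis using submodule_subset[OF assms(2)] by (simp add: quotient_module_def)
qed

lemma module_quotient:
  assumes "module K M" "submodule H K M"
  shows "module K (quotient_module M H)"
proof -
  interpret M: module K M by fact
  note q = quotient_module_add[OF assms] quotient_module_smult[OF assms] quotient_module_zero[OF assms]
  have inv: "\<exists>y\<in>carrier M. H +>\<^bsub>M\<^esub> (x \<oplus>\<^bsub>M\<^esub> y) = H +>\<^bsub>M\<^esub> \<zero>\<^bsub>M\<^esub>" if "x \<in> carrier M" for x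
    using that by (intro bexI[of _ "\<ominus>\<^bsub>M\<^esub> x"]) (auto simp: M.r_neg)
  show ?thesis
    by (intro moduleI abelian_groupI M.is_cring)
      (auto simp: quotient_module_carrier q M.a_ac M.smult_l_distr M.smult_r_distr M.smult_assoc1 inv)
qed

lemma quotient_proj_hom:
  assumes "module K M" "submodule H K M"
  shows "(\<lambda>x\<in>carrier M. H +>\<^bsub>M\<^esub> x) \<in> module_hom K M (quotient_module M H)"
  by (rule module_hom_restrictI[OF assms(1)])
    (auto simp: quotient_module_carrier quotient_module_add[OF assms] quotient_module_smult[OF assms])

lemma generates_quotient:
  assumes "module K M" "submodule H K M" "generates K M S"
  shows "generates K (quotient_module M H) ((\<lambda>x. H +>\<^bsub>M\<^esub> x) ` S)"
proof -
  interpret M: module K M by fact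
  note q = quotient_module_add[OF assms(1,2)] quotient_module_smult[OF assms(1,2)]
    quotient_module_zero[OF assms(1,2)]
  have "x \<in> L" if L: "submodule L K (quotient_module M H)" "(\<lambda>x. H +>\<^bsub>M\<^esub> x) ` S \<subseteq> L"
    and x: "x \<in> carrier (quotient_module M H)" for L x
  proof -
    obtain y where y: "y \<in> carrier M" "x = H +>\<^bsub>M\<^esub> y" using x by (auto simp: quotient_module_carrier)
    have "H +>\<^bsub>M\<^esub> y \<in> L" using assms(1,3) y(1)
    proof (induction rule: generates_induct)
      case zero
      then show ?case using submodule_zero[OF L(1)] by (simp add: q)
    next
      case (gen x)
      then show ?case using L(2) by auto
    next
      case (add x y)
      then show ?case using submodule_add[OF L(1)] by (metis q(1))
    next
      case (smult a x)
      then show ?case using submodule_smult[OF L(1)] by (metis q(2))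
    qed
    then show ?thesis using y by simp
  qed
  then show ?thesis
    using assms(3) by (auto simp: generates_def quotient_module_carrier)
qed

text \<open>Universal property of a quotient by relations: killing the relations suffices, because
  the kernel of \<open>f\<close> is a submodule and hence contains their span.\<close>

lemma quotient_span_lift:
  assumes "module K M" "module K N" "S \<subseteq> carrier M"
    and "f \<in> module_hom K M N" "\<And>x. x \<in> S \<Longrightarrow> f x = \<zero>\<^bsub>N\<^esub>"
  defines "H \<equiv> submodule_span K M S"
  shows "\<exists>g \<in> module_hom K (quotient_module M H) N. \<forall>x\<in>carrier M. g (H +>\<^bsub>M\<^esub> x) = f x"
proof -
  interpret M: module K M by fact
  interpret N: module K N by fact
  have H: "submodule H K M" unfolding H_def by (rule submodule_span_subset) fact+
  interpret H: abelian_subgroup H M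
    using H by (intro abelian_subgroupI2 M.a_comm_group) (simp add: submodule_def)
  note q = quotient_module_add[OF assms(1) H] quotient_module_smult[OF assms(1) H]
  have "submodule {x \<in> carrier M. f x = \<zero>\<^bsub>N\<^esub>} K M"
    by (rule M.submoduleI')
      (use assms in \<open>auto simp: module_hom_zero module_hom_add module_hom_smult\<close>)
  then have "H \<subseteq> {x \<in> carrier M. f x = \<zero>\<^bsub>N\<^esub>}"
    unfolding H_def by (rule submodule_span_least) (use assms in auto)
  then have null: "f h = \<zero>\<^bsub>N\<^esub>" "h \<in> carrier M" if "h \<in> H" for h using that by auto
  have eq: "f x = f y" if "H +>\<^bsub>M\<^esub> x = H +>\<^bsub>M\<^esub> y" "x \<in> carrier M" "y \<in> carrier M" for x y
  proof -
    have "x \<in> H +>\<^bsub>M\<^esub> y" using H.a_rcos_self that by blast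
    then obtain h where "h \<in> H" "x = h \<oplus>\<^bsub>M\<^esub> y" by (auto simp: a_r_coset_def')
    then show ?thesis
      using null[of h] module_hom_add[OF assms(4), of h y] module_hom_closed[OF assms(4)] that by simp
  qed
  \<comment> \<open>A map on cosets through an arbitrary representative; \<open>eq\<close> shows
    that the choice does not matter.\<close>
  define g where "g A = f (SOME x. x \<in> carrier M \<and> A = H +>\<^bsub>M\<^esub> x)" for A
  have g: "g (H +>\<^bsub>M\<^esub> x) = f x" if "x \<in> carrier M" for x
    unfolding g_def using someI[of "\<lambda>y. y \<in> carrier M \<and> H +>\<^bsub>M\<^esub> x = H +>\<^bsub>M\<^esub> y" x] that
    by (auto intro: eq)
  have "(\<lambda>A\<in>carrier (quotient_module M H). g A) \<in> module_hom K (quotient_module M H) N"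
    by (rule module_hom_restrictI[OF module_quotient[OF assms(1) H]])
      (use assms(4) in \<open>auto simp: quotient_module_carrier q g module_hom_closed module_hom_add module_hom_smult\<close>)
  then show ?thesis
    by (rule rev_bexI) (auto simp: quotient_module_carrier g)
qed

section \<open>Free modules\<close>

lemma module_free:
  fixes K :: "('k, 'r) ring_scheme" and X :: "'x set"
  assumes "cring K" shows "module K (free_module K X)"
proof -
  interpret cring K by fact
  have fin: "finite {x. f x \<oplus>\<^bsub>K\<^esub> g x \<noteq> \<zero>\<^bsub>K\<^esub>}"
    if "finite {x. f x \<noteq> \<zero>\<^bsub>K\<^esub>}" "finite {x. g x \<noteq> \<zero>\<^bsub>K\<^esub>}" for f g :: "'x \<Rightarrow> 'k"
    by (rule finite_subset[OF _ finite_UnI[OF that]]) auto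
  have fin': "finite {x. a \<otimes>\<^bsub>K\<^esub> f x \<noteq> \<zero>\<^bsub>K\<^esub>}"
    if "a \<in> carrier K" "finite {x. f x \<noteq> \<zero>\<^bsub>K\<^esub>}" for a and f :: "'x \<Rightarrow> 'k"
    by (rule finite_subset[OF _ that(2)]) (use that in auto)
  have cl: "f x \<in> carrier K" if "f \<in> carrier (free_module K X)" for f x
    using that by (cases "x \<in> X") (auto simp: free_module_def)
  have inv: "\<exists>g\<in>carrier (free_module K X). g \<oplus>\<^bsub>free_module K X\<^esub> f = \<zero>\<^bsub>free_module K X\<^esub>"
    if f: "f \<in> carrier (free_module K X)" for f
    by (rule bexI[of _ "\<lambda>x. \<ominus>\<^bsub>K\<^esub> \<one>\<^bsub>K\<^esub> \<otimes>\<^bsub>K\<^esub> f x"])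
      (use f cl[OF f] in \<open>auto simp: free_module_def l_minus l_neg intro!: fin' a_inv_closed\<close>)
  show ?thesis
  proof (intro moduleI abelian_groupI is_cring)
    fix f assume "f \<in> carrier (free_module K X)"
    then show "\<exists>g\<in>carrier (free_module K X). g \<oplus>\<^bsub>free_module K X\<^esub> f = \<zero>\<^bsub>free_module K X\<^esub>"
      by (rule inv)
  qed (auto simp: free_module_def fin fin' a_ac m_assoc l_distr r_distr cl[unfolded free_module_def, simplified])
qed

lemma free_gen_closed: "cring K \<Longrightarrow> x \<in> X \<Longrightarrow> free_gen K x \<in> carrier (free_module K X)"
proof -
  assume "cring K" "x \<in> X"
  interpret cring K by fact
  show ?thesis using \<open>x \<in> X\<close> by (auto simp: free_gen_def free_module_def)
qed

lemma generates_free: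
  assumes "cring K"
  shows "generates K (free_module K X) (free_gen K ` X)"
proof -
  interpret cring K by fact
  interpret F: module K "free_module K X" by (rule module_free) fact
  \<comment> \<open>Induction over a finite superset \<open>A\<close> of the support, not over the
    support itself, so that a point of \<open>A\<close> with value zero can simply be
    dropped.\<close>
  have *: "f \<in> H" if H: "submodule H K (free_module K X)" "free_gen K ` X \<subseteq> H"
    and fin: "finite A" and f: "f \<in> carrier (free_module K X)" "{x. f x \<noteq> \<zero>\<^bsub>K\<^esub>} \<subseteq> A" for H A f
    using fin f
  proof (induction A arbitrary: f)
    case empty
    then have "f = \<zero>\<^bsub>free_module K X\<^esub>" by (auto simp: free_module_def)
    then show ?case using submodule_zero[OF H(1)] by simp
  next
    case (insert a A)
    show ?case
    proof (cases "f a = \<zero>\<^bsub>K\<^esub>")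
      case True
      then show ?thesis using insert by auto
    next
      case False
      then have a: "a \<in> X" "f a \<in> carrier K" using insert.prems by (auto simp: free_module_def)
      have cl: "f x \<in> carrier K" for x
        using insert.prems by (cases "x \<in> X") (auto simp: free_module_def)
      have "finite {x. (f(a := \<zero>\<^bsub>K\<^esub>)) x \<noteq> \<zero>\<^bsub>K\<^esub>}"
        by (rule finite_subset[of _ "{x. f x \<noteq> \<zero>\<^bsub>K\<^esub>}"]) (use insert.prems in \<open>auto simp: free_module_def\<close>)
      then have "f(a := \<zero>\<^bsub>K\<^esub>) \<in> carrier (free_module K X)"
        using insert.prems by (auto simp: free_module_def)
      moreover have "{x. (f(a := \<zero>\<^bsub>K\<^esub>)) x \<noteq> \<zero>\<^bsub>K\<^esub>} \<subseteq> A" using insert.prems by auto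
      ultimately have "f(a := \<zero>\<^bsub>K\<^esub>) \<in> H" by (rule insert.IH)
      moreover have "f a \<odot>\<^bsub>free_module K X\<^esub> free_gen K a \<in> H"
        using a H(2) by (intro submodule_smult[OF H(1)]) auto
      moreover have "f(a := \<zero>\<^bsub>K\<^esub>) \<oplus>\<^bsub>free_module K X\<^esub> (f a \<odot>\<^bsub>free_module K X\<^esub> free_gen K a) = f"
        using cl by (auto simp: free_module_def free_gen_def fun_eq_iff)
      ultimately show ?thesis using submodule_add[OF H(1)] by metis
    qed
  qed
  show ?thesis unfolding generates_def
  proof (intro conjI allI impI subsetI)
    fix H f assume "submodule H K (free_module K X)" "free_gen K ` X \<subseteq> H" "f \<in> carrier (free_module K X)"
    then show "f \<in> H" by (intro *[of H "{x. f x \<noteq> \<zero>\<^bsub>K\<^esub>}"]) (auto simp: free_module_def)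
  qed (auto simp: free_gen_closed assms)
qed

lemma free_lift:
  assumes "module K N" "\<Phi> \<in> X \<rightarrow> carrier N"
  shows "\<exists>f \<in> module_hom K (free_module K X) N. \<forall>x\<in>X. f (free_gen K x) = \<Phi> x"
proof -
  interpret N: module K N by fact
  let ?F = "free_module K X"
  define L where "L p = finsum N (\<lambda>x. p x \<odot>\<^bsub>N\<^esub> \<Phi> x) {x. p x \<noteq> \<zero>\<^bsub>K\<^esub>}" for p
  have supp: "{x. p x \<noteq> \<zero>\<^bsub>K\<^esub>} \<subseteq> X" "finite {x. p x \<noteq> \<zero>\<^bsub>K\<^esub>}" "p x \<in> carrier K"
    if "p \<in> carrier ?F" for p x
    using that by (cases "x \<in> X"; auto simp: free_module_def)+
  have \<Phi>: "\<Phi> x \<in> carrier N" if "x \<in> X" for x using assms(2) that by auto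
  \<comment> \<open>\<open>L\<close> sums over the support of \<open>p\<close>, which varies with
    \<open>p\<close>; every larger finite subset of \<open>X\<close> gives the same value, so two
    functions can be compared over the union of their supports.\<close>
  have L: "L p = finsum N (\<lambda>x. p x \<odot>\<^bsub>N\<^esub> \<Phi> x) A"
    if "p \<in> carrier ?F" "finite A" "{x. p x \<noteq> \<zero>\<^bsub>K\<^esub>} \<subseteq> A" "A \<subseteq> X" for p A
    unfolding L_def
    by (rule N.add.finprod_mono_neutral_cong_left) (use that supp \<Phi> in \<open>auto intro!: N.smult_closed\<close>)
  have F: "module K ?F" by (rule module_free) (rule N.is_cring)
  interpret F: module K ?F by fact
  have "(\<lambda>p\<in>carrier ?F. L p) \<in> module_hom K ?F N"
  proof (rule module_hom_restrictI[OF F])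
    fix p assume p: "p \<in> carrier ?F"
    show "L p \<in> carrier N"
      unfolding L_def using supp[OF p] \<Phi> by (intro N.finsum_closed) auto
    {
      fix q assume q: "q \<in> carrier ?F"
      let ?A = "{x. p x \<noteq> \<zero>\<^bsub>K\<^esub>} \<union> {x. q x \<noteq> \<zero>\<^bsub>K\<^esub>}"
      have A: "finite ?A" "?A \<subseteq> X" using supp[OF p] supp[OF q] by auto
      have pq: "p \<oplus>\<^bsub>?F\<^esub> q = (\<lambda>x. p x \<oplus>\<^bsub>K\<^esub> q x)" by (simp add: free_module_def)
      have "L (p \<oplus>\<^bsub>?F\<^esub> q) = finsum N (\<lambda>x. (p x \<oplus>\<^bsub>K\<^esub> q x) \<odot>\<^bsub>N\<^esub> \<Phi> x) ?A"
        by (subst L[OF F.a_closed[OF p q] A(1) _ A(2)]) (auto simp: pq)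
      also have "\<dots> = finsum N (\<lambda>x. p x \<odot>\<^bsub>N\<^esub> \<Phi> x \<oplus>\<^bsub>N\<^esub> q x \<odot>\<^bsub>N\<^esub> \<Phi> x) ?A"
        using A(2) \<Phi> supp[OF p] supp[OF q]
        by (intro N.add.finprod_cong') (auto simp: N.smult_l_distr subset_iff)
      also have "\<dots> = L p \<oplus>\<^bsub>N\<^esub> L q"
        using A \<Phi> supp[OF p] supp[OF q] L[OF p A(1) _ A(2)] L[OF q A(1) _ A(2)]
        by (subst N.finsum_addf) (auto simp: subset_iff)
      finally show "L (p \<oplus>\<^bsub>?F\<^esub> q) = L p \<oplus>\<^bsub>N\<^esub> L q" .
    }
    fix a assume a: "a \<in> carrier K"
    let ?A = "{x. p x \<noteq> \<zero>\<^bsub>K\<^esub>}"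
    have ap: "a \<odot>\<^bsub>?F\<^esub> p = (\<lambda>x. a \<otimes>\<^bsub>K\<^esub> p x)" by (simp add: free_module_def)
    have "L (a \<odot>\<^bsub>?F\<^esub> p) = finsum N (\<lambda>x. (a \<otimes>\<^bsub>K\<^esub> p x) \<odot>\<^bsub>N\<^esub> \<Phi> x) ?A"
      using a p by (subst L[of _ ?A]) (use supp[OF p] in \<open>auto simp: ap[symmetric], auto simp: ap\<close>)
    also have "\<dots> = finsum N (\<lambda>x. a \<odot>\<^bsub>N\<^esub> (p x \<odot>\<^bsub>N\<^esub> \<Phi> x)) ?A"
      using a \<Phi> supp[OF p] by (intro N.add.finprod_cong') (auto simp: N.smult_assoc1 subset_iff)
    also have "\<dots> = a \<odot>\<^bsub>N\<^esub> L p"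
      unfolding L_def using a \<Phi> supp[OF p] by (intro N.finsum_smult_ldistr[symmetric]) auto
    finally show "L (a \<odot>\<^bsub>?F\<^esub> p) = a \<odot>\<^bsub>N\<^esub> L p" .
  qed
  moreover have "L (free_gen K x) = \<Phi> x" if x: "x \<in> X" for x
  proof -
    have "L (free_gen K x) = finsum N (\<lambda>y. free_gen K x y \<odot>\<^bsub>N\<^esub> \<Phi> y) {x}"
      using x by (intro L free_gen_closed N.is_cring) (auto simp: free_gen_def)
    then show ?thesis using x \<Phi> by (simp add: free_gen_def)
  qed
  ultimately show ?thesis
    by (auto intro!: bexI[of _ "\<lambda>p\<in>carrier ?F. L p"] simp: free_gen_closed[OF N.is_cring])
qed

section \<open>Multilinear maps and tensor powers\<close>

text \<open>
  The simplifier would otherwise rewrite \<open>{1..d}\<close> to \<open>{Suc 0..d}\<close> and unfold membership in it, and facts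
  about tuples would no longer match.
\<close>

declare One_nat_def [simp del] atLeastAtMost_iff [simp del]

section \<open>Tuples and place permutations\<close>

lemma tuples_upd: "x \<in> tuples d A \<Longrightarrow> t \<in> {1..d} \<Longrightarrow> a \<in> A \<Longrightarrow> x(t := a) \<in> tuples d A"
  by (auto simp: PiE_def extensional_def)

lemma tuples_mem: "x \<in> tuples d A \<Longrightarrow> t \<in> {1..d} \<Longrightarrow> x t \<in> A"
  by blast

lemma place_perm_apply: "\<sigma> permutes S \<Longrightarrow> place_perm \<sigma> x (\<sigma> t) = x t"
  by (simp add: place_perm_def permutes_inverses)

lemma place_perm_tuples:
  assumes "\<sigma> permutes {1..d}" "x \<in> tuples d A"
  shows "place_perm \<sigma> x \<in> tuples d A"
proof (rule PiE_I)
  fix t assume "t \<in> {1..d}"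
  then have "inv_into UNIV \<sigma> t \<in> {1..d}" using permutes_in_image[OF permutes_inv[OF assms(1)]] by metis
  then show "place_perm \<sigma> x t \<in> A" using assms(2) by (auto simp: place_perm_def)
next
  fix t :: nat assume "t \<notin> {1..d}"
  then have "inv_into UNIV \<sigma> t \<notin> {1..d}" using permutes_in_image[OF permutes_inv[OF assms(1)]] by metis
  then show "place_perm \<sigma> x t = undefined"
    using assms(2) by (auto simp: place_perm_def PiE_def extensional_def)
qed

text \<open>The entry at place \<open>t\<close> moves to place \<open>\<sigma> t\<close>; this
  carries multilinearity through place permutations.\<close>

lemma place_perm_upd:
  assumes "\<sigma> permutes S"
  shows "place_perm \<sigma> (x(t := a)) = (place_perm \<sigma> x)(\<sigma> t := a)"
  using permutes_inverses[OF assms] by (auto simp: place_perm_def fun_eq_iff)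

text \<open>A left action: the inverse in the definition reverses composition, and precomposition
  reverses it once more.\<close>

lemma place_perm_comp:
  assumes "\<sigma> permutes S" "\<tau> permutes S"
  shows "place_perm (\<sigma> \<circ> \<tau>) x = place_perm \<sigma> (place_perm \<tau> x)"
  using permutes_bij[OF assms(1)] permutes_bij[OF assms(2)]
  by (simp add: place_perm_def o_inv_distrib o_assoc)

lemma place_perm_id: "place_perm id x = x"
  by (simp add: place_perm_def)

text \<open>Slot \<open>t\<close> of \<open>x\<close> is overwritten on both sides, so
  \<open>x\<close> only supplies the other entries. This is the shape of
  \<open>tensor_relations\<close>, whose generators express these equations.\<close>

definition multilinear ::
    "('k, 'r) ring_scheme \<Rightarrow> nat \<Rightarrow> ('k, 'a, 'p) module_scheme \<Rightarrow> ('k, 'b, 'q) module_scheme \<Rightarrow>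
      ((nat \<Rightarrow> 'a) \<Rightarrow> 'b) \<Rightarrow> bool"
  where "multilinear K d E N \<Phi> \<longleftrightarrow>
    \<Phi> \<in> tuples d (carrier E) \<rightarrow> carrier N \<and>
    (\<forall>x\<in>tuples d (carrier E). \<forall>t\<in>{1..d}.
      (\<forall>a\<in>carrier E. \<forall>b\<in>carrier E. \<Phi> (x(t := a \<oplus>\<^bsub>E\<^esub> b)) = \<Phi> (x(t := a)) \<oplus>\<^bsub>N\<^esub> \<Phi> (x(t := b))) \<and>
      (\<forall>r\<in>carrier K. \<forall>a\<in>carrier E. \<Phi> (x(t := r \<odot>\<^bsub>E\<^esub> a)) = r \<odot>\<^bsub>N\<^esub> \<Phi> (x(t := a))))"

lemma multilinearD:
  assumes "multilinear K d E N \<Phi>" "x \<in> tuples d (carrier E)"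
  shows "\<Phi> x \<in> carrier N"
    and "t \<in> {1..d} \<Longrightarrow> a \<in> carrier E \<Longrightarrow> b \<in> carrier E \<Longrightarrow>
      \<Phi> (x(t := a \<oplus>\<^bsub>E\<^esub> b)) = \<Phi> (x(t := a)) \<oplus>\<^bsub>N\<^esub> \<Phi> (x(t := b))"
    and "t \<in> {1..d} \<Longrightarrow> r \<in> carrier K \<Longrightarrow> a \<in> carrier E \<Longrightarrow> \<Phi> (x(t := r \<odot>\<^bsub>E\<^esub> a)) = r \<odot>\<^bsub>N\<^esub> \<Phi> (x(t := a))"
  using assms by (auto simp: multilinear_def)

lemma multilinear_hom:
  assumes "multilinear K d E N \<Phi>" "f \<in> module_hom K N P"
  shows "multilinear K d E P (\<lambda>x. f (\<Phi> x))"
  unfolding multilinear_def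
proof (intro conjI ballI)
  show "(\<lambda>x. f (\<Phi> x)) \<in> tuples d (carrier E) \<rightarrow> carrier P"
    using multilinearD(1)[OF assms(1)] module_hom_closed[OF assms(2)] by auto
qed (simp_all add: multilinearD[OF assms(1)] module_hom_add[OF assms(2)] module_hom_smult[OF assms(2)]
      tuples_upd)

lemma multilinear_place_perm:
  assumes "multilinear K d E N \<Phi>" "\<sigma> permutes {1..d}"
  shows "multilinear K d E N (\<lambda>x. \<Phi> (place_perm \<sigma> x))"
  unfolding multilinear_def
proof (intro conjI ballI)
  show "(\<lambda>x. \<Phi> (place_perm \<sigma> x)) \<in> tuples d (carrier E) \<rightarrow> carrier N"
    using multilinearD(1)[OF assms(1)] place_perm_tuples[OF assms(2)] by auto
  fix x t assume x: "x \<in> tuples d (carrier E)" and t: "t \<in> {1..d}"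
  have "\<sigma> t \<in> {1..d}" using permutes_in_image[OF assms(2)] t by metis
  note * = multilinearD(2,3)[OF assms(1) place_perm_tuples[OF assms(2) x] this]
  show "\<Phi> (place_perm \<sigma> (x(t := a \<oplus>\<^bsub>E\<^esub> b))) =
      \<Phi> (place_perm \<sigma> (x(t := a))) \<oplus>\<^bsub>N\<^esub> \<Phi> (place_perm \<sigma> (x(t := b)))"
    if "a \<in> carrier E" "b \<in> carrier E" for a b
    using * that by (simp add: place_perm_upd[OF assms(2)])
  show "\<Phi> (place_perm \<sigma> (x(t := r \<odot>\<^bsub>E\<^esub> a))) = r \<odot>\<^bsub>N\<^esub> \<Phi> (place_perm \<sigma> (x(t := a)))"
    if "r \<in> carrier K" "a \<in> carrier E" for r a
    using * that by (simp add: place_perm_upd[OF assms(2)])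
qed

lemma tensor_relations_closed:
  assumes "module K E"
  shows "tensor_relations K d E \<subseteq> carrier (free_tuples K d E)"
proof -
  interpret E: module K E by fact
  interpret F: module K "free_tuples K d E" by (rule module_free) (rule E.is_cring)
  show ?thesis
    unfolding tensor_relations_def
    by (auto intro!: F.minus_closed F.a_closed F.smult_closed free_gen_closed E.is_cring tuples_upd)
qed

lemma tensor_span_submodule:
  assumes "module K E"
  shows "submodule (submodule_span K (free_tuples K d E) (tensor_relations K d E)) K (free_tuples K d E)"
  by (rule submodule_span_subset[OF module_free tensor_relations_closed])
    (use assms in \<open>auto simp: module_def\<close>)

lemma module_tensor_power:
  assumes "module K E" shows "module K (tensor_power K d E)"
  unfolding tensor_power_def
  by (rule module_quotient[OF module_free tensor_span_submodule])
    (use assms in \<open>auto simp: module_def\<close>)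

lemma generates_tensor:
  assumes "module K E"
  shows "generates K (tensor_power K d E) (tensor K d E ` tuples d (carrier E))"
proof -
  have "cring K" using assms by (simp add: module_def)
  from generates_quotient[OF module_free[OF this] tensor_span_submodule[OF assms]
      generates_free[OF this], of d]
  show ?thesis by (simp add: tensor_power_def tensor_def image_image)
qed

text \<open>Each relation lies in the span that is factored out, so the cosets on its two sides are
  equal.\<close>

lemma multilinear_tensor:
  assumes "module K E"
  shows "multilinear K d E (tensor_power K d E) (tensor K d E)"
proof -
  interpret E: module K E by fact
  let ?F = "free_tuples K d E"
  have F: "module K ?F" by (rule module_free) (rule E.is_cring)
  interpret F: module K ?F by fact
  note H = tensor_span_submodule[OF assms, of d]
  have gen: "free_gen K x \<in> carrier ?F" if "x \<in> tuples d (carrier E)" for x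
    using free_gen_closed[OF E.is_cring that] .
  show ?thesis
    unfolding multilinear_def
  proof (intro conjI ballI)
    show "tensor K d E \<in> tuples d (carrier E) \<rightarrow> carrier (tensor_power K d E)"
      using generates_tensor[OF assms, of d] by (auto simp: generates_def)
    fix x t assume x: "x \<in> tuples d (carrier E)" and t: "t \<in> {1..d}"
    show "tensor K d E (x(t := a \<oplus>\<^bsub>E\<^esub> b)) =
        tensor K d E (x(t := a)) \<oplus>\<^bsub>tensor_power K d E\<^esub> tensor K d E (x(t := b))"
      if "a \<in> carrier E" "b \<in> carrier E" for a b
    proof -
      have "free_gen K (x(t := a \<oplus>\<^bsub>E\<^esub> b)) \<ominus>\<^bsub>?F\<^esub> (free_gen K (x(t := a)) \<oplus>\<^bsub>?F\<^esub> free_gen K (x(t := b)))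
          \<in> tensor_relations K d E"
        using x t that unfolding tensor_relations_def by blast
      from r_coset_eqI[OF F H _ _ submodule_span_incl[OF this]] show ?thesis
        using x t that by (simp add: tensor_def tensor_power_def quotient_module_add[OF F H] gen tuples_upd)
    qed
    show "tensor K d E (x(t := r \<odot>\<^bsub>E\<^esub> a)) = r \<odot>\<^bsub>tensor_power K d E\<^esub> tensor K d E (x(t := a))"
      if "r \<in> carrier K" "a \<in> carrier E" for r a
    proof -
      have "free_gen K (x(t := r \<odot>\<^bsub>E\<^esub> a)) \<ominus>\<^bsub>?F\<^esub> (r \<odot>\<^bsub>?F\<^esub> free_gen K (x(t := a))) \<in> tensor_relations K d E"
        using x t that unfolding tensor_relations_def by blast
      from r_coset_eqI[OF F H _ _ submodule_span_incl[OF this]] show ?thesis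
        using x t that by (simp add: tensor_def tensor_power_def quotient_module_smult[OF F H] gen tuples_upd)
    qed
  qed
qed

text \<open>Universal property of the tensor power: the linear extension to the free module kills
  the two families of relations because \<Phi> is additive and homogeneous in each slot.\<close>

lemma tensor_lift:
  assumes "module K E" "module K N" "multilinear K d E N \<Phi>"
  shows "\<exists>g \<in> module_hom K (tensor_power K d E) N. \<forall>x\<in>tuples d (carrier E). g (tensor K d E x) = \<Phi> x"
proof -
  interpret E: module K E by fact
  interpret N: module K N by fact
  let ?F = "free_tuples K d E"
  have F: "module K ?F" by (rule module_free) (rule E.is_cring)
  interpret F: module K ?F by fact
  note \<Phi> = multilinearD[OF assms(3)]
  have gen: "free_gen K x \<in> carrier ?F" if "x \<in> tuples d (carrier E)" for x
    using free_gen_closed[OF E.is_cring that] .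
  obtain f where f: "f \<in> module_hom K ?F N"
    and f_gen: "\<And>x. x \<in> tuples d (carrier E) \<Longrightarrow> f (free_gen K x) = \<Phi> x"
    using free_lift[OF assms(2), of \<Phi> "tuples d (carrier E)"] \<Phi>(1) by blast
  have "f z = \<zero>\<^bsub>N\<^esub>" if "z \<in> tensor_relations K d E" for z
    using that unfolding tensor_relations_def
    by (auto simp: module_hom_a_minus[OF F assms(2) f] module_hom_add[OF f] module_hom_smult[OF f]
      gen f_gen tuples_upd \<Phi> N.r_neg N.minus_eq)
  then obtain g where "g \<in> module_hom K (tensor_power K d E) N"
    "\<And>z. z \<in> carrier ?F \<Longrightarrow> g (submodule_span K ?F (tensor_relations K d E) +>\<^bsub>?F\<^esub> z) = f z"
    using quotient_span_lift[OF F assms(2) tensor_relations_closed[OF assms(1)] f]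
    unfolding tensor_power_def by blast
  then show ?thesis by (intro bexI[of _ g]) (auto simp: tensor_def gen f_gen)
qed

text \<open>Justifies the definite description: existence from \<open>tensor_lift\<close> applied to
  permuted tensors, uniqueness since decomposable tensors generate.\<close>

lemma tensor_act:
  assumes "module K E" "\<sigma> permutes {1..d}"
  shows "tensor_act K d E \<sigma> \<in> module_hom K (tensor_power K d E) (tensor_power K d E)"
    and "x \<in> tuples d (carrier E) \<Longrightarrow>
      tensor_act K d E \<sigma> (tensor K d E x) = tensor K d E (place_perm \<sigma> x)"
proof -
  note T = module_tensor_power[OF assms(1), of d]
  have "\<exists>!g. g \<in> module_hom K (tensor_power K d E) (tensor_power K d E) \<and>
      (\<forall>x\<in>tuples d (carrier E). g (tensor K d E x) = tensor K d E (place_perm \<sigma> x))"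
  proof (rule ex_ex1I)
    show "\<exists>g. g \<in> module_hom K (tensor_power K d E) (tensor_power K d E) \<and>
      (\<forall>x\<in>tuples d (carrier E). g (tensor K d E x) = tensor K d E (place_perm \<sigma> x))"
      using tensor_lift[OF assms(1) T multilinear_place_perm[OF multilinear_tensor[OF assms(1)] assms(2)]]
      by blast
  qed (auto intro!: generates_hom_ext[OF T T generates_tensor[OF assms(1)]])
  from theI'[OF this] show
    "tensor_act K d E \<sigma> \<in> module_hom K (tensor_power K d E) (tensor_power K d E)"
    "x \<in> tuples d (carrier E) \<Longrightarrow>
      tensor_act K d E \<sigma> (tensor K d E x) = tensor K d E (place_perm \<sigma> x)"
    by (auto simp: tensor_act_def)
qed

section \<open>The functors attached to a character\<close>

text \<open>Only the data of the functor, so that the results also apply to the inverse character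
  and to the restriction of \<chi> to a stabilizer. Invertibility of the group order and absence of
  zero divisors are hypotheses of the lemmas that draw on them.\<close>

locale perm_character = cring K
  for K :: "('k, 'r) ring_scheme" (structure) +
  fixes d :: nat and W :: "(nat \<Rightarrow> nat) set" and \<chi> :: "(nat \<Rightarrow> nat) \<Rightarrow> 'k"
  assumes subgroup_W: "subgroup W (sym_group d)"
    and char_hom: "\<chi> \<in> hom (perm_group d W) (units_of K)"
begin

lemma W_permutes: "\<sigma> \<in> W \<Longrightarrow> \<sigma> permutes {1..d}"
  using subgroup.subset[OF subgroup_W] by (auto simp: sym_group_def)

lemma W_comp: "\<sigma> \<in> W \<Longrightarrow> \<tau> \<in> W \<Longrightarrow> \<sigma> \<circ> \<tau> \<in> W"
  using subgroup.m_closed[OF subgroup_W] by (simp add: sym_group_def)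

lemma W_id: "id \<in> W"
  using subgroup.one_closed[OF subgroup_W] by (simp add: sym_group_def)

lemma W_inv: "\<sigma> \<in> W \<Longrightarrow> inv_into UNIV \<sigma> \<in> W"
  using subgroup.m_inv_closed[OF subgroup_W] subgroup.subset[OF subgroup_W]
  by (metis subsetD sym_group_inv_equality)

lemma finite_W: "finite W"
  by (rule finite_subset[OF _ finite_permutations[of "{1..d}"]]) (auto simp: W_permutes)

lemma char_Units: "\<sigma> \<in> W \<Longrightarrow> \<chi> \<sigma> \<in> Units K"
  using char_hom by (auto simp: hom_def units_of_def)

lemma char_closed: "\<sigma> \<in> W \<Longrightarrow> \<chi> \<sigma> \<in> carrier K"
  using char_Units by auto

lemma char_inv_closed: "\<sigma> \<in> W \<Longrightarrow> inv (\<chi> \<sigma>) \<in> carrier K"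
  using char_Units by auto

lemma char_comp: "\<sigma> \<in> W \<Longrightarrow> \<tau> \<in> W \<Longrightarrow> \<chi> (\<sigma> \<circ> \<tau>) = \<chi> \<sigma> \<otimes> \<chi> \<tau>"
  using char_hom by (auto simp: hom_def units_of_def sym_group_def)

lemma inv_mult_Units: "a \<in> Units K \<Longrightarrow> b \<in> Units K \<Longrightarrow> inv (a \<otimes> b) = inv a \<otimes> inv b"
  using comm_group.inv_mult[OF units_comm_group, of a b]
  by (simp add: units_of_carrier units_of_inv units_of_mult)

text \<open>Makes everything proved about \<open>[\<chi>]^d(E)\<close> available for the inverse
  character on the dual.\<close>

lemma perm_character_inv_char: "perm_character K d W (inv_char K \<chi>)"
proof (intro perm_character.intro perm_character_axioms.intro cring_axioms subgroup_W)
  show "inv_char K \<chi> \<in> hom (perm_group d W) (units_of K)"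
    using char_comp char_Units
    by (auto simp: hom_def units_of_def inv_char_def sym_group_def inv_mult_Units)
qed

lemma chi_relations_closed:
  assumes "module K E"
  shows "chi_relations K d W \<chi> E \<subseteq> carrier (tensor_power K d E)"
proof -
  interpret T: module K "tensor_power K d E" by (rule module_tensor_power) fact
  show ?thesis
    using tensor_act(1)[OF assms W_permutes] char_inv_closed unfolding chi_relations_def
    by (auto intro!: T.minus_closed T.smult_closed intro: module_hom_closed)
qed

lemma chi_span_submodule:
  assumes "module K E"
  shows "submodule (submodule_span K (tensor_power K d E) (chi_relations K d W \<chi> E)) K (tensor_power K d E)"
  by (rule submodule_span_subset[OF module_tensor_power chi_relations_closed]) fact+

lemma module_chi_power:
  assumes "module K E" shows "module K (chi_power K d W \<chi> E)"
  unfolding chi_power_def by (rule module_quotient[OF module_tensor_power chi_span_submodule]) fact+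

lemma multilinear_chi_prod:
  assumes "module K E"
  shows "multilinear K d E (chi_power K d W \<chi> E) (chi_prod K d W \<chi> E)"
proof -
  interpret E: module K E by fact
  note T = module_tensor_power[OF assms, of d]
  note t = multilinear_tensor[OF assms, of d]
  from multilinear_hom[OF t quotient_proj_hom[OF T chi_span_submodule[OF assms]]]
  have "multilinear K d E (chi_power K d W \<chi> E) (\<lambda>x.
    (\<lambda>z\<in>carrier (tensor_power K d E). submodule_span K (tensor_power K d E) (chi_relations K d W \<chi> E)
      +>\<^bsub>tensor_power K d E\<^esub> z) (tensor K d E x))" by (simp add: chi_power_def)
  then show ?thesis
    using multilinearD(1)[OF t] by (simp add: multilinear_def chi_prod_def[abs_def] tuples_upd Pi_def)
qed

lemma generates_chi_prod:
  assumes "module K E"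
  shows "generates K (chi_power K d W \<chi> E) (chi_prod K d W \<chi> E ` tuples d (carrier E))"
  using generates_quotient[OF module_tensor_power[OF assms] chi_span_submodule[OF assms]
      generates_tensor[OF assms]]
  by (simp add: chi_power_def chi_prod_def[abs_def] image_image)

lemma chi_prod_closed:
  "module K E \<Longrightarrow> x \<in> tuples d (carrier E) \<Longrightarrow> chi_prod K d W \<chi> E x \<in> carrier (chi_power K d W \<chi> E)"
  using multilinearD(1)[OF multilinear_chi_prod] .

text \<open>The defining relation taken at a decomposable tensor, whose image under \<sigma> is
  known.\<close>

lemma chi_prod_place_perm:
  assumes "module K E" "\<sigma> \<in> W" "x \<in> tuples d (carrier E)"
  shows "chi_prod K d W \<chi> E (place_perm \<sigma> x) = inv (\<chi> \<sigma>) \<odot>\<^bsub>chi_power K d W \<chi> E\<^esub> chi_prod K d W \<chi> E x"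
proof -
  note T = module_tensor_power[OF assms(1), of d]
  interpret T: module K "tensor_power K d E" by fact
  note H = chi_span_submodule[OF assms(1)]
  note tc = multilinearD(1)[OF multilinear_tensor[OF assms(1)]]
  let ?z = "tensor K d E x"
  have "inv (\<chi> \<sigma>) \<odot>\<^bsub>tensor_power K d E\<^esub> ?z \<ominus>\<^bsub>tensor_power K d E\<^esub> tensor_act K d E \<sigma> ?z
      \<in> chi_relations K d W \<chi> E"
    unfolding chi_relations_def using assms tc by blast
  then have "inv (\<chi> \<sigma>) \<odot>\<^bsub>tensor_power K d E\<^esub> ?z \<ominus>\<^bsub>tensor_power K d E\<^esub> tensor K d E (place_perm \<sigma> x)
      \<in> submodule_span K (tensor_power K d E) (chi_relations K d W \<chi> E)"
    using tensor_act(2)[OF assms(1) W_permutes[OF assms(2)] assms(3)]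
    by (auto intro: submodule_span_incl)
  from r_coset_eqI[OF T H T.smult_closed[OF char_inv_closed[OF assms(2)] tc[OF assms(3)]]
      tc[OF place_perm_tuples[OF W_permutes[OF assms(2)] assms(3)]] this]
  show ?thesis
    using assms tc char_inv_closed by (simp add: chi_prod_def chi_power_def quotient_module_smult[OF T H])
qed

text \<open>Universal property of \<open>[\<chi>]^d(E)\<close>, reached through that of the tensor
  power. The hypothesis concerns tuples, while the relations to be killed range over all
  tensors.\<close>

lemma chi_power_lift:
  assumes "module K E" "module K N" "multilinear K d E N \<Phi>"
    and "\<And>\<sigma> x. \<sigma> \<in> W \<Longrightarrow> x \<in> tuples d (carrier E) \<Longrightarrow> \<Phi> (place_perm \<sigma> x) = inv (\<chi> \<sigma>) \<odot>\<^bsub>N\<^esub> \<Phi> x"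
  shows "\<exists>!g. g \<in> module_hom K (chi_power K d W \<chi> E) N \<and>
    (\<forall>x\<in>tuples d (carrier E). g (chi_prod K d W \<chi> E x) = \<Phi> x)"
proof -
  note T = module_tensor_power[OF assms(1), of d]
  interpret T: module K "tensor_power K d E" by fact
  interpret N: module K N by fact
  note tc = multilinearD(1)[OF multilinear_tensor[OF assms(1)]]
  obtain f where f: "f \<in> module_hom K (tensor_power K d E) N"
    and fx: "\<And>x. x \<in> tuples d (carrier E) \<Longrightarrow> f (tensor K d E x) = \<Phi> x"
    using tensor_lift[OF assms(1-3)] by blast
  have "f z = \<zero>\<^bsub>N\<^esub>" if z: "z \<in> chi_relations K d W \<chi> E" for z
  proof -
    obtain \<sigma> y where y: "\<sigma> \<in> W" "y \<in> carrier (tensor_power K d E)"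
      "z = inv (\<chi> \<sigma>) \<odot>\<^bsub>tensor_power K d E\<^esub> y \<ominus>\<^bsub>tensor_power K d E\<^esub> tensor_act K d E \<sigma> y"
      using z by (auto simp: chi_relations_def)
    note act = tensor_act[OF assms(1) W_permutes[OF y(1)]]
    note i = char_inv_closed[OF y(1)]
    \<comment> \<open>Equivariance extends from decomposable tensors to all tensors, both sides
      being linear in \<open>y\<close>.\<close>
    have "f (tensor_act K d E \<sigma> y) = inv (\<chi> \<sigma>) \<odot>\<^bsub>N\<^esub> f y"
      using T generates_tensor[OF assms(1)] y(2)
    proof (induction rule: generates_induct)
      case zero
      then show ?case using i
        by (simp add: module_hom_zero[OF T T act(1)] module_hom_zero[OF T assms(2) f])
    next
      case (gen z)
      then show ?case
        by (auto simp: act(2) fx assms(4)[OF y(1)] place_perm_tuples[OF W_permutes[OF y(1)]])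
    next
      case (add a b)
      then show ?case using i
        by (simp add: module_hom_add[OF act(1)] module_hom_add[OF f] module_hom_closed[OF act(1)]
            module_hom_closed[OF f] N.smult_r_distr)
    next
      case (smult r a)
      then have "r \<odot>\<^bsub>N\<^esub> (inv (\<chi> \<sigma>) \<odot>\<^bsub>N\<^esub> f a) = inv (\<chi> \<sigma>) \<odot>\<^bsub>N\<^esub> (r \<odot>\<^bsub>N\<^esub> f a)"
        using i by (metis N.smult_assoc1 m_comm module_hom_closed[OF f])
      with smult show ?case
        by (simp add: module_hom_smult[OF act(1)] module_hom_smult[OF f] module_hom_closed[OF act(1)])
    qed
    moreover have "inv (\<chi> \<sigma>) \<odot>\<^bsub>N\<^esub> f y \<in> carrier N" using i y(2) module_hom_closed[OF f] by simp
    ultimately show ?thesis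
      unfolding y(3)
      using module_hom_a_minus[OF T assms(2) f T.smult_closed[OF i y(2)] module_hom_closed[OF act(1) y(2)]]
      by (simp add: module_hom_smult[OF f i y(2)] N.minus_eq N.r_neg)
  qed
  then obtain g where g: "g \<in> module_hom K (chi_power K d W \<chi> E) N"
    "\<And>z. z \<in> carrier (tensor_power K d E) \<Longrightarrow>
      g (submodule_span K (tensor_power K d E) (chi_relations K d W \<chi> E) +>\<^bsub>tensor_power K d E\<^esub> z) = f z"
    using quotient_span_lift[OF T assms(2) chi_relations_closed[OF assms(1)] f]
    unfolding chi_power_def by blast
  show ?thesis
  proof (rule ex1I[of _ g])
    show "g \<in> module_hom K (chi_power K d W \<chi> E) N \<and>
      (\<forall>x\<in>tuples d (carrier E). g (chi_prod K d W \<chi> E x) = \<Phi> x)"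
      using g by (auto simp: chi_prod_def tc fx)
    then show "h = g" if "h \<in> module_hom K (chi_power K d W \<chi> E) N \<and>
      (\<forall>x\<in>tuples d (carrier E). h (chi_prod K d W \<chi> E x) = \<Phi> x)" for h
      using that
      by (intro generates_hom_ext[OF module_chi_power[OF assms(1)] assms(2) generates_chi_prod[OF assms(1)]])
        auto
  qed
qed

end

section \<open>Bilinear forms and dual bases\<close>

lemma associated_map_hom:
  assumes "module K M" "module K N" "B \<in> bilinear_forms K M N"
  shows "associated_map M N B \<in> module_hom K N (dual_module K M)"
proof -
  interpret M: module K M by fact
  interpret N: module K N by fact
  have B: "(\<lambda>x\<in>carrier M. B (x, y)) \<in> module_hom K M (regular_module K)" if "y \<in> carrier N" for y
    using assms(3) that by (simp add: bilinear_forms_def)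
  have B': "(\<lambda>y\<in>carrier N. B (x, y)) \<in> module_hom K N (regular_module K)" if "x \<in> carrier M" for x
    using assms(3) that by (simp add: bilinear_forms_def)
  show ?thesis unfolding associated_map_def
  proof (rule module_hom_restrictI[OF assms(2)])
    fix y z assume y: "y \<in> carrier N" and z: "z \<in> carrier N"
    have "B (x, y \<oplus>\<^bsub>N\<^esub> z) = B (x, y) \<oplus>\<^bsub>K\<^esub> B (x, z)" if "x \<in> carrier M" for x
      using module_hom_add[OF B'[OF that] y z] y z by simp
    then show "(\<lambda>x\<in>carrier M. B (x, y \<oplus>\<^bsub>N\<^esub> z)) =
        (\<lambda>x\<in>carrier M. B (x, y)) \<oplus>\<^bsub>dual_module K M\<^esub> (\<lambda>x\<in>carrier M. B (x, z))"
      by (auto intro!: restrict_ext)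
  next
    fix a y assume a: "a \<in> carrier K" and y: "y \<in> carrier N"
    have "B (x, a \<odot>\<^bsub>N\<^esub> y) = a \<otimes>\<^bsub>K\<^esub> B (x, y)" if "x \<in> carrier M" for x
      using module_hom_smult[OF B'[OF that] a y] a y by simp
    then show "(\<lambda>x\<in>carrier M. B (x, a \<odot>\<^bsub>N\<^esub> y)) = a \<odot>\<^bsub>dual_module K M\<^esub> (\<lambda>x\<in>carrier M. B (x, y))"
      by (auto intro!: restrict_ext)
  qed (simp add: B)
qed

text \<open>Reverses the passage from a form to its associated map, so that a form on two quotients
  can be produced as a linear map into a dual.\<close>

lemma bilinear_form_of_hom:
  assumes "module K M" "module K N" "f \<in> module_hom K N (dual_module K M)"
  shows "(\<lambda>(x, y) \<in> carrier M \<times> carrier N. f y x) \<in> bilinear_forms K M N"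
proof -
  interpret M: module K M by fact
  interpret N: module K N by fact
  have f: "f y \<in> module_hom K M (regular_module K)" if "y \<in> carrier N" for y
    using module_hom_closed[OF assms(3) that] by simp
  \<comment> \<open>Members of a dual are extensional, so restricting them to the carrier changes
    nothing.\<close>
  have 1: "(\<lambda>x\<in>carrier M. (\<lambda>(x, y)\<in>carrier M \<times> carrier N. f y x) (x, y)) = f y" if "y \<in> carrier N" for y
    using f[OF that] that by (auto simp: module_hom_def PiE_def extensional_def fun_eq_iff)
  have 2: "(\<lambda>y\<in>carrier N. (\<lambda>(x, y)\<in>carrier M \<times> carrier N. f y x) (x, y)) = (\<lambda>y\<in>carrier N. f y x)"
    if "x \<in> carrier M" for x
    using that by (auto intro!: restrict_ext)
  have 3: "(\<lambda>y\<in>carrier N. f y x) \<in> module_hom K N (regular_module K)" if "x \<in> carrier M" for x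
    by (rule module_hom_restrictI[OF assms(2)])
      (use that module_hom_closed[OF f that] in \<open>simp_all add: module_hom_add[OF assms(3)] module_hom_smult[OF assms(3)]\<close>)
  have "(\<lambda>(x, y)\<in>carrier M \<times> carrier N. f y x) \<in> carrier M \<times> carrier N \<rightarrow>\<^sub>E carrier K"
    using module_hom_closed[OF f] by (auto simp: PiE_def extensional_def)
  then show ?thesis
    unfolding bilinear_forms_def using f 3 by (simp add: 1 2 del: restrict_apply)
qed

lemma module_hom_regular_closed:
  "f \<in> module_hom K M (regular_module K) \<Longrightarrow> x \<in> carrier M \<Longrightarrow> f x \<in> carrier K"
  using module_hom_closed[of f K M "regular_module K"] by simp

lemma eval_hom:
  assumes "module K M" "x \<in> carrier M"
  shows "(\<lambda>f\<in>carrier (dual_module K M). f x) \<in> module_hom K (dual_module K M) (regular_module K)"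
  by (rule module_hom_restrictI[OF module_dual[OF assms(1)]])
    (use assms(2) module_hom_regular_closed in auto)

text \<open>Evaluation at \<open>x\<close> is linear on the dual, which moves it inside the
  sum.\<close>

lemma dual_finsum_apply:
  assumes "module K M" "finite A" "g \<in> A \<rightarrow> carrier (dual_module K M)" "x \<in> carrier M"
  shows "finsum (dual_module K M) g A x = finsum K (\<lambda>i. g i x) A"
proof -
  have K: "cring K" using assms(1) by (simp add: module_def)
  interpret K: cring K by fact
  interpret D: module K "dual_module K M" by (rule module_dual) fact
  have "finsum (dual_module K M) g A \<in> carrier (dual_module K M)" using assms(3) by (rule D.finsum_closed)
  then have "finsum (dual_module K M) g A x
      = finsum (regular_module K) (\<lambda>i. (\<lambda>f\<in>carrier (dual_module K M). f x) (g i)) A"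
    using module_hom_finsum[OF module_dual[OF assms(1)] module_regular[OF K] eval_hom[OF assms(1,4)] assms(2,3)]
    by simp
  also have "\<dots> = finsum K (\<lambda>i. g i x) A"
    unfolding regular_module_finsum
    using assms(3,4) by (intro K.add.finprod_cong') (auto simp: Pi_def intro: module_hom_regular_closed)
  finally show ?thesis .
qed

lemma (in cring) finsum_delta:
  assumes "finite J" "j \<in> J" "c \<in> J \<rightarrow> carrier R"
  shows "finsum R (\<lambda>i. c i \<otimes> (if i = j then \<one> else \<zero>)) J = c j"
    and "finsum R (\<lambda>i. c i \<otimes> (if j = i then \<one> else \<zero>)) J = c j"
proof -
  have "finsum R (\<lambda>i. if j = i then c i else \<zero>) J = c j"
    using assms by (intro add.finprod_singleton) auto
  moreover have "finsum R (\<lambda>i. c i \<otimes> (if i = j then \<one> else \<zero>)) J = finsum R (\<lambda>i. if j = i then c i else \<zero>) J"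
    "finsum R (\<lambda>i. c i \<otimes> (if j = i then \<one> else \<zero>)) J = finsum R (\<lambda>i. if j = i then c i else \<zero>) J"
    by (rule add.finprod_cong'; use assms in \<open>auto simp: Pi_def\<close>)+
  ultimately show "finsum R (\<lambda>i. c i \<otimes> (if i = j then \<one> else \<zero>)) J = c j"
    "finsum R (\<lambda>i. c i \<otimes> (if j = i then \<one> else \<zero>)) J = c j" by simp_all
qed

text \<open>Both sides take the value \<open>f (b i)\<close> at the generator \<open>b i\<close>,
  and linear maps are determined there.\<close>

lemma dual_expansion:
  assumes "module K P" "finite J" "generates K P (b ` J)"
    and "g \<in> J \<rightarrow> carrier (dual_module K P)"
    and "\<And>i j. i \<in> J \<Longrightarrow> j \<in> J \<Longrightarrow> g j (b i) = (if i = j then \<one>\<^bsub>K\<^esub> else \<zero>\<^bsub>K\<^esub>)"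
    and "f \<in> carrier (dual_module K P)"
  shows "f = finsum (dual_module K P) (\<lambda>j. f (b j) \<odot>\<^bsub>dual_module K P\<^esub> g j) J"
proof -
  have K: "cring K" using assms(1) by (simp add: module_def)
  interpret K: cring K by fact
  interpret D: module K "dual_module K P" by (rule module_dual) fact
  have b: "b i \<in> carrier P" if "i \<in> J" for i using assms(3) that by (auto simp: generates_def)
  have f: "f \<in> module_hom K P (regular_module K)" using assms(6) by simp
  have fb: "f (b i) \<in> carrier K" if "i \<in> J" for i
    using module_hom_closed[OF f b[OF that]] by simp
  have g: "(\<lambda>j. f (b j) \<odot>\<^bsub>dual_module K P\<^esub> g j) \<in> J \<rightarrow> carrier (dual_module K P)"
    using assms(4) fb by (intro Pi_I D.smult_closed) auto
  have "finsum (dual_module K P) (\<lambda>j. f (b j) \<odot>\<^bsub>dual_module K P\<^esub> g j) J \<in> module_hom K P (regular_module K)"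
    using D.finsum_closed[OF g] by simp
  moreover have "f (b i) = finsum (dual_module K P) (\<lambda>j. f (b j) \<odot>\<^bsub>dual_module K P\<^esub> g j) J (b i)"
    if "i \<in> J" for i
  proof -
    have "finsum (dual_module K P) (\<lambda>j. f (b j) \<odot>\<^bsub>dual_module K P\<^esub> g j) J (b i)
        = finsum K (\<lambda>j. (f (b j) \<odot>\<^bsub>dual_module K P\<^esub> g j) (b i)) J"
      by (rule dual_finsum_apply[OF assms(1,2) g b[OF that]])
    also have "\<dots> = finsum K (\<lambda>j. f (b j) \<otimes>\<^bsub>K\<^esub> (if i = j then \<one>\<^bsub>K\<^esub> else \<zero>\<^bsub>K\<^esub>)) J"
      using that b fb assms(5) by (intro K.add.finprod_cong') auto
    also have "\<dots> = f (b i)"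
      using fb by (intro K.finsum_delta(2)[OF assms(2) that]) auto
    finally show ?thesis by simp
  qed
  ultimately show ?thesis
    by (intro generates_hom_ext[OF assms(1) module_regular[OF K] assms(3) f]) auto
qed

lemma generates_dual_family:
  assumes "module K E" "module_basis K E I e" "dual_family K E I e e'"
  shows "generates K (dual_module K E) (e' ` I)"
proof -
  interpret D: module K "dual_module K E" by (rule module_dual) fact
  have fin: "finite I" and e: "e \<in> I \<rightarrow> carrier E" using assms(2) by (auto simp: module_basis_def)
  have e': "e' \<in> I \<rightarrow> carrier (dual_module K E)"
    and \<delta>: "\<And>i j. i \<in> I \<Longrightarrow> j \<in> I \<Longrightarrow> e' j (e i) = (if i = j then \<one>\<^bsub>K\<^esub> else \<zero>\<^bsub>K\<^esub>)"
    using assms(3) by (auto simp: dual_family_def)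
  have "f \<in> H" if H: "submodule H K (dual_module K E)" "e' ` I \<subseteq> H"
    and f: "f \<in> carrier (dual_module K E)" for H f
  proof -
    have "f (e j) \<in> carrier K" if "j \<in> I" for j
      using module_hom_closed[of f K E "regular_module K" "e j"] f e that by auto
    then have "finsum (dual_module K E) (\<lambda>j. f (e j) \<odot>\<^bsub>dual_module K E\<^esub> e' j) I \<in> H"
      using H(2) by (intro submodule_finsum[OF module_dual[OF assms(1)] H(1) fin] submodule_smult[OF H(1)]) auto
    then show ?thesis
      using dual_expansion[OF assms(1) fin module_basis_generates[OF assms(1,2)] e' \<delta> f] by simp
  qed
  then show ?thesis using e' by (auto simp: generates_def simp del: dual_module_simps)
qed

text \<open>The common source of bases and non-singularity. The Kronecker relation reads off
  coefficients on both sides, which gives independence of both families and injectivity of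
  \<open>f\<close>; surjectivity comes from expanding a form along the
  \<open>f (b' j)\<close>.\<close>

lemma dual_generators:
  assumes "module K P" "module K Q" "finite J"
    and "generates K P (b ` J)" "generates K Q (b' ` J)"
    and "f \<in> module_hom K Q (dual_module K P)"
    and "\<And>i j. i \<in> J \<Longrightarrow> j \<in> J \<Longrightarrow> f (b' j) (b i) = (if i = j then \<one>\<^bsub>K\<^esub> else \<zero>\<^bsub>K\<^esub>)"
  shows "module_basis K P J b" "module_basis K Q J b'" "f \<in> module_iso K Q (dual_module K P)"
    "dual_family K P J b (\<lambda>j. f (b' j))"
proof -
  have K: "cring K" using assms(1) by (simp add: module_def)
  interpret K: cring K by fact
  interpret P: module K P by fact
  interpret Q: module K Q by fact
  interpret D: module K "dual_module K P" by (rule module_dual) fact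
  have b: "b i \<in> carrier P" if "i \<in> J" for i using assms(4) that by (auto simp: generates_def)
  have b': "b' i \<in> carrier Q" if "i \<in> J" for i using assms(5) that by (auto simp: generates_def)
  have f: "f y \<in> module_hom K P (regular_module K)" if "y \<in> carrier Q" for y
    using module_hom_closed[OF assms(6) that] by simp
  have coord: "f (b' j) (finsum P (\<lambda>i. c i \<odot>\<^bsub>P\<^esub> b i) J) = c j" if c: "c \<in> J \<rightarrow> carrier K" and j: "j \<in> J" for c j
  proof -
    have "f (b' j) (finsum P (\<lambda>i. c i \<odot>\<^bsub>P\<^esub> b i) J) = finsum K (\<lambda>i. f (b' j) (c i \<odot>\<^bsub>P\<^esub> b i)) J"
      using module_hom_finsum[OF assms(1) module_regular[OF K] f[OF b'[OF j]] assms(3), of "\<lambda>i. c i \<odot>\<^bsub>P\<^esub> b i"] c b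
      by (auto simp: Pi_def)
    also have "\<dots> = finsum K (\<lambda>i. c i \<otimes>\<^bsub>K\<^esub> (if i = j then \<one>\<^bsub>K\<^esub> else \<zero>\<^bsub>K\<^esub>)) J"
      using c b j assms(7) module_hom_smult[OF f[OF b'[OF j]]]
      by (intro K.add.finprod_cong') (auto simp: Pi_def)
    also have "\<dots> = c j" by (rule K.finsum_delta(1)[OF assms(3) j c])
    finally show ?thesis .
  qed
  \<comment> \<open>The same extraction in \<open>Q\<close>: a combination of the
    \<open>b' i\<close> is sent to a linear form, and evaluating that form at \<open>b j\<close>
    isolates one coefficient.\<close>
  have coord': "f (finsum Q (\<lambda>i. c i \<odot>\<^bsub>Q\<^esub> b' i) J) (b j) = c j" if c: "c \<in> J \<rightarrow> carrier K" and j: "j \<in> J" for c j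
  proof -
    have "f (finsum Q (\<lambda>i. c i \<odot>\<^bsub>Q\<^esub> b' i) J) = finsum (dual_module K P) (\<lambda>i. f (c i \<odot>\<^bsub>Q\<^esub> b' i)) J"
      using c b' by (intro module_hom_finsum[OF assms(2) module_dual[OF assms(1)] assms(6,3)]) auto
    moreover have "finsum (dual_module K P) (\<lambda>i. f (c i \<odot>\<^bsub>Q\<^esub> b' i)) J (b j) = finsum K (\<lambda>i. f (c i \<odot>\<^bsub>Q\<^esub> b' i) (b j)) J"
      using c b b' j by (intro dual_finsum_apply[OF assms(1,3)])
        (auto simp: Pi_def simp del: dual_module_simps(1) intro!: module_hom_closed[OF assms(6)])
    moreover have "\<dots> = finsum K (\<lambda>i. c i \<otimes>\<^bsub>K\<^esub> (if j = i then \<one>\<^bsub>K\<^esub> else \<zero>\<^bsub>K\<^esub>)) J"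
      using c b b' j assms(7) module_hom_smult[OF assms(6)]
      by (intro K.add.finprod_cong') (auto simp: Pi_def)
    moreover have "\<dots> = c j" by (rule K.finsum_delta(2)[OF assms(3) j c])
    ultimately show ?thesis by simp
  qed
  show "module_basis K P J b"
    unfolding module_basis_def
  proof (intro conjI ballI impI)
    fix c i assume "c \<in> J \<rightarrow> carrier K" "finsum P (\<lambda>i. c i \<odot>\<^bsub>P\<^esub> b i) J = \<zero>\<^bsub>P\<^esub>" "i \<in> J"
    then show "c i = \<zero>\<^bsub>K\<^esub>"
      using coord[of c i] module_hom_zero[OF assms(1) module_regular[OF K] f[OF b'[of i]]] by simp
  qed (use assms(3) b generates_finsum[OF assms(1,3,4)] in auto)
  show "module_basis K Q J b'"
    unfolding module_basis_def
  proof (intro conjI ballI impI)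
    fix c i assume "c \<in> J \<rightarrow> carrier K" "finsum Q (\<lambda>i. c i \<odot>\<^bsub>Q\<^esub> b' i) J = \<zero>\<^bsub>Q\<^esub>" "i \<in> J"
    then show "c i = \<zero>\<^bsub>K\<^esub>"
      using coord'[of c i] module_hom_zero[OF assms(2) module_dual[OF assms(1)] assms(6)] b by simp
  qed (use assms(3) b' generates_finsum[OF assms(2,3,5)] in auto)
  show "dual_family K P J b (\<lambda>j. f (b' j))"
    unfolding dual_family_def using f b' assms(7) by auto
  have "inj_on f (carrier Q)"
  proof (rule inj_onI)
    fix x y assume x: "x \<in> carrier Q" and y: "y \<in> carrier Q" and eq: "f x = f y"
    obtain c where c: "c \<in> J \<rightarrow> carrier K" "x = finsum Q (\<lambda>i. c i \<odot>\<^bsub>Q\<^esub> b' i) J"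
      using generates_finsum[OF assms(2,3,5) x] by auto
    obtain c' where c': "c' \<in> J \<rightarrow> carrier K" "y = finsum Q (\<lambda>i. c' i \<odot>\<^bsub>Q\<^esub> b' i) J"
      using generates_finsum[OF assms(2,3,5) y] by auto
    have "c i = c' i" if "i \<in> J" for i
      using coord'[OF c(1) that] coord'[OF c'(1) that] eq c(2) c'(2) by simp
    then show "x = y"
      unfolding c(2) c'(2) using c'(1) b' by (intro Q.add.finprod_cong') auto
  qed
  \<comment> \<open>The preimage of \<open>h\<close> has the values \<open>h (b j)\<close> as its
    coefficients.\<close>
  moreover have "h \<in> f ` carrier Q" if h: "h \<in> carrier (dual_module K P)" for h
  proof -
    have hb: "h (b j) \<in> carrier K" if "j \<in> J" for j
      using module_hom_closed[of h K P "regular_module K" "b j"] h b that by auto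
    have "h = finsum (dual_module K P) (\<lambda>j. h (b j) \<odot>\<^bsub>dual_module K P\<^esub> f (b' j)) J"
      by (rule dual_expansion[OF assms(1,3,4) _ assms(7) h]) (use f b' in auto)
    also have "\<dots> = finsum (dual_module K P) (\<lambda>j. f (h (b j) \<odot>\<^bsub>Q\<^esub> b' j)) J"
    proof (intro D.add.finprod_cong' refl)
      show "(\<lambda>j. f (h (b j) \<odot>\<^bsub>Q\<^esub> b' j)) \<in> J \<rightarrow> carrier (dual_module K P)"
        using hb b' module_hom_closed[OF assms(6)] by blast
    qed (simp only: module_hom_smult[OF assms(6) hb b'])
    also have "\<dots> = f (finsum Q (\<lambda>j. h (b j) \<odot>\<^bsub>Q\<^esub> b' j) J)"
      using hb b' by (intro module_hom_finsum[OF assms(2) module_dual[OF assms(1)] assms(6,3), symmetric]) auto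
    finally show ?thesis using hb b' by (auto intro!: Q.finsum_closed)
  qed
  ultimately show "f \<in> module_iso K Q (dual_module K P)"
    using assms(6) module_hom_closed[OF assms(6)] unfolding module_iso_def bij_betw_def by blast
qed

section \<open>The Schur form\<close>

lemma multilinear_cong:
  assumes "module K E" "multilinear K d E N \<Phi>" "\<And>x. x \<in> tuples d (carrier E) \<Longrightarrow> \<Psi> x = \<Phi> x"
  shows "multilinear K d E N \<Psi>"
proof -
  interpret E: module K E by fact
  show ?thesis using assms(2) by (simp add: multilinear_def assms(3) tuples_upd Pi_def)
qed

lemma multilinear_prod:
  assumes "module K E" "\<And>t. t \<in> {1..d} \<Longrightarrow> f t \<in> module_hom K E (regular_module K)"
  shows "multilinear K d E (regular_module K) (\<lambda>x. finprod K (\<lambda>t. f t (x t)) {1..d})"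
proof -
  interpret E: module K E by fact
  have cl: "f t a \<in> carrier K" if "t \<in> {1..d}" "a \<in> carrier E" for t a
    using module_hom_regular_closed[OF assms(2)] that .
  \<comment> \<open>Slot \<open>t\<close> enters only the factor at \<open>t\<close>; isolating it
    reduces linearity in the slot to linearity of \<open>f t\<close>.\<close>
  have split: "finprod K (\<lambda>s. f s ((x(t := a)) s)) {1..d} = f t a \<otimes>\<^bsub>K\<^esub> finprod K (\<lambda>s. f s (x s)) ({1..d} - {t})"
    if x: "x \<in> tuples d (carrier E)" and t: "t \<in> {1..d}" and a: "a \<in> carrier E" for x t a
  proof -
    have "finprod K (\<lambda>s. f s ((x(t := a)) s)) (insert t ({1..d} - {t}))
        = f t a \<otimes>\<^bsub>K\<^esub> finprod K (\<lambda>s. f s ((x(t := a)) s)) ({1..d} - {t})"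
      using x t a by (subst E.finprod_insert) (auto simp: cl tuples_mem)
    also have "finprod K (\<lambda>s. f s ((x(t := a)) s)) ({1..d} - {t}) = finprod K (\<lambda>s. f s (x s)) ({1..d} - {t})"
      using x by (intro E.finprod_cong') (auto simp: cl tuples_mem)
    finally show ?thesis using t by (simp add: insert_absorb)
  qed
  have rest: "finprod K (\<lambda>s. f s (x s)) ({1..d} - {t}) \<in> carrier K" if "x \<in> tuples d (carrier E)" for x t
    using that by (intro E.finprod_closed) (auto simp: cl tuples_mem)
  show ?thesis unfolding multilinear_def
  proof (intro conjI ballI)
    show "(\<lambda>x. finprod K (\<lambda>t. f t (x t)) {1..d}) \<in> tuples d (carrier E) \<rightarrow> carrier (regular_module K)"
      by (auto intro!: E.finprod_closed simp: cl tuples_mem)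
  qed (simp_all add: split rest cl module_hom_add[OF assms(2)] module_hom_smult[OF assms(2)]
      E.R.l_distr E.m_assoc del: fun_upd_apply)
qed

lemma multilinear_finsum:
  assumes "module K E" "module K N" "finite A" "\<And>i. i \<in> A \<Longrightarrow> multilinear K d E N (\<Phi> i)"
    and "\<And>i. i \<in> A \<Longrightarrow> c i \<in> carrier K"
  shows "multilinear K d E N (\<lambda>x. finsum N (\<lambda>i. c i \<odot>\<^bsub>N\<^esub> \<Phi> i x) A)"
proof -
  interpret E: module K E by fact
  interpret N: module K N by fact
  note \<Phi> = multilinearD[OF assms(4)]
  show ?thesis unfolding multilinear_def
  proof (intro conjI ballI)
    show "(\<lambda>x. finsum N (\<lambda>i. c i \<odot>\<^bsub>N\<^esub> \<Phi> i x) A) \<in> tuples d (carrier E) \<rightarrow> carrier N"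
      using assms(5) \<Phi>(1) by (auto intro!: N.finsum_closed)
    fix x t assume x: "x \<in> tuples d (carrier E)" and t: "t \<in> {1..d}"
    have cl: "\<Phi> i (x(t := a)) \<in> carrier N" if "i \<in> A" "a \<in> carrier E" for i a
      using \<Phi>(1)[OF that(1) tuples_upd[OF x t that(2)]] .
    show "finsum N (\<lambda>i. c i \<odot>\<^bsub>N\<^esub> \<Phi> i (x(t := a \<oplus>\<^bsub>E\<^esub> b))) A =
        finsum N (\<lambda>i. c i \<odot>\<^bsub>N\<^esub> \<Phi> i (x(t := a))) A \<oplus>\<^bsub>N\<^esub> finsum N (\<lambda>i. c i \<odot>\<^bsub>N\<^esub> \<Phi> i (x(t := b))) A"
      if ab: "a \<in> carrier E" "b \<in> carrier E" for a b
    proof -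
      have "finsum N (\<lambda>i. c i \<odot>\<^bsub>N\<^esub> \<Phi> i (x(t := a \<oplus>\<^bsub>E\<^esub> b))) A =
          finsum N (\<lambda>i. c i \<odot>\<^bsub>N\<^esub> \<Phi> i (x(t := a)) \<oplus>\<^bsub>N\<^esub> c i \<odot>\<^bsub>N\<^esub> \<Phi> i (x(t := b))) A"
        using ab assms(5) cl by (intro N.add.finprod_cong') (auto simp: \<Phi>(2)[OF _ x t] N.smult_r_distr)
      also have "\<dots> = finsum N (\<lambda>i. c i \<odot>\<^bsub>N\<^esub> \<Phi> i (x(t := a))) A \<oplus>\<^bsub>N\<^esub> finsum N (\<lambda>i. c i \<odot>\<^bsub>N\<^esub> \<Phi> i (x(t := b))) A"
        using ab assms(5) cl by (intro N.finsum_addf) auto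
      finally show ?thesis .
    qed
    show "finsum N (\<lambda>i. c i \<odot>\<^bsub>N\<^esub> \<Phi> i (x(t := r \<odot>\<^bsub>E\<^esub> a))) A = r \<odot>\<^bsub>N\<^esub> finsum N (\<lambda>i. c i \<odot>\<^bsub>N\<^esub> \<Phi> i (x(t := a))) A"
      if ra: "r \<in> carrier K" "a \<in> carrier E" for r a
    proof -
      have "finsum N (\<lambda>i. c i \<odot>\<^bsub>N\<^esub> \<Phi> i (x(t := r \<odot>\<^bsub>E\<^esub> a))) A = finsum N (\<lambda>i. r \<odot>\<^bsub>N\<^esub> (c i \<odot>\<^bsub>N\<^esub> \<Phi> i (x(t := a)))) A"
        using ra assms(5) cl
        by (intro N.add.finprod_cong')
          (auto simp: \<Phi>(3)[OF _ x t] N.smult_assoc1[symmetric] E.m_comm)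
      also have "\<dots> = r \<odot>\<^bsub>N\<^esub> finsum N (\<lambda>i. c i \<odot>\<^bsub>N\<^esub> \<Phi> i (x(t := a))) A"
        using ra assms(3,5) cl by (intro N.finsum_smult_ldistr[symmetric]) auto
      finally show ?thesis .
    qed
  qed
qed

context perm_character
begin

abbreviation schur_pairing :: "('k, 'a, 'p) module_scheme \<Rightarrow> (nat \<Rightarrow> 'a) \<Rightarrow> (nat \<Rightarrow> 'a \<Rightarrow> 'k) \<Rightarrow> 'k"
  where "schur_pairing E x y \<equiv> schur_function K d W \<chi> (\<lambda>i j. canonical_form K E (x i, y j))"

text \<open>The entry of \<open>x\<close> at the preimage of \<open>t\<close> under \<sigma> is
  place \<open>t\<close> of the permuted tuple, so the Schur function becomes a sum of pairings of
  permuted copies of \<open>x\<close> with \<open>y\<close>, weighted by \<chi>. The symmetry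
  arguments start from this form.\<close>

lemma schur_pairing_eq:
  assumes "x \<in> tuples d (carrier E)" "y \<in> tuples d (carrier (dual_module K E))"
  shows "schur_pairing E x y = (\<Oplus>\<sigma>\<in>W. \<chi> \<sigma> \<otimes> (\<Otimes>t\<in>{1..d}. y t (place_perm \<sigma> x t)))"
proof -
  have eq: "canonical_form K E (x (inv_into UNIV \<sigma> t), y t) = y t (place_perm \<sigma> x t)"
    and cl: "y t (place_perm \<sigma> x t) \<in> carrier K"
    if "\<sigma> \<in> W" "t \<in> {1..d}" for \<sigma> t
    using tuples_mem[OF place_perm_tuples[OF W_permutes[OF that(1)] assms(1)] that(2)]
      tuples_mem[OF assms(2) that(2)]
    by (auto simp: canonical_form_def place_perm_def intro: module_hom_regular_closed)
  have "(\<Otimes>t\<in>{1..d}. canonical_form K E (x (inv_into UNIV \<sigma> t), y t)) = (\<Otimes>t\<in>{1..d}. y t (place_perm \<sigma> x t))"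
    if "\<sigma> \<in> W" for \<sigma>
    using eq[OF that] cl[OF that] by (intro finprod_cong') auto
  then show ?thesis unfolding schur_function_def
    using cl char_closed by (intro add.finprod_cong') (auto intro!: finprod_closed)
qed

lemma schur_prod_closed:
  assumes "\<sigma> \<in> W" "x \<in> tuples d (carrier E)" "y \<in> tuples d (carrier (dual_module K E))"
  shows "(\<Otimes>t\<in>{1..d}. y t (place_perm \<sigma> x t)) \<in> carrier K"
  using tuples_mem[OF place_perm_tuples[OF W_permutes[OF assms(1)] assms(2)]] tuples_mem[OF assms(3)]
  by (intro finprod_closed) (auto intro: module_hom_regular_closed[where M = E])

lemma multilinear_schur_left:
  assumes "module K E" "y \<in> tuples d (carrier (dual_module K E))"
  shows "multilinear K d E (regular_module K) (\<lambda>x. schur_pairing E x y)"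
proof -
  note reg = module_regular[OF cring_axioms]
  have "multilinear K d E (regular_module K) (\<lambda>x. \<Otimes>t\<in>{1..d}. y t (x t))"
    using tuples_mem[OF assms(2)] by (intro multilinear_prod[OF assms(1)]) simp
  from multilinear_place_perm[OF this W_permutes]
  have "multilinear K d E (regular_module K) (\<lambda>x. finsum (regular_module K)
      (\<lambda>\<sigma>. \<chi> \<sigma> \<odot>\<^bsub>regular_module K\<^esub> (\<Otimes>t\<in>{1..d}. y t (place_perm \<sigma> x t))) W)"
    by (intro multilinear_finsum[OF assms(1) reg finite_W] char_closed) auto
  then show ?thesis
    by (rule multilinear_cong[OF assms(1)]) (use schur_pairing_eq assms(2) in auto)
qed

lemma multilinear_schur_right:
  assumes "module K E" "x \<in> tuples d (carrier E)"
  shows "multilinear K d (dual_module K E) (regular_module K) (\<lambda>y. schur_pairing E x y)"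
proof -
  note reg = module_regular[OF cring_axioms]
  note D = module_dual[OF assms(1)]
  have *: "multilinear K d (dual_module K E) (regular_module K) (\<lambda>y. \<Otimes>t\<in>{1..d}. y t (place_perm \<sigma> x t))"
    if "\<sigma> \<in> W" for \<sigma>
  proof (rule multilinear_cong[OF D])
    \<comment> \<open>With \<open>x\<close> fixed, the factor at \<open>t\<close> evaluates a linear
      form at a fixed vector, which is linear in the form.\<close>
    show "multilinear K d (dual_module K E) (regular_module K)
        (\<lambda>y. \<Otimes>t\<in>{1..d}. (\<lambda>f\<in>carrier (dual_module K E). f (place_perm \<sigma> x t)) (y t))"
      using tuples_mem[OF place_perm_tuples[OF W_permutes[OF that] assms(2)]]
      by (intro multilinear_prod[OF D] eval_hom[OF assms(1)])
    fix y assume y: "y \<in> tuples d (carrier (dual_module K E))"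
    then show "(\<Otimes>t\<in>{1..d}. y t (place_perm \<sigma> x t)) =
        (\<Otimes>t\<in>{1..d}. (\<lambda>f\<in>carrier (dual_module K E). f (place_perm \<sigma> x t)) (y t))"
      using tuples_mem[OF place_perm_tuples[OF W_permutes[OF that] assms(2)]] tuples_mem[OF y]
      by (intro finprod_cong') (auto intro: module_hom_regular_closed[where M = E])
  qed
  have "multilinear K d (dual_module K E) (regular_module K) (\<lambda>y. finsum (regular_module K)
      (\<lambda>\<sigma>. \<chi> \<sigma> \<odot>\<^bsub>regular_module K\<^esub> (\<Otimes>t\<in>{1..d}. y t (place_perm \<sigma> x t))) W)"
    by (intro multilinear_finsum[OF D reg finite_W] char_closed *) auto
  then show ?thesis
    by (rule multilinear_cong[OF D]) (use schur_pairing_eq assms(2) in auto)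
qed

section \<open>Equivariance of the Schur pairing under place permutations\<close>

lemma finsum_W_reindex_right:
  assumes "\<tau> \<in> W" "\<And>\<sigma>. \<sigma> \<in> W \<Longrightarrow> g \<sigma> \<in> carrier K"
  shows "(\<Oplus>\<sigma>\<in>W. g (\<sigma> \<circ> \<tau>)) = (\<Oplus>\<sigma>\<in>W. g \<sigma>)"
proof -
  have inj: "inj_on (\<lambda>\<sigma>. \<sigma> \<circ> \<tau>) W"
    using permutes_surj[OF W_permutes[OF assms(1)]] by (auto simp: inj_on_def fun_eq_iff) (metis surjD)
  have "(\<lambda>\<sigma>. \<sigma> \<circ> \<tau>) ` W = W"
    using inj finite_W W_comp assms(1) by (intro endo_inj_surj) auto
  then show ?thesis using finsum_reindex[OF _ inj, of g] assms(2) by (auto simp: Pi_def)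
qed

lemma finsum_W_reindex_left:
  assumes "\<tau> \<in> W" "\<And>\<sigma>. \<sigma> \<in> W \<Longrightarrow> g \<sigma> \<in> carrier K"
  shows "(\<Oplus>\<sigma>\<in>W. g (\<tau> \<circ> \<sigma>)) = (\<Oplus>\<sigma>\<in>W. g \<sigma>)"
proof -
  have inj: "inj_on (\<lambda>\<sigma>. \<tau> \<circ> \<sigma>) W"
    using permutes_inj[OF W_permutes[OF assms(1)]] by (auto simp: inj_on_def fun_eq_iff)
  have "(\<lambda>\<sigma>. \<tau> \<circ> \<sigma>) ` W = W"
    using inj finite_W W_comp assms(1) by (intro endo_inj_surj) auto
  then show ?thesis using finsum_reindex[OF _ inj, of g] assms(2) by (auto simp: Pi_def)
qed

text \<open>Substituting \<open>\<sigma> \<circ> \<tau>\<close> for \<sigma> in the sum, the weight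
  gains the factor \<chi>(\<tau>), which the inverse cancels, and the product becomes that of the
  tuple permuted by \<tau>.\<close>

lemma schur_pairing_place_perm_left:
  assumes "\<tau> \<in> W" "x \<in> tuples d (carrier E)" "y \<in> tuples d (carrier (dual_module K E))"
  shows "schur_pairing E (place_perm \<tau> x) y = inv (\<chi> \<tau>) \<otimes> schur_pairing E x y"
proof -
  define g where "g \<sigma> = (\<Otimes>t\<in>{1..d}. y t (place_perm \<sigma> x t))" for \<sigma>
  have g: "g \<sigma> \<in> carrier K" if "\<sigma> \<in> W" for \<sigma>
    unfolding g_def using schur_prod_closed[OF that assms(2,3)] .
  have i: "inv (\<chi> \<tau>) \<in> carrier K" "\<chi> \<tau> \<in> carrier K" "inv (\<chi> \<tau>) \<otimes> \<chi> \<tau> = \<one>"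
    using char_Units[OF assms(1)] by auto
  have "inv (\<chi> \<tau>) \<otimes> schur_pairing E x y = inv (\<chi> \<tau>) \<otimes> (\<Oplus>\<sigma>\<in>W. \<chi> \<sigma> \<otimes> g \<sigma>)"
    using schur_pairing_eq[OF assms(2,3)] by (simp add: g_def)
  also have "\<dots> = (\<Oplus>\<sigma>\<in>W. inv (\<chi> \<tau>) \<otimes> (\<chi> \<sigma> \<otimes> g \<sigma>))"
    using finite_W i g char_closed by (intro finsum_rdistr) auto
  also have "\<dots> = (\<Oplus>\<sigma>\<in>W. inv (\<chi> \<tau>) \<otimes> (\<chi> (\<sigma> \<circ> \<tau>) \<otimes> g (\<sigma> \<circ> \<tau>)))"
    using i g char_closed by (intro finsum_W_reindex_right[OF assms(1), symmetric]) auto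
  also have "\<dots> = (\<Oplus>\<sigma>\<in>W. \<chi> \<sigma> \<otimes> g (\<sigma> \<circ> \<tau>))"
  proof (intro add.finprod_cong' refl)
    fix \<sigma> assume \<sigma>: "\<sigma> \<in> W"
    have "inv (\<chi> \<tau>) \<otimes> (\<chi> (\<sigma> \<circ> \<tau>) \<otimes> g (\<sigma> \<circ> \<tau>)) = (inv (\<chi> \<tau>) \<otimes> \<chi> \<tau>) \<otimes> (\<chi> \<sigma> \<otimes> g (\<sigma> \<circ> \<tau>))"
      using i(1,2) g[OF W_comp[OF \<sigma> assms(1)]] char_closed[OF \<sigma>]
      by (simp add: char_comp[OF \<sigma> assms(1)] m_ac)
    then show "inv (\<chi> \<tau>) \<otimes> (\<chi> (\<sigma> \<circ> \<tau>) \<otimes> g (\<sigma> \<circ> \<tau>)) = \<chi> \<sigma> \<otimes> g (\<sigma> \<circ> \<tau>)"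
      using i(3) g[OF W_comp[OF \<sigma> assms(1)]] char_closed[OF \<sigma>] by simp
  qed (use g W_comp assms(1) char_closed in auto)
  also have "\<dots> = schur_pairing E (place_perm \<tau> x) y"
  proof -
    have "g (\<sigma> \<circ> \<tau>) = (\<Otimes>t\<in>{1..d}. y t (place_perm \<sigma> (place_perm \<tau> x) t))" if "\<sigma> \<in> W" for \<sigma>
      unfolding g_def by (simp only: place_perm_comp[OF W_permutes[OF that] W_permutes[OF assms(1)]])
    then show ?thesis
      unfolding schur_pairing_eq[OF place_perm_tuples[OF W_permutes[OF assms(1)] assms(2)] assms(3)]
      using g[OF W_comp[OF _ assms(1)]] char_closed by (intro add.finprod_cong') auto
  qed
  finally show ?thesis by simp
qed

text \<open>Here \<sigma> is replaced by \<open>\<tau> \<circ> \<sigma>\<close>, so that both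
  arguments are permuted by \<tau> and the product is unchanged; the weight contributes
  \<chi>(\<tau>), this time with no inverse.\<close>

lemma schur_pairing_place_perm_right:
  assumes "\<tau> \<in> W" "x \<in> tuples d (carrier E)" "y \<in> tuples d (carrier (dual_module K E))"
  shows "schur_pairing E x (place_perm \<tau> y) = \<chi> \<tau> \<otimes> schur_pairing E x y"
proof -
  define g where "g \<sigma> = (\<Otimes>t\<in>{1..d}. y t (place_perm \<sigma> x t))" for \<sigma>
  have g: "g \<sigma> \<in> carrier K" if "\<sigma> \<in> W" for \<sigma>
    unfolding g_def using schur_prod_closed[OF that assms(2,3)] .
  define h where "h \<sigma> = (\<Otimes>t\<in>{1..d}. place_perm \<tau> y t (place_perm \<sigma> x t))" for \<sigma>
  note \<tau> = W_permutes[OF assms(1)]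
  note y' = place_perm_tuples[OF \<tau> assms(3)]
  have h_cl: "h \<sigma> \<in> carrier K" if "\<sigma> \<in> W" for \<sigma>
    unfolding h_def using schur_prod_closed[OF that assms(2) y'] .
  \<comment> \<open>The factors are only reordered: reindexing the places along \<tau> removes it
    from both tuples.\<close>
  have h: "h (\<tau> \<circ> \<sigma>) = g \<sigma>" if \<sigma>: "\<sigma> \<in> W" for \<sigma>
  proof -
    have "h (\<tau> \<circ> \<sigma>) = (\<Otimes>t\<in>\<tau> ` {1..d}. place_perm \<tau> y t (place_perm \<tau> (place_perm \<sigma> x) t))"
      unfolding h_def by (simp only: place_perm_comp[OF \<tau> W_permutes[OF \<sigma>]] permutes_image[OF \<tau>])
    also have "\<dots> = (\<Otimes>t\<in>{1..d}. place_perm \<tau> y (\<tau> t) (place_perm \<tau> (place_perm \<sigma> x) (\<tau> t)))"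
      using tuples_mem[OF place_perm_tuples[OF \<tau> place_perm_tuples[OF W_permutes[OF \<sigma>] assms(2)]]]
        tuples_mem[OF y'] permutes_inj_on[OF \<tau>]
      by (intro finprod_reindex) (auto simp: permutes_image[OF \<tau>] intro: module_hom_regular_closed[where M = E])
    finally show ?thesis by (simp add: g_def place_perm_apply[OF \<tau>])
  qed
  have "schur_pairing E x (place_perm \<tau> y) = (\<Oplus>\<sigma>\<in>W. \<chi> \<sigma> \<otimes> h \<sigma>)"
    using schur_pairing_eq[OF assms(2) y'] by (simp add: h_def)
  also have "\<dots> = (\<Oplus>\<sigma>\<in>W. \<chi> (\<tau> \<circ> \<sigma>) \<otimes> h (\<tau> \<circ> \<sigma>))"
    using h_cl char_closed by (intro finsum_W_reindex_left[OF assms(1), symmetric]) auto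
  also have "\<dots> = (\<Oplus>\<sigma>\<in>W. \<chi> \<tau> \<otimes> (\<chi> \<sigma> \<otimes> g \<sigma>))"
    using g assms(1) by (intro add.finprod_cong') (auto simp: h char_comp char_closed m_assoc)
  also have "\<dots> = \<chi> \<tau> \<otimes> (\<Oplus>\<sigma>\<in>W. \<chi> \<sigma> \<otimes> g \<sigma>)"
    using finite_W g char_closed assms(1) by (intro finsum_rdistr[symmetric]) auto
  also have "\<dots> = \<chi> \<tau> \<otimes> schur_pairing E x y"
    using schur_pairing_eq[OF assms(2,3)] by (simp add: g_def)
  finally show ?thesis .
qed

end

text \<open>Uniqueness of linear maps is applied twice: to the associated maps on generators of
  \<open>N\<close>, then to each of their values on generators of \<open>M\<close>.\<close>

lemma bilinear_forms_ext:
  assumes "module K M" "module K N" "B \<in> bilinear_forms K M N" "B' \<in> bilinear_forms K M N"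
    and "generates K M S" "generates K N S'" "\<And>x y. x \<in> S \<Longrightarrow> y \<in> S' \<Longrightarrow> B (x, y) = B' (x, y)"
  shows "B = B'"
proof -
  note A = associated_map_hom[OF assms(1,2,3)]
  note A' = associated_map_hom[OF assms(1,2,4)]
  have K: "cring K" using assms(1) by (simp add: module_def)
  have S: "x \<in> carrier M" if "x \<in> S" for x using assms(5) that by (auto simp: generates_def)
  have "associated_map M N B = associated_map M N B'"
  proof (rule generates_hom_ext[OF assms(2) module_dual[OF assms(1)] assms(6) A A'])
    fix y assume y: "y \<in> S'"
    then have yN: "y \<in> carrier N" using assms(6) by (auto simp: generates_def)
    show "associated_map M N B y = associated_map M N B' y"
      by (rule generates_hom_ext[OF assms(1) module_regular[OF K] assms(5)])
        (use module_hom_closed[OF A yN] module_hom_closed[OF A' yN] S yN y assms(7) in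
          \<open>auto simp: associated_map_def\<close>)
  qed
  then have "B (x, y) = B' (x, y)" if "x \<in> carrier M" "y \<in> carrier N" for x y
    using that by (auto simp: associated_map_def restrict_def dest!: fun_cong[of _ _ y] fun_cong[of _ _ x])
  then show ?thesis
    using assms(3,4) unfolding bilinear_forms_def
    by (intro PiE_ext[of B "carrier M \<times> carrier N" "\<lambda>_. carrier K" B']) auto
qed

section \<open>Functoriality, existence of the form, and naturality\<close>

lemma place_perm_restrict:
  assumes "\<sigma> permutes {1..d}"
  shows "place_perm \<sigma> (\<lambda>t\<in>{1..d}. u (x t)) = (\<lambda>t\<in>{1..d}. u (place_perm \<sigma> x t))"
  using permutes_in_image[OF permutes_inv[OF assms]] by (auto simp: place_perm_def fun_eq_iff)

lemma restrict_comp_upd: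
  "t \<in> I \<Longrightarrow> (\<lambda>s\<in>I. u ((x(t := a)) s)) = (\<lambda>s\<in>I. u (x s))(t := u a)"
  by (auto simp: fun_eq_iff)

lemma restrict_comp_tuples:
  "u \<in> module_hom K E F \<Longrightarrow> x \<in> tuples d (carrier E) \<Longrightarrow> (\<lambda>t\<in>{1..d}. u (x t)) \<in> tuples d (carrier F)"
  using module_hom_closed tuples_mem by fastforce

lemma multilinear_comp_hom:
  assumes "module K E" "multilinear K d F N \<Phi>" "u \<in> module_hom K E F"
  shows "multilinear K d E N (\<lambda>x. \<Phi> (\<lambda>t\<in>{1..d}. u (x t)))"
proof -
  interpret E: module K E by fact
  note r = restrict_comp_tuples[OF assms(3)]
  note \<Phi> = multilinearD[OF assms(2) r]
  show ?thesis unfolding multilinear_def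
    by (intro conjI ballI)
      (auto simp only: Pi_iff restrict_comp_upd module_hom_add[OF assms(3)]
        module_hom_smult[OF assms(3)] \<Phi> module_hom_closed[OF assms(3)])
qed

lemma transpose_map_hom:
  assumes "module K E" "module K F" "u \<in> module_hom K E F"
  shows "transpose_map K E F u \<in> module_hom K (dual_module K F) (dual_module K E)"
proof -
  interpret E: module K E by fact
  note u = module_hom_closed[OF assms(3)]
  show ?thesis unfolding transpose_map_def
  proof (rule module_hom_restrictI[OF module_dual[OF assms(2)]])
    fix f assume "f \<in> carrier (dual_module K F)"
    then show "(\<lambda>x\<in>carrier E. f (u x)) \<in> carrier (dual_module K E)"
      using module_hom_compose[OF assms(1,3)] by simp
  qed (auto simp: u intro!: restrict_ext)
qed

lemma transpose_map_apply:
  "f \<in> carrier (dual_module K F) \<Longrightarrow> x \<in> carrier E \<Longrightarrow> transpose_map K E F u f x = f (u x)"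
  by (simp add: transpose_map_def)

context perm_character
begin

text \<open>Justifies the definite description: applying \<open>u\<close> entrywise commutes with
  place permutations, so the composite is again equivariant and lifts.\<close>

lemma chi_power_map:
  assumes "module K E" "module K F" "u \<in> module_hom K E F"
  shows "chi_power_map K d W \<chi> E F u \<in> module_hom K (chi_power K d W \<chi> E) (chi_power K d W \<chi> F)"
    and "x \<in> tuples d (carrier E) \<Longrightarrow>
      chi_power_map K d W \<chi> E F u (chi_prod K d W \<chi> E x) = chi_prod K d W \<chi> F (\<lambda>t\<in>{1..d}. u (x t))"
proof -
  have "\<exists>!g. g \<in> module_hom K (chi_power K d W \<chi> E) (chi_power K d W \<chi> F) \<and>
      (\<forall>x\<in>tuples d (carrier E). g (chi_prod K d W \<chi> E x) = chi_prod K d W \<chi> F (\<lambda>t\<in>{1..d}. u (x t)))"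
  proof (rule chi_power_lift[OF assms(1) module_chi_power[OF assms(2)]
        multilinear_comp_hom[OF assms(1) multilinear_chi_prod[OF assms(2)] assms(3)]])
    fix \<sigma> x assume \<sigma>: "\<sigma> \<in> W" and x: "x \<in> tuples d (carrier E)"
    show "chi_prod K d W \<chi> F (\<lambda>t\<in>{1..d}. u (place_perm \<sigma> x t)) =
        inv (\<chi> \<sigma>) \<odot>\<^bsub>chi_power K d W \<chi> F\<^esub> chi_prod K d W \<chi> F (\<lambda>t\<in>{1..d}. u (x t))"
      using chi_prod_place_perm[OF assms(2) \<sigma> restrict_comp_tuples[OF assms(3) x]]
      by (simp only: place_perm_restrict[OF W_permutes[OF \<sigma>]])
  qed
  from theI'[OF this]
  show "chi_power_map K d W \<chi> E F u \<in> module_hom K (chi_power K d W \<chi> E) (chi_power K d W \<chi> F)"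
    "x \<in> tuples d (carrier E) \<Longrightarrow>
      chi_power_map K d W \<chi> E F u (chi_prod K d W \<chi> E x) = chi_prod K d W \<chi> F (\<lambda>t\<in>{1..d}. u (x t))"
    by (auto simp: chi_power_map_def)
qed

lemma inv_inv_char: "\<sigma> \<in> W \<Longrightarrow> inv (inv_char K \<chi> \<sigma>) = \<chi> \<sigma>"
  using char_Units by (simp add: inv_char_def)

lemma ex_schur_form:
  assumes "module K E"
  shows "\<exists>B. B \<in> bilinear_forms K (chi_power K d W \<chi> E) (chi_power K d W (inv_char K \<chi>) (dual_module K E)) \<and>
    satisfies_schur_formula K d W \<chi> E B"
proof -
  interpret IC: perm_character K d W "inv_char K \<chi>" by (rule perm_character_inv_char)
  let ?P = "chi_power K d W \<chi> E" and ?D = "dual_module K E"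
  let ?Q = "chi_power K d W (inv_char K \<chi>) ?D"
  note P = module_chi_power[OF assms]
  note D = module_dual[OF assms]
  note reg = module_regular[OF cring_axioms]
  \<comment> \<open>First stage: the linear form in the variable \<open>x\<close>, for a tuple
    \<open>y\<close> not yet passed to its own quotient.\<close>
  define \<beta> where "\<beta> y = (THE g. g \<in> module_hom K ?P (regular_module K) \<and>
      (\<forall>x\<in>tuples d (carrier E). g (chi_prod K d W \<chi> E x) = schur_pairing E x y))" for y
  have \<beta>: "\<beta> y \<in> module_hom K ?P (regular_module K)"
    "\<And>x. x \<in> tuples d (carrier E) \<Longrightarrow> \<beta> y (chi_prod K d W \<chi> E x) = schur_pairing E x y"
    if y: "y \<in> tuples d (carrier ?D)" for y
  proof -
    have "\<exists>!g. g \<in> module_hom K ?P (regular_module K) \<and>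
      (\<forall>x\<in>tuples d (carrier E). g (chi_prod K d W \<chi> E x) = schur_pairing E x y)"
      using schur_pairing_place_perm_left[OF _ _ y]
      by (intro chi_power_lift[OF assms reg multilinear_schur_left[OF assms y]]) simp
    from theI'[OF this] show "\<beta> y \<in> module_hom K ?P (regular_module K)"
      "\<And>x. x \<in> tuples d (carrier E) \<Longrightarrow> \<beta> y (chi_prod K d W \<chi> E x) = schur_pairing E x y"
      by (auto simp: \<beta>_def)
  qed
  \<comment> \<open>This local fact takes over the name of function extensionality: in the rest of
    the proof, \<open>rule ext\<close> compares linear forms on products only.\<close>
  have ext: "f = g" if "f \<in> carrier (dual_module K ?P)" "g \<in> carrier (dual_module K ?P)"
    "\<And>x. x \<in> tuples d (carrier E) \<Longrightarrow> f (chi_prod K d W \<chi> E x) = g (chi_prod K d W \<chi> E x)" for f g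
    using that by (intro generates_hom_ext[OF P reg generates_chi_prod[OF assms]]) auto
  interpret DP: module K "dual_module K ?P" by (rule module_dual[OF P])
  interpret D: module K ?D by (rule D)
  note S = multilinearD[OF multilinear_schur_right[OF assms]]
  note cp = chi_prod_closed[OF assms]
  have \<beta>_cl: "\<beta> y \<in> carrier (dual_module K ?P)" if "y \<in> tuples d (carrier ?D)" for y
    using \<beta>(1)[OF that] by simp
  have "multilinear K d ?D (dual_module K ?P) \<beta>"
    unfolding multilinear_def
  proof (intro conjI ballI)
    fix y t assume y: "y \<in> tuples d (carrier ?D)" and t: "t \<in> {1..d}"
    show "\<beta> (y(t := a \<oplus>\<^bsub>?D\<^esub> b)) = \<beta> (y(t := a)) \<oplus>\<^bsub>dual_module K ?P\<^esub> \<beta> (y(t := b))"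
      if a: "a \<in> carrier ?D" and b: "b \<in> carrier ?D" for a b
    proof (rule ext)
      note ua = tuples_upd[OF y t a] and ub = tuples_upd[OF y t b]
      note uab = tuples_upd[OF y t D.a_closed[OF a b]]
      show "\<beta> (y(t := a \<oplus>\<^bsub>?D\<^esub> b)) \<in> carrier (dual_module K ?P)"
        "\<beta> (y(t := a)) \<oplus>\<^bsub>dual_module K ?P\<^esub> \<beta> (y(t := b)) \<in> carrier (dual_module K ?P)"
        by (intro \<beta>_cl[OF uab] DP.a_closed[OF \<beta>_cl[OF ua] \<beta>_cl[OF ub]])+
      fix x assume x: "x \<in> tuples d (carrier E)"
      show "\<beta> (y(t := a \<oplus>\<^bsub>?D\<^esub> b)) (chi_prod K d W \<chi> E x) =
          (\<beta> (y(t := a)) \<oplus>\<^bsub>dual_module K ?P\<^esub> \<beta> (y(t := b))) (chi_prod K d W \<chi> E x)"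
        using S(2)[OF x y t a b] cp[OF x] \<beta>(2)[OF uab x] \<beta>(2)[OF ua x] \<beta>(2)[OF ub x]
        by (simp del: fun_upd_apply add: dual_module_def regular_module_def)
    qed
    show "\<beta> (y(t := r \<odot>\<^bsub>?D\<^esub> a)) = r \<odot>\<^bsub>dual_module K ?P\<^esub> \<beta> (y(t := a))"
      if r: "r \<in> carrier K" and a: "a \<in> carrier ?D" for r a
    proof (rule ext)
      note ua = tuples_upd[OF y t a]
      note ura = tuples_upd[OF y t D.smult_closed[OF r a]]
      show "\<beta> (y(t := r \<odot>\<^bsub>?D\<^esub> a)) \<in> carrier (dual_module K ?P)"
        "r \<odot>\<^bsub>dual_module K ?P\<^esub> \<beta> (y(t := a)) \<in> carrier (dual_module K ?P)"
        by (intro \<beta>_cl[OF ura] DP.smult_closed[OF r \<beta>_cl[OF ua]])+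
      fix x assume x: "x \<in> tuples d (carrier E)"
      show "\<beta> (y(t := r \<odot>\<^bsub>?D\<^esub> a)) (chi_prod K d W \<chi> E x) =
          (r \<odot>\<^bsub>dual_module K ?P\<^esub> \<beta> (y(t := a))) (chi_prod K d W \<chi> E x)"
        using S(3)[OF x y t r a] cp[OF x] \<beta>(2)[OF ura x] \<beta>(2)[OF ua x]
        by (simp del: fun_upd_apply add: dual_module_def regular_module_def)
    qed
  qed (use \<beta>_cl in blast)
  \<comment> \<open>The relation for the inverse character involves the inverse of its value, which
    is \<chi>(\<sigma>) again: precisely the factor produced by permuting the second argument of the
    pairing.\<close>
  moreover have "\<beta> (place_perm \<sigma> y) = inv (inv_char K \<chi> \<sigma>) \<odot>\<^bsub>dual_module K ?P\<^esub> \<beta> y"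
    if \<sigma>: "\<sigma> \<in> W" and y: "y \<in> tuples d (carrier ?D)" for \<sigma> y
  proof (rule ext)
    note y' = place_perm_tuples[OF W_permutes[OF \<sigma>] y]
    show "\<beta> (place_perm \<sigma> y) \<in> carrier (dual_module K ?P)" by (rule \<beta>_cl[OF y'])
    show "inv (inv_char K \<chi> \<sigma>) \<odot>\<^bsub>dual_module K ?P\<^esub> \<beta> y \<in> carrier (dual_module K ?P)"
      using \<sigma> by (intro DP.smult_closed \<beta>_cl[OF y]) (simp add: inv_inv_char char_closed)
    fix x assume x: "x \<in> tuples d (carrier E)"
    show "\<beta> (place_perm \<sigma> y) (chi_prod K d W \<chi> E x) =
        (inv (inv_char K \<chi> \<sigma>) \<odot>\<^bsub>dual_module K ?P\<^esub> \<beta> y) (chi_prod K d W \<chi> E x)"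
      using schur_pairing_place_perm_right[OF \<sigma> x y] \<beta>(2)[OF y' x] \<beta>(2)[OF y x] cp[OF x]
      by (simp add: inv_inv_char[OF \<sigma>])
  qed
  ultimately obtain f where f: "f \<in> module_hom K ?Q (dual_module K ?P)"
    "\<And>y. y \<in> tuples d (carrier ?D) \<Longrightarrow> f (chi_prod K d W (inv_char K \<chi>) ?D y) = \<beta> y"
    using IC.chi_power_lift[OF D DP.module_axioms, of \<beta>] by blast
  have "satisfies_schur_formula K d W \<chi> E (\<lambda>(x, y) \<in> carrier ?P \<times> carrier ?Q. f y x)"
    unfolding satisfies_schur_formula_def
    using f(2) \<beta>(2) cp IC.chi_prod_closed[OF D] by (simp del: dual_module_simps)
  then show ?thesis
    using bilinear_form_of_hom[OF P IC.module_chi_power[OF D] f(1)] by blast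
qed

lemma schur_form_ex1:
  assumes "module K E"
  shows "\<exists>!B. B \<in> bilinear_forms K (chi_power K d W \<chi> E) (chi_power K d W (inv_char K \<chi>) (dual_module K E)) \<and>
    satisfies_schur_formula K d W \<chi> E B"
proof (rule ex_ex1I[OF ex_schur_form[OF assms]])
  interpret IC: perm_character K d W "inv_char K \<chi>" by (rule perm_character_inv_char)
  note D = module_dual[OF assms]
  fix B B' assume "B \<in> bilinear_forms K (chi_power K d W \<chi> E) (chi_power K d W (inv_char K \<chi>) (dual_module K E)) \<and>
      satisfies_schur_formula K d W \<chi> E B"
    "B' \<in> bilinear_forms K (chi_power K d W \<chi> E) (chi_power K d W (inv_char K \<chi>) (dual_module K E)) \<and>
      satisfies_schur_formula K d W \<chi> E B'"
  then show "B = B'"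
    by (intro bilinear_forms_ext[OF module_chi_power[OF assms] IC.module_chi_power[OF D] _ _
          generates_chi_prod[OF assms] IC.generates_chi_prod[OF D]])
      (auto simp: satisfies_schur_formula_def simp del: dual_module_simps)
qed

lemma schur_form:
  assumes "module K E"
  shows "schur_form K d W \<chi> E \<in>
      bilinear_forms K (chi_power K d W \<chi> E) (chi_power K d W (inv_char K \<chi>) (dual_module K E))"
    and "satisfies_schur_formula K d W \<chi> E (schur_form K d W \<chi> E)"
  using theI'[OF schur_form_ex1[OF assms]] by (simp_all add: schur_form_def)

lemma iota_hom:
  assumes "module K E"
  shows "iota K d W \<chi> E \<in>
    module_hom K (chi_power K d W (inv_char K \<chi>) (dual_module K E)) (dual_module K (chi_power K d W \<chi> E))"
  unfolding iota_def
  by (intro associated_map_hom module_chi_power perm_character.module_chi_power[OF perm_character_inv_char]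
      module_dual schur_form assms)

lemma iota_chi_prod:
  assumes "module K E" "x \<in> tuples d (carrier E)" "y \<in> tuples d (carrier (dual_module K E))"
  shows "iota K d W \<chi> E (chi_prod K d W (inv_char K \<chi>) (dual_module K E) y) (chi_prod K d W \<chi> E x)
    = schur_pairing E x y"
  using schur_form(2)[OF assms(1)] assms(2,3) chi_prod_closed[OF assms(1,2)]
    perm_character.chi_prod_closed[OF perm_character_inv_char module_dual[OF assms(1)] assms(3)]
  by (simp add: iota_def associated_map_def satisfies_schur_formula_def del: dual_module_simps)

text \<open>In each factor the transpose moves \<open>u\<close> from the form to the vector, and
  \<open>u\<close> applied entrywise commutes with place permutations. This is the computation
  behind naturality.\<close>

lemma schur_pairing_transpose:
  assumes "module K E" "module K F" "u \<in> module_hom K E F"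
    and "x \<in> tuples d (carrier E)" "y \<in> tuples d (carrier (dual_module K F))"
  shows "schur_pairing E x (\<lambda>t\<in>{1..d}. transpose_map K E F u (y t)) = schur_pairing F (\<lambda>t\<in>{1..d}. u (x t)) y"
proof -
  note x' = restrict_comp_tuples[OF assms(3,4)]
  note y' = restrict_comp_tuples[OF transpose_map_hom[OF assms(1-3)] assms(5)]
  have "(\<Otimes>t\<in>{1..d}. (\<lambda>t\<in>{1..d}. transpose_map K E F u (y t)) t (place_perm \<sigma> x t)) =
      (\<Otimes>t\<in>{1..d}. y t (place_perm \<sigma> (\<lambda>t\<in>{1..d}. u (x t)) t))" if \<sigma>: "\<sigma> \<in> W" for \<sigma>
  proof (intro finprod_cong' refl)
    show "(\<lambda>t. y t (place_perm \<sigma> (\<lambda>t\<in>{1..d}. u (x t)) t)) \<in> {1..d} \<rightarrow> carrier K"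
      using tuples_mem[OF place_perm_tuples[OF W_permutes[OF \<sigma>] x']] tuples_mem[OF assms(5)]
      by (auto intro: module_hom_regular_closed[where M = F] simp del: restrict_apply)
    fix t assume t: "t \<in> {1..d}"
    then show "(\<lambda>t\<in>{1..d}. transpose_map K E F u (y t)) t (place_perm \<sigma> x t) =
        y t (place_perm \<sigma> (\<lambda>t\<in>{1..d}. u (x t)) t)"
      using tuples_mem[OF place_perm_tuples[OF W_permutes[OF \<sigma>] assms(4)] t] tuples_mem[OF assms(5) t]
      by (simp add: place_perm_restrict[OF W_permutes[OF \<sigma>]] transpose_map_apply del: dual_module_simps)
  qed
  then show ?thesis
    unfolding schur_pairing_eq[OF assms(4) y'] schur_pairing_eq[OF x' assms(5)]
    using schur_prod_closed[OF _ x' assms(5)] char_closed by (intro add.finprod_cong') auto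
qed

text \<open>Both sides are linear in \<open>y\<close> with linear forms as values, so it suffices to
  take a product for \<open>y\<close> and to evaluate at a product.\<close>

lemma iota_natural:
  assumes "module K E" "module K F" "u \<in> module_hom K E F"
    and "y \<in> carrier (chi_power K d W (inv_char K \<chi>) (dual_module K F))"
  shows "iota K d W \<chi> E
      (chi_power_map K d W (inv_char K \<chi>) (dual_module K F) (dual_module K E) (transpose_map K E F u) y) =
    transpose_map K (chi_power K d W \<chi> E) (chi_power K d W \<chi> F) (chi_power_map K d W \<chi> E F u)
      (iota K d W \<chi> F y)"
proof -
  interpret IC: perm_character K d W "inv_char K \<chi>" by (rule perm_character_inv_char)
  let ?QF = "chi_power K d W (inv_char K \<chi>) (dual_module K F)"
  let ?L = "\<lambda>y. iota K d W \<chi> E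
      (chi_power_map K d W (inv_char K \<chi>) (dual_module K F) (dual_module K E) (transpose_map K E F u) y)"
  let ?R = "\<lambda>y. transpose_map K (chi_power K d W \<chi> E) (chi_power K d W \<chi> F) (chi_power_map K d W \<chi> E F u)
      (iota K d W \<chi> F y)"
  note PE = module_chi_power[OF assms(1)] and PF = module_chi_power[OF assms(2)]
  note DE = module_dual[OF assms(1)] and DF = module_dual[OF assms(2)]
  note QF = IC.module_chi_power[OF DF]
  note tr = transpose_map_hom[OF assms(1-3)]
  note mp = chi_power_map[OF assms(1-3)]
  note mp' = IC.chi_power_map[OF DF DE tr]
  have L: "(\<lambda>y\<in>carrier ?QF. ?L y) \<in> module_hom K ?QF (dual_module K (chi_power K d W \<chi> E))"
    by (rule module_hom_compose[OF QF mp'(1) iota_hom[OF assms(1)]])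
  have R: "(\<lambda>y\<in>carrier ?QF. ?R y) \<in> module_hom K ?QF (dual_module K (chi_power K d W \<chi> E))"
    by (rule module_hom_compose[OF QF iota_hom[OF assms(2)] transpose_map_hom[OF PE PF mp(1)]])
  have "(\<lambda>y\<in>carrier ?QF. ?L y) = (\<lambda>y\<in>carrier ?QF. ?R y)"
  proof (rule generates_hom_ext[OF QF module_dual[OF PE] IC.generates_chi_prod[OF DF] L R])
    fix z assume "z \<in> chi_prod K d W (inv_char K \<chi>) (dual_module K F) ` tuples d (carrier (dual_module K F))"
    then obtain y where y: "y \<in> tuples d (carrier (dual_module K F))"
      "z = chi_prod K d W (inv_char K \<chi>) (dual_module K F) y" by auto
    have z: "z \<in> carrier ?QF" unfolding y(2) by (rule IC.chi_prod_closed[OF DF y(1)])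
    note y' = restrict_comp_tuples[OF tr y(1)]
    have "?L z = ?R z"
    proof (rule generates_hom_ext[OF PE module_regular[OF cring_axioms] generates_chi_prod[OF assms(1)]])
      show "?L z \<in> module_hom K (chi_power K d W \<chi> E) (regular_module K)"
        using module_hom_closed[OF L z] z by simp
      show "?R z \<in> module_hom K (chi_power K d W \<chi> E) (regular_module K)"
        using module_hom_closed[OF R z] z by simp
      fix w assume "w \<in> chi_prod K d W \<chi> E ` tuples d (carrier E)"
      then obtain x where x: "x \<in> tuples d (carrier E)" "w = chi_prod K d W \<chi> E x" by auto
      have "?L z w = schur_pairing E x (\<lambda>t\<in>{1..d}. transpose_map K E F u (y t))"
        unfolding x(2) y(2) by (simp only: mp'(2)[OF y(1)] iota_chi_prod[OF assms(1) x(1) y'])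
      also have "\<dots> = schur_pairing F (\<lambda>t\<in>{1..d}. u (x t)) y"
        by (rule schur_pairing_transpose[OF assms(1-3) x(1) y(1)])
      also have "\<dots> = iota K d W \<chi> F z (chi_power_map K d W \<chi> E F u w)"
        unfolding x(2) y(2)
        by (simp only: mp(2)[OF x(1)] iota_chi_prod[OF assms(2) restrict_comp_tuples[OF assms(3) x(1)] y(1)])
      also have "\<dots> = ?R z w"
        by (rule transpose_map_apply[symmetric])
          (use module_hom_closed[OF iota_hom[OF assms(2)] z] chi_prod_closed[OF assms(1) x(1)] x(2) in auto)
      finally show "?L z w = ?R z w" .
    qed
    then show "(\<lambda>y\<in>carrier ?QF. ?L y) z = (\<lambda>y\<in>carrier ?QF. ?R y) z" using z by simp
  qed
  from fun_cong[OF this, of y] show ?thesis using assms(4) by simp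
qed

end

section \<open>The bases indexed by \<open>J\<close>\<close>

lemma finite_tuples: "finite A \<Longrightarrow> finite (tuples d A)"
  by (simp add: finite_PiE)

text \<open>Trichotomy of \<open>less_fun\<close> asks for finitely many places of disagreement;
  multi-indices agree outside \<open>{1..d}\<close>.\<close>

lemma tuples_less_fun_cases:
  assumes "i \<in> tuples d {1..n::nat}" "j \<in> tuples d {1..n}"
  shows "less_fun i j \<or> i = j \<or> less_fun j i"
proof (rule less_fun_trichotomy)
  have "{k. i k \<noteq> j k} \<subseteq> {1..d}"
  proof
    fix k assume "k \<in> {k. i k \<noteq> j k}"
    then show "k \<in> {1..d}"
      using PiE_arb[OF assms(1), of k] PiE_arb[OF assms(2), of k] by (cases "k \<in> {1..d}") simp_all
  qed
  then show "finite {k. i k \<noteq> j k}" using finite_subset by blast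
qed

lemma (in module) smult_eq_zero_Units:
  assumes "a \<in> Units R" "x \<in> carrier M" "a \<odot>\<^bsub>M\<^esub> x = \<zero>\<^bsub>M\<^esub>"
  shows "x = \<zero>\<^bsub>M\<^esub>"
proof -
  have "x = (inv\<^bsub>R\<^esub> a \<otimes>\<^bsub>R\<^esub> a) \<odot>\<^bsub>M\<^esub> x" using assms by simp
  also have "\<dots> = inv\<^bsub>R\<^esub> a \<odot>\<^bsub>M\<^esub> (a \<odot>\<^bsub>M\<^esub> x)"
    using assms R.Units_closed R.Units_inv_closed by (intro smult_assoc1) auto
  also have "\<dots> = \<zero>\<^bsub>M\<^esub>" using assms R.Units_inv_closed by simp
  finally show ?thesis .
qed

lemma generates_smult_Units:
  assumes "module K M" "generates K M (b ` J)" "\<And>j. j \<in> J \<Longrightarrow> c j \<in> Units K"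
  shows "generates K M ((\<lambda>j. c j \<odot>\<^bsub>M\<^esub> b j) ` J)"
proof -
  interpret M: module K M by fact
  have b: "b j \<in> carrier M" if "j \<in> J" for j using assms(2) that by (auto simp: generates_def)
  have "b j \<in> H" if H: "submodule H K M" "(\<lambda>j. c j \<odot>\<^bsub>M\<^esub> b j) ` J \<subseteq> H" and j: "j \<in> J" for H j
  proof -
    have "b j = (inv\<^bsub>K\<^esub> (c j) \<otimes>\<^bsub>K\<^esub> c j) \<odot>\<^bsub>M\<^esub> b j" using assms(3)[OF j] b[OF j] by simp
    also have "\<dots> = inv\<^bsub>K\<^esub> (c j) \<odot>\<^bsub>M\<^esub> (c j \<odot>\<^bsub>M\<^esub> b j)"
      using assms(3)[OF j] b[OF j] by (intro M.smult_assoc1) auto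
    also have "\<dots> \<in> H" by (rule submodule_smult[OF H(1)]) (use H(2) j assms(3)[OF j] in auto)
    finally show ?thesis .
  qed
  then show ?thesis
    using assms(2) b M.R.Units_closed[OF assms(3)] unfolding generates_def by (auto simp: image_subset_iff)
qed

lemma (in cring) finprod_delta:
  assumes "finite A"
  shows "(\<Otimes>t\<in>A. if P t then \<one> else \<zero>) = (if \<forall>t\<in>A. P t then \<one> else \<zero>)"
  using assms
proof (induction A)
  case (insert a A)
  then show ?case by (subst finprod_insert) auto
qed simp

text \<open>Turns a factorization of \<open>card W\<close> into a factorization of a unit of
  \<open>K\<close>.\<close>

lemma (in cring) add_pow_one_mult:
  "([m] \<cdot> \<one>) \<otimes> ([n] \<cdot> \<one>) = [(m * n :: nat)] \<cdot> \<one>"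
  by (simp add: add_pow_ldistr add.nat_pow_pow mult.commute)

context perm_character
begin

section \<open>Stabilizers and character sums\<close>

lemma index_stabilizer_eq: "index_stabilizer d W i = {\<sigma> \<in> W. place_perm \<sigma> i = i}"
  by (simp add: stabilizer_def)

lemma subgroup_index_stabilizer: "subgroup (index_stabilizer d W i) (sym_group d)"
proof (rule group.subgroupI[OF sym_group_is_group])
  show "index_stabilizer d W i \<subseteq> carrier (sym_group d)"
    using subgroup.subset[OF subgroup_W] by (auto simp: index_stabilizer_eq)
  show "index_stabilizer d W i \<noteq> {}"
    using W_id by (auto simp: index_stabilizer_eq place_perm_id)
next
  fix \<sigma> assume \<sigma>: "\<sigma> \<in> index_stabilizer d W i"
  then have W: "\<sigma> \<in> W" "place_perm \<sigma> i = i" by (auto simp: index_stabilizer_eq)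
  have "place_perm (inv_into UNIV \<sigma>) (place_perm \<sigma> i) = i"
    using place_perm_comp[OF permutes_inv[OF W_permutes] W_permutes, OF W(1) W(1), of i]
      permutes_inv_o(2)[OF W_permutes[OF W(1)]] by (simp add: place_perm_id)
  then show "inv\<^bsub>sym_group d\<^esub> \<sigma> \<in> index_stabilizer d W i"
    using W subgroup.subset[OF subgroup_W] by (auto simp: index_stabilizer_eq W_inv subset_iff)
next
  fix \<sigma> \<tau> assume "\<sigma> \<in> index_stabilizer d W i" "\<tau> \<in> index_stabilizer d W i"
  then show "\<sigma> \<otimes>\<^bsub>sym_group d\<^esub> \<tau> \<in> index_stabilizer d W i"
    using place_perm_comp[OF W_permutes W_permutes, of \<sigma> \<tau> i] W_comp
    by (auto simp: index_stabilizer_eq sym_group_mult)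
qed

text \<open>By Lagrange the order of the stabilizer divides that of \<open>W\<close>, and a divisor
  of a unit is a unit.\<close>

lemma card_index_stabilizer_Units:
  assumes "[card W] \<cdot> \<one> \<in> Units K"
  shows "[card (index_stabilizer d W i)] \<cdot> \<one> \<in> Units K"
proof -
  let ?S = "index_stabilizer d W i"
  interpret G: group "perm_group d W"
    using subgroup.subgroup_is_group[OF subgroup_W sym_group_is_group] .
  have "subgroup ?S (perm_group d W)"
    by (rule group.subgroup_incl[OF sym_group_is_group subgroup_index_stabilizer subgroup_W])
      (auto simp: index_stabilizer_eq)
  from G.lagrange[OF this] have "card W = card ?S * card (rcosets\<^bsub>perm_group d W\<^esub> ?S)"
    by (simp add: order_def mult.commute)
  then have "([card ?S] \<cdot> \<one>) \<otimes> ([card (rcosets\<^bsub>perm_group d W\<^esub> ?S)] \<cdot> \<one>) \<in> Units K"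
    using assms by (simp add: add_pow_one_mult)
  then show ?thesis by (rule unit_factor) auto
qed

text \<open>Lets \<open>sum_char_eq_zero\<close> be used with the stabilizer in the place of
  \<open>W\<close>.\<close>

lemma perm_character_index_stabilizer: "perm_character K d (index_stabilizer d W i) \<chi>"
proof (intro perm_character.intro perm_character_axioms.intro cring_axioms subgroup_index_stabilizer)
  show "\<chi> \<in> hom (perm_group d (index_stabilizer d W i)) (units_of K)"
    using char_hom by (auto simp: hom_def index_stabilizer_eq)
qed

text \<open>Translation by \<tau> reorders the sum and multiplies it by \<chi>(\<tau>); if the sum
  were nonzero, cancelling it would give \<chi>(\<tau>) = 1.\<close>

lemma sum_char_eq_zero:
  assumes "domain K" "\<tau> \<in> W" "\<chi> \<tau> \<noteq> \<one>"
  shows "(\<Oplus>\<sigma>\<in>W. \<chi> \<sigma>) = \<zero>"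
proof (rule ccontr)
  interpret domain K by fact
  assume nz: "(\<Oplus>\<sigma>\<in>W. \<chi> \<sigma>) \<noteq> \<zero>"
  have s: "(\<Oplus>\<sigma>\<in>W. \<chi> \<sigma>) \<in> carrier K" using char_closed by (intro finsum_closed) auto
  have "\<chi> \<tau> \<otimes> (\<Oplus>\<sigma>\<in>W. \<chi> \<sigma>) = (\<Oplus>\<sigma>\<in>W. \<chi> \<tau> \<otimes> \<chi> \<sigma>)"
    using finite_W char_closed assms(2) by (intro finsum_rdistr) auto
  also have "\<dots> = (\<Oplus>\<sigma>\<in>W. \<chi> (\<tau> \<circ> \<sigma>))"
    using char_closed W_comp assms(2) by (intro add.finprod_cong') (auto simp: char_comp)
  also have "\<dots> = (\<Oplus>\<sigma>\<in>W. \<chi> \<sigma>)" using char_closed by (intro finsum_W_reindex_left[OF assms(2)]) auto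
  finally have "\<chi> \<tau> \<otimes> (\<Oplus>\<sigma>\<in>W. \<chi> \<sigma>) = \<one> \<otimes> (\<Oplus>\<sigma>\<in>W. \<chi> \<sigma>)" using s by simp
  then show False using m_rcancel[OF nz s] char_closed[OF assms(2)] assms(3) by simp
qed

text \<open>A unit is 1 exactly when its inverse is; hence the two families of products share one
  index set.\<close>

lemma index_set_inv_char: "index_set K d W (inv_char K \<chi>) n = index_set K d W \<chi> n"
proof -
  have "inv_char K \<chi> \<sigma> = \<one> \<longleftrightarrow> \<chi> \<sigma> = \<one>" if "\<sigma> \<in> W" for \<sigma>
  proof
    assume "inv_char K \<chi> \<sigma> = \<one>"
    then show "\<chi> \<sigma> = \<one>" using inv_inv_char[OF that] by simp
  qed (simp add: inv_char_def)
  then show ?thesis by (auto simp: index_set_def index_stabilizer_eq)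
qed

section \<open>Products of basis vectors\<close>

lemma basis_tuple_closed:
  fixes e :: "nat \<Rightarrow> 'a"
  assumes "e \<in> I \<rightarrow> A" "i \<in> tuples d I"
  shows "(\<lambda>t\<in>{1..d}. e (i t)) \<in> tuples d A"
  using assms by auto

lemma chi_basis_place_perm:
  assumes "module K E" "e \<in> I \<rightarrow> carrier E" "i \<in> tuples d I" "\<sigma> \<in> W"
  shows "chi_basis K d W \<chi> E e (place_perm \<sigma> i) = inv (\<chi> \<sigma>) \<odot>\<^bsub>chi_power K d W \<chi> E\<^esub> chi_basis K d W \<chi> E e i"
  using chi_prod_place_perm[OF assms(1,4) basis_tuple_closed[OF assms(2,3)]]
  by (simp only: chi_basis_def place_perm_restrict[OF W_permutes[OF assms(4)]])

lemma chi_basis_closed: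
  assumes "module K E" "e \<in> I \<rightarrow> carrier E" "i \<in> tuples d I"
  shows "chi_basis K d W \<chi> E e i \<in> carrier (chi_power K d W \<chi> E)"
  unfolding chi_basis_def by (rule chi_prod_closed[OF assms(1) basis_tuple_closed[OF assms(2,3)]])

text \<open>
  Averaging over the stabilizer \<open>S\<close> of \<open>i\<close>: every \<open>\<sigma>\<close> in \<open>S\<close> multiplies \<open>e\<^sub>i\<close> by \<open>\<chi>(\<sigma>)\<^sup>-\<^sup>1\<close> and
  also fixes it, so \<open>|S| e\<^sub>i\<close> is a multiple of the vanishing sum of \<open>\<chi>\<^sup>-\<^sup>1\<close> over \<open>S\<close>.
\<close>

lemma chi_basis_eq_zero:
  assumes "domain K" "[card W] \<cdot> \<one> \<in> Units K" "module K E" "e \<in> I \<rightarrow> carrier E" "i \<in> tuples d I"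
    and "\<tau> \<in> index_stabilizer d W i" "\<chi> \<tau> \<noteq> \<one>"
  shows "chi_basis K d W \<chi> E e i = \<zero>\<^bsub>chi_power K d W \<chi> E\<^esub>"
proof -
  let ?P = "chi_power K d W \<chi> E" and ?v = "chi_basis K d W \<chi> E e i"
  let ?S = "index_stabilizer d W i"
  interpret P: module K ?P by (rule module_chi_power) fact
  interpret S: perm_character K d ?S "inv_char K \<chi>"
    by (rule perm_character.perm_character_inv_char[OF perm_character_index_stabilizer])
  have v: "?v \<in> carrier ?P" by (rule chi_basis_closed) fact+
  have \<tau>: "\<tau> \<in> W" using assms(6) by (simp add: index_stabilizer_eq)
  have "inv_char K \<chi> \<tau> \<noteq> \<one>" using inv_inv_char[OF \<tau>] assms(7) by auto
  then have zero: "(\<Oplus>\<sigma>\<in>?S. inv_char K \<chi> \<sigma>) = \<zero>" by (rule S.sum_char_eq_zero[OF assms(1,6)])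
  have hom: "(\<lambda>a\<in>carrier (regular_module K). a \<odot>\<^bsub>?P\<^esub> ?v) \<in> module_hom K (regular_module K) ?P"
    by (rule module_hom_restrictI[OF module_regular[OF cring_axioms]])
      (auto simp: v P.smult_l_distr P.smult_assoc1)
  \<comment> \<open>Scaling \<open>?v\<close> is a linear map from \<open>K\<close> into the module,
    so it distributes over a sum of scalars.\<close>
  have rdistr: "finsum K c ?S \<odot>\<^bsub>?P\<^esub> ?v = finsum ?P (\<lambda>\<sigma>. c \<sigma> \<odot>\<^bsub>?P\<^esub> ?v) ?S" if c: "c \<in> ?S \<rightarrow> carrier K" for c
  proof -
    have "finsum K c ?S \<odot>\<^bsub>?P\<^esub> ?v = finsum ?P (\<lambda>\<sigma>. (\<lambda>a\<in>carrier (regular_module K). a \<odot>\<^bsub>?P\<^esub> ?v) (c \<sigma>)) ?S"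
      using module_hom_finsum[OF module_regular[OF cring_axioms] P.module_axioms hom S.finite_W, of c] c
      by simp
    also have "\<dots> = finsum ?P (\<lambda>\<sigma>. c \<sigma> \<odot>\<^bsub>?P\<^esub> ?v) ?S"
      using c v by (intro P.M.add.finprod_cong') auto
    finally show ?thesis .
  qed
  have "([card ?S] \<cdot> \<one>) \<odot>\<^bsub>?P\<^esub> ?v = (\<Oplus>\<sigma>\<in>?S. \<one>) \<odot>\<^bsub>?P\<^esub> ?v"
    by (simp add: add.finprod_const)
  also have "\<dots> = finsum ?P (\<lambda>\<sigma>. \<one> \<odot>\<^bsub>?P\<^esub> ?v) ?S" by (rule rdistr) simp
  also have "\<dots> = finsum ?P (\<lambda>\<sigma>. inv_char K \<chi> \<sigma> \<odot>\<^bsub>?P\<^esub> ?v) ?S"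
  proof (intro P.M.add.finprod_cong' refl)
    fix \<sigma> assume "\<sigma> \<in> ?S"
    then have "\<sigma> \<in> W" "place_perm \<sigma> i = i" by (auto simp: index_stabilizer_eq)
    then show "\<one> \<odot>\<^bsub>?P\<^esub> ?v = inv_char K \<chi> \<sigma> \<odot>\<^bsub>?P\<^esub> ?v"
      using chi_basis_place_perm[OF assms(3-5), of \<sigma>] v by (simp add: inv_char_def)
  qed (use v S.char_closed in auto)
  also have "\<dots> = (\<Oplus>\<sigma>\<in>?S. inv_char K \<chi> \<sigma>) \<odot>\<^bsub>?P\<^esub> ?v"
    by (rule rdistr[symmetric]) (use S.char_closed in auto)
  also have "\<dots> = \<zero>\<^bsub>?P\<^esub>" using v by (simp add: zero)
  finally show ?thesis
    using P.smult_eq_zero_Units[OF card_index_stabilizer_Units[OF assms(2)] v] by simp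
qed

text \<open>The orbit is a finite image of \<open>W\<close>, nonempty through the identity, and
  \<open>less_fun\<close> is asymmetric and transitive.\<close>

lemma ex_minimal_in_orbit:
  assumes "i \<in> tuples d {1..n}"
  shows "\<exists>\<sigma>\<in>W. \<forall>k \<in> orbit (perm_group d W) place_perm (place_perm \<sigma> i). \<not> less_fun k (place_perm \<sigma> i)"
proof -
  let ?O = "(\<lambda>\<sigma>. place_perm \<sigma> i) ` W"
  have "\<exists>m\<in>?O. \<forall>k\<in>?O. k \<noteq> m \<longrightarrow> \<not> less_fun k m"
    using finite_W W_id less_fun_asym less_fun_trans
    by (intro Finite_Set.bex_min_element) (auto simp: asymp_on_def transp_on_def, blast+)
  then obtain \<sigma> where \<sigma>: "\<sigma> \<in> W" "\<forall>k\<in>?O. k \<noteq> place_perm \<sigma> i \<longrightarrow> \<not> less_fun k (place_perm \<sigma> i)" by auto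
  \<comment> \<open>Minimality was obtained over the orbit of \<open>i\<close>; the orbit of the
    permuted index lies inside it.\<close>
  have orb: "k \<in> ?O" if k: "k \<in> orbit (perm_group d W) place_perm (place_perm \<sigma> i)" for k
  proof -
    obtain \<tau> where \<tau>: "\<tau> \<in> W" "k = place_perm \<tau> (place_perm \<sigma> i)"
      using k by (auto simp: orbit_def)
    then have "k = place_perm (\<tau> \<circ> \<sigma>) i"
      using place_perm_comp[OF W_permutes[OF \<tau>(1)] W_permutes[OF \<sigma>(1)], of i] by simp
    then show ?thesis using W_comp[OF \<tau>(1) \<sigma>(1)] by blast
  qed
  have "\<not> less_fun k (place_perm \<sigma> i)" if "k \<in> orbit (perm_group d W) place_perm (place_perm \<sigma> i)" for k
    using orb[OF that] \<sigma>(2) less_fun_irrefl[of k] by (cases "k = place_perm \<sigma> i") auto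
  then show ?thesis using \<sigma>(1) by blast
qed

text \<open>Two reductions: multilinearity replaces arbitrary vectors by the generators of
  \<open>E\<close>, and a place permutation, at the price of a unit factor, replaces an arbitrary
  index by a minimal one, where the product either belongs to the family or is zero.\<close>

lemma generates_chi_basis:
  assumes "domain K" "[card W] \<cdot> \<one> \<in> Units K" "module K E" "generates K E (e ` {1..n})"
  shows "generates K (chi_power K d W \<chi> E) (chi_basis K d W \<chi> E e ` index_set K d W \<chi> n)"
proof -
  let ?P = "chi_power K d W \<chi> E"
  interpret E: module K E by fact
  interpret P: module K ?P by (rule module_chi_power) fact
  have e: "e \<in> {1..n} \<rightarrow> carrier E" using assms(4) by (auto simp: generates_def)
  have basis: "chi_basis K d W \<chi> E e i \<in> H"
    if H: "submodule H K ?P" "chi_basis K d W \<chi> E e ` index_set K d W \<chi> n \<subseteq> H" and i: "i \<in> tuples d {1..n}"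
    for H i
  proof -
    obtain \<sigma> where \<sigma>: "\<sigma> \<in> W"
      and min: "\<forall>k \<in> orbit (perm_group d W) place_perm (place_perm \<sigma> i). \<not> less_fun k (place_perm \<sigma> i)"
      using ex_minimal_in_orbit[OF i] by blast
    let ?j = "place_perm \<sigma> i"
    have j: "?j \<in> tuples d {1..n}" by (rule place_perm_tuples[OF W_permutes[OF \<sigma>] i])
    have "chi_basis K d W \<chi> E e ?j \<in> H"
    proof (cases "\<forall>\<tau> \<in> index_stabilizer d W ?j. \<chi> \<tau> = \<one>")
      case True
      then have "?j \<in> index_set K d W \<chi> n" using j min by (auto simp: index_set_def)
      then show ?thesis using H(2) by auto
    next
      case False
      then show ?thesis
        using chi_basis_eq_zero[OF assms(1-3) e j] submodule_zero[OF H(1)] by auto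
    qed
    \<comment> \<open>Multiplying by \<chi>(\<sigma>) undoes the factor picked up in moving
      \<open>i\<close> to the minimal index.\<close>
    then have "\<chi> \<sigma> \<odot>\<^bsub>?P\<^esub> (inv (\<chi> \<sigma>) \<odot>\<^bsub>?P\<^esub> chi_basis K d W \<chi> E e i) \<in> H"
      using chi_basis_place_perm[OF assms(3) e i \<sigma>] submodule_smult[OF H(1) char_closed[OF \<sigma>]] by simp
    then show ?thesis
      using chi_basis_closed[OF assms(3) e i] char_Units[OF \<sigma>] char_closed[OF \<sigma>] char_inv_closed[OF \<sigma>]
      by (simp add: P.smult_assoc1[symmetric])
  qed
  \<comment> \<open>Replace the entries of a tuple by arbitrary vectors one position at a time; at each step
    the admissible vectors form a submodule containing the generators.\<close>
  have step: "chi_prod K d W \<chi> E x \<in> H"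
    if H: "submodule H K ?P" "chi_basis K d W \<chi> E e ` index_set K d W \<chi> n \<subseteq> H"
      and x: "x \<in> tuples d (carrier E)" "\<forall>t\<in>{1..d}. k < t \<longrightarrow> x t \<in> e ` {1..n}" for H x k
    using x
  proof (induction k arbitrary: x)
    \<comment> \<open>Slots are numbered from 1, so at \<open>k = 0\<close> every entry is one of
      the generators, and a choice of their indices leads to \<open>basis\<close>.\<close>
    case 0
    have "\<exists>l. l \<in> {1..n} \<and> x t = e l" if "t \<in> {1..d}" for t
    proof -
      have "0 < t" using that by (simp add: atLeastAtMost_iff)
      then show ?thesis using 0(2) that by blast
    qed
    then obtain i where i: "\<And>t. t \<in> {1..d} \<Longrightarrow> i t \<in> {1..n} \<and> x t = e (i t)" by metis
    then have "(\<lambda>t\<in>{1..d}. i t) \<in> tuples d {1..n}" by (intro restrict_PiE_iff[THEN iffD2]) blast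
    moreover have "(\<lambda>t\<in>{1..d}. e ((\<lambda>t\<in>{1..d}. i t) t)) = x"
    proof
      fix t
      show "(\<lambda>t\<in>{1..d}. e ((\<lambda>t\<in>{1..d}. i t) t)) t = x t"
        using i[of t] PiE_arb[OF 0(1), of t] by (cases "t \<in> {1..d}") simp_all
    qed
    ultimately show ?case using basis[OF H] unfolding chi_basis_def by metis
  next
    case (Suc k)
    show ?case
    proof (cases "Suc k \<in> {1..d}")
      \<comment> \<open>No slot has number \<open>Suc k\<close>, so the conditions for
        \<open>k\<close> and for \<open>Suc k\<close> say the same.\<close>
      case False
      then have "\<forall>t\<in>{1..d}. k < t \<longrightarrow> x t \<in> e ` {1..n}"
        using Suc.prems(2) Suc_lessI by blast
      then show ?thesis using Suc.IH Suc.prems(1) by blast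
    next
      case True
      note ml = multilinearD[OF multilinear_chi_prod[OF assms(3)] Suc.prems(1)]
      have upd: "x(Suc k := a) \<in> tuples d (carrier E)" if "a \<in> carrier E" for a
        by (rule tuples_upd[OF Suc.prems(1) True that])
      have "chi_prod K d W \<chi> E (x(Suc k := a)) \<in> H" if "a \<in> carrier E" for a
        using assms(3,4) that
      proof (induction rule: generates_induct)
        case zero
        \<comment> \<open>The zero vector is written as a zero multiple so that homogeneity in the
          slot gives a zero product.\<close>
        have "chi_prod K d W \<chi> E (x(Suc k := \<zero> \<odot>\<^bsub>E\<^esub> \<zero>\<^bsub>E\<^esub>)) = \<zero> \<odot>\<^bsub>?P\<^esub> chi_prod K d W \<chi> E (x(Suc k := \<zero>\<^bsub>E\<^esub>))"
          using True by (intro ml(3)) auto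
        also have "\<dots> = \<zero>\<^bsub>?P\<^esub>" using chi_prod_closed[OF assms(3) upd] by simp
        finally show ?case using submodule_zero[OF H(1)] by (simp only: E.smult_l_null[OF E.M.zero_closed])
      next
        case (gen a)
        show ?case
        proof (rule Suc.IH)
          show "x(Suc k := a) \<in> tuples d (carrier E)" using gen e by (intro upd) auto
          show "\<forall>t\<in>{1..d}. k < t \<longrightarrow> (x(Suc k := a)) t \<in> e ` {1..n}"
          proof (intro ballI impI)
            fix t assume "t \<in> {1..d}" "k < t"
            then show "(x(Suc k := a)) t \<in> e ` {1..n}"
              using gen Suc.prems(2) by (cases "t = Suc k") (simp_all add: Suc_lessI)
          qed
        qed
      next
        case (add a b)
        then show ?case
          using submodule_add[OF H(1) add.IH] ml(2)[OF True add.hyps] by (simp del: fun_upd_apply)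
      next
        case (smult r a)
        then show ?case
          using submodule_smult[OF H(1) smult.hyps(1) smult.IH] ml(3)[OF True smult.hyps]
          by (simp del: fun_upd_apply)
      qed
      from this[OF tuples_mem[OF Suc.prems(1) True]] show ?thesis by simp
    qed
  qed
  show ?thesis
    unfolding generates_def
  proof (intro conjI allI impI)
    show "chi_basis K d W \<chi> E e ` index_set K d W \<chi> n \<subseteq> carrier ?P"
      using chi_basis_closed[OF assms(3) e] by (auto simp: index_set_def)
    fix H assume H: "submodule H K ?P" "chi_basis K d W \<chi> E e ` index_set K d W \<chi> n \<subseteq> H"
    have "chi_prod K d W \<chi> E ` tuples d (carrier E) \<subseteq> H"
    proof (rule image_subsetI)
      fix x assume "x \<in> tuples d (carrier E)"
      \<comment> \<open>With \<open>k = d\<close> no entry is required to be a generator.\<close>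
      then show "chi_prod K d W \<chi> E x \<in> H" by (rule step[OF H, of x d]) (simp add: atLeastAtMost_iff)
    qed
    then show "carrier ?P \<subseteq> H" using generates_chi_prod[OF assms(3)] H(1) by (auto simp: generates_def)
  qed
qed

text \<open>Both indices are minimal in the same orbit, so neither lies below the other and
  trichotomy leaves equality.\<close>

lemma index_set_place_perm_eq:
  assumes "i \<in> index_set K d W \<chi> n" "j \<in> index_set K d W \<chi> n" "\<sigma> \<in> W" "place_perm \<sigma> i = j"
  shows "i = j"
proof -
  have "place_perm (inv_into UNIV \<sigma>) j = i"
    using place_perm_comp[OF permutes_inv[OF W_permutes] W_permutes, OF assms(3,3), of i]
      permutes_inv_o(2)[OF W_permutes[OF assms(3)]] assms(4) by (simp add: place_perm_id)
  then have "i \<in> orbit (perm_group d W) place_perm j" "j \<in> orbit (perm_group d W) place_perm i"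
    using assms(3,4) W_inv unfolding orbit_def by force+
  then show ?thesis
    using assms(1,2) tuples_less_fun_cases[of i d n j] by (auto simp: index_set_def)
qed

text \<open>A permutation \<sigma> contributes \<chi>(\<sigma>) exactly when it carries
  \<open>i\<close> to \<open>j\<close>. Distinct members of the index set lie in distinct orbits;
  for equal ones the sum runs over the stabilizer, where \<chi> is 1, and counts it.\<close>

lemma schur_pairing_basis:
  assumes "module_basis K E {1..n} e" "dual_family K E {1..n} e e'"
    and "i \<in> index_set K d W \<chi> n" "j \<in> index_set K d W \<chi> n"
  shows "schur_pairing E (\<lambda>t\<in>{1..d}. e (i t)) (\<lambda>t\<in>{1..d}. e' (j t)) =
    (if i = j then [card (index_stabilizer d W j)] \<cdot> \<one> else \<zero>)"
proof -
  have e: "e \<in> {1..n} \<rightarrow> carrier E" using assms(1) by (simp add: module_basis_def)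
  have e': "e' \<in> {1..n} \<rightarrow> carrier (dual_module K E)"
    and \<delta>: "\<And>k l. k \<in> {1..n} \<Longrightarrow> l \<in> {1..n} \<Longrightarrow> e' l (e k) = (if k = l then \<one> else \<zero>)"
    using assms(2) by (auto simp: dual_family_def)
  have i: "i \<in> tuples d {1..n}" and j: "j \<in> tuples d {1..n}" using assms(3,4) by (auto simp: index_set_def)
  have prod: "(\<Otimes>t\<in>{1..d}. (\<lambda>t\<in>{1..d}. e' (j t)) t (place_perm \<sigma> (\<lambda>t\<in>{1..d}. e (i t)) t)) =
      (if place_perm \<sigma> i = j then \<one> else \<zero>)" if \<sigma>: "\<sigma> \<in> W" for \<sigma>
  proof -
    note i' = place_perm_tuples[OF W_permutes[OF \<sigma>] i]
    have "(\<Otimes>t\<in>{1..d}. (\<lambda>t\<in>{1..d}. e' (j t)) t (place_perm \<sigma> (\<lambda>t\<in>{1..d}. e (i t)) t)) =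
        (\<Otimes>t\<in>{1..d}. if place_perm \<sigma> i t = j t then \<one> else \<zero>)"
      using tuples_mem[OF i'] tuples_mem[OF j]
      by (intro finprod_cong') (auto simp: place_perm_restrict[OF W_permutes[OF \<sigma>]] \<delta>)
    also have "\<dots> = (if \<forall>t\<in>{1..d}. place_perm \<sigma> i t = j t then \<one> else \<zero>)"
      by (rule finprod_delta) simp
    also have "(\<forall>t\<in>{1..d}. place_perm \<sigma> i t = j t) \<longleftrightarrow> place_perm \<sigma> i = j"
      using PiE_ext[OF i' j] by auto
    finally show ?thesis .
  qed
  have "schur_pairing E (\<lambda>t\<in>{1..d}. e (i t)) (\<lambda>t\<in>{1..d}. e' (j t)) =
      (\<Oplus>\<sigma>\<in>W. \<chi> \<sigma> \<otimes> (\<Otimes>t\<in>{1..d}. (\<lambda>t\<in>{1..d}. e' (j t)) t (place_perm \<sigma> (\<lambda>t\<in>{1..d}. e (i t)) t)))"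
    by (rule schur_pairing_eq[OF basis_tuple_closed[OF e i] basis_tuple_closed[OF e' j]])
  also have "\<dots> = (\<Oplus>\<sigma>\<in>W. if place_perm \<sigma> i = j then \<chi> \<sigma> else \<zero>)"
  proof (intro add.finprod_cong' refl)
    fix \<sigma> assume \<sigma>: "\<sigma> \<in> W"
    show "\<chi> \<sigma> \<otimes> (\<Otimes>t\<in>{1..d}. (\<lambda>t\<in>{1..d}. e' (j t)) t (place_perm \<sigma> (\<lambda>t\<in>{1..d}. e (i t)) t)) =
        (if place_perm \<sigma> i = j then \<chi> \<sigma> else \<zero>)"
      unfolding prod[OF \<sigma>] using char_closed[OF \<sigma>] by simp
  qed (use char_closed in auto)
  also have "\<dots> = (if i = j then [card (index_stabilizer d W j)] \<cdot> \<one> else \<zero>)"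
  proof (cases "i = j")
    case True
    have "(\<Oplus>\<sigma>\<in>W. if place_perm \<sigma> i = j then \<chi> \<sigma> else \<zero>) = (\<Oplus>\<sigma>\<in>index_stabilizer d W j. \<one>)"
      using True finite_W assms(4) by (intro add.finprod_mono_neutral_cong_right)
        (auto simp: index_stabilizer_eq index_set_def)
    then show ?thesis using True by (simp add: add.finprod_const)
  next
    case False
    have "(\<Oplus>\<sigma>\<in>W. if place_perm \<sigma> i = j then \<chi> \<sigma> else \<zero>) = (\<Oplus>\<sigma>\<in>W. \<zero>)"
      using False index_set_place_perm_eq[OF assms(3,4)] by (intro add.finprod_cong') auto
    then show ?thesis using False by simp
  qed
  finally show ?thesis .
qed

end

text \<open>Degree 0 follows the same mechanism with a one-point index set: the element 1 generates
  \<open>K\<close> on both sides and pairs with itself to 1.\<close>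

lemma regular_nonsingular:
  assumes "cring K"
  shows "nonsingular_form K (regular_module K) (regular_module K)
    (\<lambda>(k, l) \<in> carrier (regular_module K) \<times> carrier (regular_module K). k \<otimes>\<^bsub>K\<^esub> l)"
proof -
  interpret cring K by fact
  let ?R = "regular_module K"
  note R = module_regular[OF assms]
  define f where "f = (\<lambda>l\<in>carrier ?R. \<lambda>k\<in>carrier ?R. k \<otimes>\<^bsub>K\<^esub> l)"
  have fl: "f l \<in> module_hom K ?R ?R" if "l \<in> carrier K" for l
    unfolding f_def using that module_hom_restrictI[OF R, of "\<lambda>k. k \<otimes>\<^bsub>K\<^esub> l" ?R] by (simp add: l_distr m_assoc)
  have f: "f \<in> module_hom K ?R (dual_module K ?R)"
    unfolding f_def
    by (rule module_hom_restrictI[OF R])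
      (use fl in \<open>auto simp: f_def r_distr m_lcomm intro!: restrict_ext\<close>)
  have form: "(\<lambda>(k, l) \<in> carrier ?R \<times> carrier ?R. k \<otimes>\<^bsub>K\<^esub> l) = (\<lambda>(k, l) \<in> carrier ?R \<times> carrier ?R. f l k)"
    by (auto simp: f_def intro!: restrict_ext)
  have assoc: "associated_map ?R ?R (\<lambda>(k, l) \<in> carrier ?R \<times> carrier ?R. k \<otimes>\<^bsub>K\<^esub> l) = f"
    by (auto simp: f_def associated_map_def intro!: restrict_ext)
  have "generates K ?R ((\<lambda>_. \<one>\<^bsub>K\<^esub>) ` {()})"
    unfolding generates_def
  proof (intro conjI allI impI subsetI)
    fix H x assume "submodule H K ?R" "(\<lambda>_. \<one>\<^bsub>K\<^esub>) ` {()} \<subseteq> H" "x \<in> carrier ?R"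
    then show "x \<in> H" using submodule_smult[of H K ?R x "\<one>\<^bsub>K\<^esub>"] by simp
  qed simp
  from dual_generators(3)[OF R R _ this this f] have "f \<in> module_iso K ?R (dual_module K ?R)"
    by (simp add: f_def)
  then show ?thesis
    unfolding nonsingular_form_def assoc using bilinear_form_of_hom[OF R R f] form by simp
qed

section \<open>The theorem: non-singularity, naturality and dual bases\<close>

theorem theorem11:
  fixes K :: "('k, 'r) ring_scheme"
    and d :: nat and W :: "(nat \<Rightarrow> nat) set" and \<chi> :: "(nat \<Rightarrow> nat) \<Rightarrow> 'k"
    and E :: "('k, 'e, 'p) module_scheme"
    and n :: nat and e :: "nat \<Rightarrow> 'e" and e' :: "nat \<Rightarrow> 'e \<Rightarrow> 'k"
  assumes "domain K"
    and "d \<ge> 1"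
    and "subgroup W (sym_group d)"
    and "[card W] \<cdot>\<^bsub>K\<^esub> \<one>\<^bsub>K\<^esub> \<in> Units K"
    and "\<chi> \<in> hom (perm_group d W) (units_of K)"
    and "module K E"
    and "module_basis K E {1..n} e"
    and "dual_family K E {1..n} e e'"
  defines "P \<equiv> chi_power K d W \<chi> E"
    and "Q \<equiv> chi_power K d W (inv_char K \<chi>) (dual_module K E)"
    and "B \<equiv> schur_form K d W \<chi> E"
    and "J \<equiv> index_set K d W \<chi> n"
    and "ej \<equiv> chi_basis K d W \<chi> E e"
    and "ej' \<equiv> scaled_dual_chi_basis K d W \<chi> E e'"
  shows
    \<comment> \<open>(i)\<close>
    "((\<exists>!B'. B' \<in> bilinear_forms K P Q \<and> satisfies_schur_formula K d W \<chi> E B') \<and>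
      nonsingular_form K P Q B \<and>
      nonsingular_form K (chi_power0 K E) (chi_power0 K (dual_module K E)) (schur_form0 K E)) \<and>
    \<comment> \<open>(ii)\<close>
     (iota K d W \<chi> E \<in> module_iso K Q (dual_module K P) \<and>
      iota0 K E \<in> module_iso K (chi_power0 K (dual_module K E)) (dual_module K (chi_power0 K E)) \<and>
      (\<forall>(F :: ('k, 'f, 'q) module_scheme) u.
        finite_free_module K F \<longrightarrow> u \<in> module_hom K E F \<longrightarrow>
          (\<forall>y \<in> carrier (chi_power K d W (inv_char K \<chi>) (dual_module K F)).
            iota K d W \<chi> E
              (chi_power_map K d W (inv_char K \<chi>) (dual_module K F) (dual_module K E)
                (transpose_map K E F u) y) =
            transpose_map K P (chi_power K d W \<chi> F) (chi_power_map K d W \<chi> E F u)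
              (iota K d W \<chi> F y)) \<and>
          (\<forall>y \<in> carrier (chi_power0 K (dual_module K F)).
            iota0 K E
              (chi_power_map0 K (dual_module K F) (dual_module K E) (transpose_map K E F u) y) =
            transpose_map K (chi_power0 K E) (chi_power0 K F) (chi_power_map0 K E F u)
              (iota0 K F y)))) \<and>
    \<comment> \<open>(iii)\<close>
     ((\<forall>x \<in> carrier P. \<forall>y \<in> carrier Q. B (x, y) = canonical_form K P (x, iota K d W \<chi> E y)) \<and>
      module_basis K P J ej \<and>
      (\<forall>j\<in>J. [card (index_stabilizer d W j)] \<cdot>\<^bsub>K\<^esub> \<one>\<^bsub>K\<^esub> \<in> Units K) \<and>
      module_basis K Q J ej' \<and>
      dual_family K P J ej (\<lambda>j. iota K d W \<chi> E (ej' j)))"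
proof -
  have K: "cring K" using assms(6) by (simp add: module_def)
  interpret perm_character K d W \<chi>
    by (intro perm_character.intro perm_character_axioms.intro K assms(3,5))
  interpret IC: perm_character K d W "inv_char K \<chi>" by (rule perm_character_inv_char)
  note E = assms(6)
  note D = module_dual[OF E]
  have P: "module K P" unfolding P_def by (rule module_chi_power[OF E])
  have Q: "module K Q" unfolding Q_def by (rule IC.module_chi_power[OF D])
  have e: "e \<in> {1..n} \<rightarrow> carrier E" using assms(7) by (simp add: module_basis_def)
  have e': "e' \<in> {1..n} \<rightarrow> carrier (dual_module K E)" using assms(8) by (simp add: dual_family_def)
  let ?\<iota> = "iota K d W \<chi> E"
  let ?f = "chi_basis K d W (inv_char K \<chi>) (dual_module K E) e'"
  let ?c = "\<lambda>j. [card (index_stabilizer d W j)] \<cdot>\<^bsub>K\<^esub> \<one>\<^bsub>K\<^esub>"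
  have c: "?c j \<in> Units K" for j by (rule card_index_stabilizer_Units[OF assms(4)])
  have ej': "ej' = (\<lambda>j. inv\<^bsub>K\<^esub> (?c j) \<odot>\<^bsub>Q\<^esub> ?f j)"
    by (simp add: ej'_def Q_def scaled_dual_chi_basis_def fun_eq_iff)
  have J: "j \<in> tuples d {1..n}" if "j \<in> J" for j using that by (simp add: J_def index_set_def)
  have finJ: "finite J" using J by (intro finite_subset[OF _ finite_tuples[of "{1..n}" d]]) auto
  have genP: "generates K P (ej ` J)"
    unfolding P_def ej_def J_def
    by (rule generates_chi_basis[OF assms(1,4) E module_basis_generates[OF E assms(7)]])
  \<comment> \<open>The spanning result is applied to the inverse character and to the dual family,
    which generates the dual of \<open>E\<close>; both characters have the same index set.\<close>
  have "generates K Q (?f ` J)"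
    unfolding Q_def J_def index_set_inv_char[symmetric]
    by (rule IC.generates_chi_basis[OF assms(1,4) D generates_dual_family[OF E assms(7,8)]])
  then have genQ: "generates K Q (ej' ` J)"
    unfolding ej' by (rule generates_smult_Units[OF Q]) (use c in auto)
  have \<iota>: "?\<iota> \<in> module_hom K Q (dual_module K P)"
    unfolding P_def Q_def by (rule iota_hom[OF E])
  \<comment> \<open>Matching indices pair to the order of the stabilizer, and the scaling in
    \<open>ej'\<close> divides by exactly this unit.\<close>
  have \<delta>: "?\<iota> (ej' j) (ej i) = (if i = j then \<one>\<^bsub>K\<^esub> else \<zero>\<^bsub>K\<^esub>)" if i: "i \<in> J" and j: "j \<in> J" for i j
  proof -
    have ejP: "ej i \<in> carrier P"
      unfolding ej_def P_def by (rule chi_basis_closed[OF E e J[OF i]])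
    have "?f j \<in> carrier Q" unfolding Q_def by (rule IC.chi_basis_closed[OF D e' J[OF j]])
    then have "?\<iota> (ej' j) (ej i) = inv\<^bsub>K\<^esub> (?c j) \<otimes>\<^bsub>K\<^esub> ?\<iota> (?f j) (ej i)"
      using module_hom_smult[OF \<iota> Units_inv_closed[OF c]] ejP by (simp add: ej')
    also have "?\<iota> (?f j) (ej i) = schur_pairing E (\<lambda>t\<in>{1..d}. e (i t)) (\<lambda>t\<in>{1..d}. e' (j t))"
      unfolding ej_def chi_basis_def
      by (rule iota_chi_prod[OF E basis_tuple_closed[OF e J[OF i]] basis_tuple_closed[OF e' J[OF j]]])
    also have "\<dots> = (if i = j then ?c j else \<zero>\<^bsub>K\<^esub>)"
      by (rule schur_pairing_basis[OF assms(7,8) i[unfolded J_def] j[unfolded J_def]])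
    finally show ?thesis using c[of j] by simp
  qed
  \<comment> \<open>Both bases, the isomorphism and the duality follow together from the Kronecker
    relation \<open>\<delta>\<close>.\<close>
  have dual: "module_basis K P J ej" "module_basis K Q J ej'" "?\<iota> \<in> module_iso K Q (dual_module K P)"
    "dual_family K P J ej (\<lambda>j. ?\<iota> (ej' j))"
    by (rule dual_generators[OF P Q finJ genP genQ \<iota> \<delta>]; assumption)+
  have B: "B \<in> bilinear_forms K P Q" unfolding B_def P_def Q_def by (rule schur_form(1)[OF E])
  have \<iota>_eq: "?\<iota> = associated_map P Q B" by (simp add: iota_def P_def Q_def B_def)
  have ns0: "nonsingular_form K (chi_power0 K E) (chi_power0 K (dual_module K E)) (schur_form0 K E)"
    unfolding chi_power0_def schur_form0_def by (rule regular_nonsingular[OF K])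
  have ex1: "\<exists>!B'. B' \<in> bilinear_forms K P Q \<and> satisfies_schur_formula K d W \<chi> E B'"
    unfolding P_def Q_def by (rule schur_form_ex1[OF E])
  have nat: "?\<iota> (chi_power_map K d W (inv_char K \<chi>) (dual_module K F) (dual_module K E)
        (transpose_map K E F u) y) =
      transpose_map K P (chi_power K d W \<chi> F) (chi_power_map K d W \<chi> E F u) (iota K d W \<chi> F y)"
    if "finite_free_module K F" "u \<in> module_hom K E F"
      "y \<in> carrier (chi_power K d W (inv_char K \<chi>) (dual_module K F))"
    for F :: "('k, 'f, 'q) module_scheme" and u y
    unfolding P_def using that by (intro iota_natural[OF E]) (auto simp: finite_free_module_def)
  \<comment> \<open>In degree 0 every \<open>u\<close> induces the identity of \<open>K\<close>, so
    both sides are the form that multiplies by \<open>y\<close>.\<close>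
  have nat0: "iota0 K E (chi_power_map0 K (dual_module K F) (dual_module K E) (transpose_map K E F u) y) =
      transpose_map K (chi_power0 K E) (chi_power0 K F) (chi_power_map0 K E F u) (iota0 K F y)"
    if y: "y \<in> carrier (chi_power0 K (dual_module K F))"
    for F :: "('k, 'f, 'q) module_scheme" and u y
  proof -
    let ?R = "regular_module K"
    have y': "y \<in> carrier K" using y by (simp add: chi_power0_def)
    have "iota0 K F \<in> module_hom K ?R (dual_module K ?R)"
      using regular_nonsingular[OF K]
      by (simp add: nonsingular_form_def module_iso_def iota0_def chi_power0_def schur_form0_def)
    then have cl: "iota0 K F y \<in> carrier (dual_module K ?R)"
      by (rule module_hom_closed) (simp add: y')
    have F: "iota0 K F y = (\<lambda>k\<in>carrier K. k \<otimes>\<^bsub>K\<^esub> y)" and E': "iota0 K E y = (\<lambda>k\<in>carrier K. k \<otimes>\<^bsub>K\<^esub> y)"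
      using y' by (auto simp: iota0_def associated_map_def chi_power0_def schur_form0_def intro!: restrict_ext)
    have "iota0 K E (chi_power_map0 K (dual_module K F) (dual_module K E) (transpose_map K E F u) y)
        = (\<lambda>k\<in>carrier K. k \<otimes>\<^bsub>K\<^esub> y)"
      using y' by (simp add: chi_power_map0_def E')
    also have "\<dots> = transpose_map K ?R ?R (chi_power_map0 K E F u) (iota0 K F y)"
    proof
      fix k
      show "(\<lambda>k\<in>carrier K. k \<otimes>\<^bsub>K\<^esub> y) k = transpose_map K ?R ?R (chi_power_map0 K E F u) (iota0 K F y) k"
        \<comment> \<open>The outer restriction is removed before \<open>iota0 K F y\<close> is
          expanded, since \<open>cl\<close> speaks of the unexpanded form.\<close>
        unfolding transpose_map_def restrict_apply'[OF cl] unfolding F by (simp add: chi_power_map0_def)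
    qed
    finally show ?thesis by (simp only: chi_power0_def)
  qed
  have iota0: "iota0 K E \<in> module_iso K (chi_power0 K (dual_module K E)) (dual_module K (chi_power0 K E))"
    using ns0 unfolding nonsingular_form_def iota0_def by blast
  have can: "B (x, y) = canonical_form K P (x, ?\<iota> y)" if "x \<in> carrier P" "y \<in> carrier Q" for x y
  proof -
    have "canonical_form K P (x, ?\<iota> y) = ?\<iota> y x"
      using that(1) module_hom_closed[OF \<iota> that(2)] by (simp add: canonical_form_def del: dual_module_simps)
    also have "\<dots> = B (x, y)" unfolding \<iota>_eq associated_map_def using that by simp
    finally show ?thesis by simp
  qed
  have ns: "nonsingular_form K P Q B"
    using B dual(3) unfolding nonsingular_form_def \<iota>_eq by blast
  show ?thesis
  proof (intro conjI)
    show "\<forall>(F :: ('k, 'f, 'q) module_scheme) u.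
        finite_free_module K F \<longrightarrow> u \<in> module_hom K E F \<longrightarrow>
          (\<forall>y \<in> carrier (chi_power K d W (inv_char K \<chi>) (dual_module K F)).
            ?\<iota> (chi_power_map K d W (inv_char K \<chi>) (dual_module K F) (dual_module K E)
                (transpose_map K E F u) y) =
            transpose_map K P (chi_power K d W \<chi> F) (chi_power_map K d W \<chi> E F u)
              (iota K d W \<chi> F y)) \<and>
          (\<forall>y \<in> carrier (chi_power0 K (dual_module K F)).
            iota0 K E
              (chi_power_map0 K (dual_module K F) (dual_module K E) (transpose_map K E F u) y) =
            transpose_map K (chi_power0 K E) (chi_power0 K F) (chi_power_map0 K E F u)
              (iota0 K F y))"
      by (intro allI impI conjI ballI) (erule (2) nat, erule nat0)
    show "\<forall>x\<in>carrier P. \<forall>y\<in>carrier Q. B (x, y) = canonical_form K P (x, ?\<iota> y)"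
      by (intro ballI) (rule can)
    show "\<forall>j\<in>J. ?c j \<in> Units K" by (intro ballI c)
  qed (rule ex1 ns ns0 iota0 dual)+
qed

end
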